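(* Let $m\ge 2$ and $\alpha\ge 2$ be integers, let $C=\mathrm{diag}(\alpha,\alpha,\dots,\alpha)$ be the $m\times m$ diagonal matrix, and let $A(x,y)=A(\lambda_1x,\dots,\lambda_mx,y)$, with $\lambda_i\in\mathbb C\setminus\{0\}$, be the quiver A-polynomial of the (diagonal) quiver with adjacency matrix $C$. Then $A(x,y)$ is tempered. Moreover, all its face polynomials factorize into binomials.
   Context: Quiver A-polynomial. For a symmetric matrix $C=(C_{i,j})_{i,j=1}^m$ with integer entries put $$F_0=y-z_1\cdots z_m,\qquad F_i=z_i-1+(-1)^{C_{i,i}}x_i\prod_{j=1}^m z_j^{C_{i,j}}\quad(i=1,\dots,m).$$ The quiver resultant $A(x_1,\dots,x_m,y)$ is the resultant of $F_0,F_1,\dots,F_m$ with respect to $z_1,\dots,z_m$: the irreducible polynomial, unique up to sign, which vanishes whenever $F_0,\dots,F_m$ have a common root with respect to $z_1,\dots,z_m$ (with all $z_i\neq0$). The quiver A-polynomial is its two-variable specialization $A(x,y)=A(\lambda_1x,\dots,\lambda_mx,y)$ with $\lambda_i\in\mathbb C\setminus\{0\}$. Face polynomials. The Newton polygon of $P(x,y)=\sum c_{i,j}x^iy^j$ is the convex hull of its monomials, regarded as lattice points $(i,j)$. The face polynomial of an edge $e$ is the sum of all monomials of $P$ lying on $e$; it is written as a one-variable polynomial $f_e(\tau)$ by labelling the monomials on $e$ consecutively from one endpoint of $e$ to the other and replacing the monomials $x^iy^j$ by the successive powers $1,\tau,\tau^2,\dots$, keeping the coefficients. $P$ is tempered if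 all its face polynomials have roots only on the unit circle.
   Formalization: Temperedness is claimed only when all |λ_i| = 1; for other nonzero λ_i it fails (m = α = 2, λ_1 = λ_2 = L gives a face polynomial with roots ±1/L). Factorization into binomials is proved for all nonzero λ_i, with coefficients in Z[λ_1,…,λ_m]. *)

theory Defs
  imports
    "HOL-Analysis.Analysis"
    "HOL-Library.Poly_Mapping"
    "HOL-Computational_Algebra.Computational_Algebra"
begin

section \<open>Integer polynomials in several variables\<close>

text \<open>A monomial maps the index of a variable to its exponent. Variables are indexed by
  natural numbers; below, index 0 is \<open>y\<close> and the indices \<open>1, \<dots>, m\<close> are \<open>x\<^sub>1, \<dots>, x\<^sub>m\<close>.\<close>

type_synonym int_mpoly = "(nat \<Rightarrow>\<^sub>0 nat) \<Rightarrow>\<^sub>0 int"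

definition mpoly_vars :: "int_mpoly \<Rightarrow> nat set" where
  "mpoly_vars p = (\<Union>t\<in>Poly_Mapping.keys p. Poly_Mapping.keys t)"

definition mpoly_eval :: "int_mpoly \<Rightarrow> (nat \<Rightarrow> 'a::comm_ring_1) \<Rightarrow> 'a" where
  "mpoly_eval p v =
     (\<Sum>t\<in>Poly_Mapping.keys p. of_int (Poly_Mapping.lookup p t) *
        (\<Prod>i\<in>Poly_Mapping.keys t. v i ^ Poly_Mapping.lookup t i))"


section \<open>The quiver A-polynomial\<close>

text \<open>The entries of \<open>C\<close> may be negative, so \<open>F\<^sub>i\<close> is a Laurent polynomial in the \<open>z\<^sub>j\<close> and
  is only used where all \<open>z\<^sub>j\<close> are nonzero.\<close>

definition quiver_F0 :: "nat \<Rightarrow> complex \<Rightarrow> (nat \<Rightarrow> complex) \<Rightarrow> complex" where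
  "quiver_F0 m y z = y - (\<Prod>j\<in>{1..m}. z j)"

definition quiver_F ::
  "nat \<Rightarrow> (nat \<Rightarrow> nat \<Rightarrow> int) \<Rightarrow> nat \<Rightarrow> (nat \<Rightarrow> complex) \<Rightarrow> (nat \<Rightarrow> complex) \<Rightarrow> complex" where
  "quiver_F m C i x z =
     z i - 1 + (- 1) powi (C i i) * x i * (\<Prod>j\<in>{1..m}. z j powi (C i j))"

text \<open>This characterises the resultant up to sign, hence it is a predicate. Irreducibility is
  over the integers; the factors of a polynomial involve no variables that it does not involve
  itself, so it does not matter that the type has further variables.\<close>

definition is_quiver_resultant :: "nat \<Rightarrow> (nat \<Rightarrow> nat \<Rightarrow> int) \<Rightarrow> int_mpoly \<Rightarrow> bool" where
  "is_quiver_resultant m C A \<longleftrightarrow>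
     irreducible A \<and> mpoly_vars A \<subseteq> {0..m} \<and>
     (\<forall>x y z. (\<forall>i\<in>{1..m}. z i \<noteq> 0) \<and> quiver_F0 m y z = 0 \<and>
              (\<forall>i\<in>{1..m}. quiver_F m C i x z = 0)
        \<longrightarrow> mpoly_eval A (\<lambda>k. if k = 0 then y else x k) = 0)"

text \<open>Elements of \<open>\<complex>[x,y]\<close> are polynomials in \<open>y\<close> whose coefficients are polynomials in \<open>x\<close>.\<close>

definition quiver_A_poly :: "(nat \<Rightarrow> complex) \<Rightarrow> int_mpoly \<Rightarrow> complex poly poly" where
  "quiver_A_poly lam A = mpoly_eval A (\<lambda>k. if k = 0 then [:0, 1:] else [:[:0, lam k:]:])"


section \<open>Newton polygon and face polynomials\<close>

definition coeff2 :: "complex poly poly \<Rightarrow> nat \<Rightarrow> nat \<Rightarrow> complex" where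
  "coeff2 P i j = coeff (coeff P j) i"

definition newton_polygon :: "complex poly poly \<Rightarrow> (real \<times> real) set" where
  "newton_polygon P = convex hull {(real i, real j) |i j. coeff2 P i j \<noteq> 0}"

text \<open>As \<open>u\<close> and \<open>v\<close> are coprime, the points \<open>(a + k u, b + k v)\<close> with \<open>k \<le> n\<close> are exactly the
  lattice points on the edge \<open>e\<close>, listed from one endpoint to the other. Lattice points whose
  monomial does not occur in \<open>P\<close> are counted with coefficient 0. Each edge has two face
  polynomials, one for each orientation, with mutually inverse roots.\<close>

definition is_face_poly ::
  "complex poly poly \<Rightarrow> (real \<times> real) set \<Rightarrow> complex poly \<Rightarrow> bool" where
  "is_face_poly P e f \<longleftrightarrow>
     e edge_of newton_polygon P \<and>
     (\<exists>(a::nat) (b::nat) (u::int) (v::int) (n::nat). coprime u v \<and>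
        e = closed_segment (real a, real b)
              (real a + real n * real_of_int u, real b + real n * real_of_int v) \<and>
        f = (\<Sum>k\<le>n. monom (coeff2 P (nat (int a + int k * u)) (nat (int b + int k * v))) k))"

definition tempered :: "complex poly poly \<Rightarrow> bool" where
  "tempered P \<longleftrightarrow>
     (\<forall>e f. is_face_poly P e f \<longrightarrow> (\<forall>\<tau>. poly f \<tau> = 0 \<longrightarrow> cmod \<tau> = 1))"


section \<open>Factorization into binomials\<close>

definition binomial_poly :: "complex poly \<Rightarrow> bool" where
  "binomial_poly g \<longleftrightarrow> card {k. coeff g k \<noteq> 0} = 2"

text \<open>The subring \<open>\<int>[\<lambda>\<^sub>1, \<dots>, \<lambda>\<^sub>m]\<close> of \<open>\<complex>\<close>, which contains the coefficients of \<open>A(x,y)\<close>.\<close>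

definition int_adjoin :: "nat \<Rightarrow> (nat \<Rightarrow> complex) \<Rightarrow> complex set" where
  "int_adjoin m lam = {mpoly_eval p lam |p. mpoly_vars p \<subseteq> {1..m}}"

text \<open>The factors are required to have coefficients in a given ring \<open>R\<close>: over \<open>\<complex>\<close> every
  nonconstant polynomial with nonzero constant term is a product of binomials of degree 1.\<close>

definition factors_into_binomials :: "complex set \<Rightarrow> complex poly \<Rightarrow> bool" where
  "factors_into_binomials R f \<longleftrightarrow>
     (\<exists>gs. (\<forall>g\<in>set gs. binomial_poly g \<and> (\<forall>k. coeff g k \<in> R)) \<and> f = prod_list gs)"

end

theory Submission
  imports Defs "Jordan_Normal_Form.Char_Poly"
begin

text \<open>
  With \<open>w\<^sub>i = 1 / z\<^sub>i\<close> the equation \<open>F\<^sub>i = 0\<close> becomes the monic trinomial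
  \<open>w\<^sub>i\<^sup>\<alpha> = w\<^sub>i\<^sup>\<alpha>\<^sup>-\<^sup>1 + (- 1)\<^sup>\<alpha> x\<^sub>i\<close>. Multiplication by \<open>w\<^sub>1 \<cdots> w\<^sub>m\<close> on the monomials with all
  exponents below \<open>\<alpha>\<close> is a matrix over \<open>\<int>[x\<^sub>1, \<dots>, x\<^sub>m]\<close>, and the reversed characteristic polynomial
  \<open>R\<close> of this matrix is the product of the factors \<open>1 - y w\<^sub>1 \<cdots> w\<^sub>m\<close> over all choices of roots.
  At generic points these products of roots are distinct, so division by the monic polynomial
  shows that \<open>R\<close> divides \<open>A\<close>; as \<open>A\<close> is irreducible, \<open>A = \<plusminus> R\<close>.

  The face polynomial of an edge is, up to a monomial, the leading term of \<open>A(s\<^sup>p X, s\<^sup>q Y)\<close> as \<open>s\<close>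
  tends to infinity, for a weight \<open>(p, q)\<close> that supports the edge. For \<open>x \<rightarrow> \<infinity>\<close> all roots \<open>w\<^sub>i\<close> behave like
  the \<open>\<alpha>\<close>-th roots of \<open>(- 1)\<^sup>\<alpha> x\<^sub>i\<close>. For \<open>x \<rightarrow> 0\<close> one root tends to \<open>1\<close> and the others
  behave like the \<open>(\<alpha> - 1)\<close>-th roots of \<open>- (- 1)\<^sup>\<alpha> x\<^sub>i\<close>. The limits of the factors then
  multiply up to products of binomials.
\<close>

section \<open>Evaluation of integer polynomials\<close>

text \<open>\<open>A\<close> is known only through irreducibility and its vanishing at common roots,
  so no resultant is computed: it suffices to exhibit one divisor that is not a unit. Passing to
  \<open>w = 1 / z\<close> makes the trinomials monic, which keeps the coefficients in the integer
  polynomials and makes the division exact there.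

  The obstacle to the asymptotics is that the roots have no continuous labelling. Every limit is
  therefore taken along a subsequence on which the finitely many root sequences converge. Nothing is
  lost: the product over all choices of roots does not depend on the labelling, and the leading term
  of a polynomial is a limit along the whole sequence.

  A supporting weight matters only up to a positive factor. The sign of p leaves three cases,
  normalised to p = \<alpha>, 1 - \<alpha> and 0, so that the roots grow like s, the small roots
  decay like 1/s, and the roots stay fixed. In the last case the limit has no zero with X, Y
  \<noteq> 0, so no edge has such a weight.

  All constants of the binomials are signed monomials in the numbers \<open>lam i\<close>. They lie
  in the required ring and have modulus 1 as soon as all \<open>lam i\<close> do.\<close>

lemma mpoly_eval_0 [simp]: "mpoly_eval 0 v = 0"
  by (simp add: mpoly_eval_def)

lemma mpoly_eval_single:
  "mpoly_eval (Poly_Mapping.single t c) v =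
     of_int c * (\<Prod>i\<in>Poly_Mapping.keys t. v i ^ Poly_Mapping.lookup t i)"
  by (cases "c = 0") (simp_all add: mpoly_eval_def)

lemma mpoly_eval_1 [simp]: "mpoly_eval 1 v = 1"
  using mpoly_eval_single[of 0 1 v] by simp

lemma mpoly_eval_add: "mpoly_eval (p + q) v = mpoly_eval p v + mpoly_eval q v"
  unfolding mpoly_eval_def
  by (rule setsum_keys_plus_distrib) (simp_all add: algebra_simps)

lemma int_mpoly_induct [case_names single add]:
  assumes "\<And>t c. P (Poly_Mapping.single t c)"
    and "\<And>p q. P p \<Longrightarrow> P q \<Longrightarrow> P (p + q)"
  shows "P (p :: int_mpoly)"
proof (induction p rule: update_induct)
  case const
  show ?case using assms(1)[of 0 0] by simp
next
  case (update f a b)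
  have "Poly_Mapping.update a b f = f + Poly_Mapping.single a b"
    using update(1) by (intro poly_mapping_eqI)
      (auto simp: lookup_update lookup_add lookup_single in_keys_iff when_def)
  then show ?case using assms update by metis
qed

lemma prod_keys_add:
  fixes v :: "nat \<Rightarrow> 'a::comm_ring_1"
  shows "(\<Prod>i\<in>Poly_Mapping.keys (s + t). v i ^ Poly_Mapping.lookup (s + t) i) =
   (\<Prod>i\<in>Poly_Mapping.keys s. v i ^ Poly_Mapping.lookup s i) *
   (\<Prod>i\<in>Poly_Mapping.keys t. v i ^ Poly_Mapping.lookup t i)"
proof -
  let ?K = "Poly_Mapping.keys s \<union> Poly_Mapping.keys t"
  have *: "(\<Prod>i\<in>Poly_Mapping.keys r. v i ^ Poly_Mapping.lookup r i) =
      (\<Prod>i\<in>?K. v i ^ Poly_Mapping.lookup r i)" if "Poly_Mapping.keys r \<subseteq> ?K" for r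
    using that by (intro prod.mono_neutral_left) (auto simp: in_keys_iff)
  show ?thesis
    unfolding *[OF Poly_Mapping.keys_add] *[OF Un_upper1] *[OF Un_upper2]
    by (simp add: lookup_add power_add prod.distrib)
qed

lemma mpoly_eval_mult: "mpoly_eval (p * q) v = mpoly_eval p v * mpoly_eval q v"
proof (induction p rule: int_mpoly_induct)
  case (single t c)
  show ?case
  proof (induction q rule: int_mpoly_induct)
    case (single s d)
    show ?case
      by (simp add: mult_single mpoly_eval_single prod_keys_add algebra_simps)
  next
    case (add p q)
    then show ?case by (simp add: distrib_left mpoly_eval_add)
  qed
next
  case (add p q)
  then show ?case by (simp add: distrib_right mpoly_eval_add)
qed

lemma mpoly_eval_hom: "comm_ring_hom (\<lambda>p. mpoly_eval p v)"
  by unfold_locales (simp_all add: mpoly_eval_add mpoly_eval_mult)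

lemma mpoly_eval_comp_hom:
  fixes v :: "nat \<Rightarrow> 'a::comm_ring_1"
  assumes "comm_ring_hom (h :: 'a \<Rightarrow> 'b::comm_ring_1)"
  shows "h (mpoly_eval p v) = mpoly_eval p (\<lambda>k. h (v k))"
proof -
  interpret comm_ring_hom h by fact
  show ?thesis unfolding mpoly_eval_def by (simp add: hom_distribs)
qed

definition mvar :: "nat \<Rightarrow> int_mpoly" where
  "mvar i = Poly_Mapping.single (Poly_Mapping.single i 1) 1"

lemma mpoly_eval_mvar [simp]: "mpoly_eval (mvar i) v = v i"
  by (simp add: mvar_def mpoly_eval_single)

lemma mvar_power: "mvar i ^ n = Poly_Mapping.single (Poly_Mapping.single i n) 1"
  by (induction n) (simp_all add: mvar_def mult_single flip: single_add)

lemma prod_mvar: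
  "finite I \<Longrightarrow> (\<Prod>i\<in>I. mvar i ^ e i) = Poly_Mapping.single (\<Sum>i\<in>I. Poly_Mapping.single i (e i)) 1"
  by (induction rule: finite_induct) (simp_all add: mvar_power mult_single)

lemma of_int_int_mpoly: "(of_int c :: int_mpoly) = Poly_Mapping.single 0 c"
  by (metis id_apply of_int_eq_id single_of_int)

text \<open>The target ring is the polynomial ring itself. This recovers \<open>A\<close> after it
  has been rewritten as a polynomial in y alone.\<close>

lemma mpoly_eval_mvars: "mpoly_eval p mvar = p"
proof (induction p rule: int_mpoly_induct)
  case (single t c)
  have "(\<Sum>i\<in>Poly_Mapping.keys t. Poly_Mapping.single i (Poly_Mapping.lookup t i)) = t"
    by (intro poly_mapping_eqI)
      (auto simp: lookup_sum lookup_single when_def sum.delta in_keys_iff)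
  then show ?case
    by (simp add: mpoly_eval_single prod_mvar of_int_int_mpoly mult_single)
next
  case (add p q)
  then show ?case by (simp add: mpoly_eval_add)
qed

text \<open>The coordinates are chosen one after another. Once the earlier ones are fixed so that
  the coefficient of some power of the last variable is nonzero, only finitely many values of the
  last variable are excluded. The allowed set \<open>G i x\<close> may depend on the coordinates
  below i, because genericity of \<open>x i\<close> will be a condition relative to those already
  chosen.\<close>

lemma exists_nonroot_in_infinite:
  fixes c :: "(nat \<Rightarrow> nat) \<Rightarrow> complex" and G :: "nat \<Rightarrow> (nat \<Rightarrow> complex) \<Rightarrow> complex set"
  assumes "finite K" and "\<And>t i. t \<in> K \<Longrightarrow> i \<ge> n \<Longrightarrow> t i = 0" and "\<exists>t\<in>K. c t \<noteq> 0"
    and "\<And>i x. infinite (G i x)"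
    and "\<And>i x x'. (\<And>j. j < i \<Longrightarrow> x j = x' j) \<Longrightarrow> G i x = G i x'"
  shows "\<exists>x. (\<forall>i<n. x i \<in> G i x) \<and> (\<Sum>t\<in>K. c t * (\<Prod>i<n. x i ^ t i)) \<noteq> 0"
  using assms(1-3)
proof (induction n arbitrary: K c)
  case 0
  have "t = (\<lambda>_. 0)" if "t \<in> K" for t using 0(2)[OF that] by auto
  then have "K = {\<lambda>_. 0}" using 0(3) by auto
  then show ?case using 0(3) by simp
next
  case (Suc n)
  obtain t0 where t0: "t0 \<in> K" "c t0 \<noteq> 0" using Suc.prems(3) by auto
  \<comment> \<open>The terms with exponent e in the last variable, with that exponent erased so
    that the induction hypothesis for n variables applies.\<close>
  define L where "L e = (\<lambda>t. t(n := 0)) ` {t \<in> K. t n = e}" for e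
  define d where "d e s = c (s(n := e))" for e s
  have inj: "inj_on (\<lambda>t. t(n := 0)) {t \<in> K. t n = e}" for e
    by (rule inj_onI) (metis (mono_tags) fun_upd_triv fun_upd_upd mem_Collect_eq)
  have sumL: "(\<Sum>s\<in>L e. d e s * (\<Prod>i<n. x i ^ s i)) =
      (\<Sum>t\<in>{t \<in> K. t n = e}. c t * (\<Prod>i<n. x i ^ t i))" for e x
    unfolding L_def sum.reindex[OF inj] by (rule sum.cong) (auto simp: d_def)
  have "\<exists>x. (\<forall>i<n. x i \<in> G i x) \<and> (\<Sum>s\<in>L (t0 n). d (t0 n) s * (\<Prod>i<n. x i ^ s i)) \<noteq> 0"
  proof (rule Suc.IH)
    show "finite (L (t0 n))" using Suc.prems(1) by (simp add: L_def)
    show "t i = 0" if "t \<in> L (t0 n)" "n \<le> i" for t i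
      using that Suc.prems(2) by (auto simp: L_def Suc_le_eq)
    show "\<exists>t\<in>L (t0 n). d (t0 n) t \<noteq> 0"
      using t0 by (auto simp: L_def d_def intro!: bexI[of _ t0])
  qed
  then obtain x where x: "\<And>i. i < n \<Longrightarrow> x i \<in> G i x"
    and nz: "(\<Sum>t\<in>{t \<in> K. t n = t0 n}. c t * (\<Prod>i<n. x i ^ t i)) \<noteq> 0"
    unfolding sumL by blast
  define q where "q = (\<Sum>t\<in>K. monom (c t * (\<Prod>i<n. x i ^ t i)) (t n))"
  have "coeff q (t0 n) = (\<Sum>t\<in>K. if t n = t0 n then c t * (\<Prod>i<n. x i ^ t i) else 0)"
    by (simp add: q_def coeff_sum)
  also have "\<dots> = (\<Sum>t\<in>{t \<in> K. t n = t0 n}. c t * (\<Prod>i<n. x i ^ t i))"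
    using Suc.prems(1) by (simp add: sum.inter_filter)
  finally have "q \<noteq> 0" using nz by auto
  then have "finite {z. poly q z = 0}" by (rule poly_roots_finite)
  then obtain z where z: "z \<in> G n x" "poly q z \<noteq> 0"
    using assms(4)[of n x] by (metis (mono_tags, lifting) finite_subset mem_Collect_eq subsetI)
  let ?x = "x(n := z)"
  have G: "G i ?x = G i x" if "i \<le> n" for i
    using that by (intro assms(5)) auto
  have "(\<Sum>t\<in>K. c t * (\<Prod>i<Suc n. ?x i ^ t i)) = poly q z"
    unfolding q_def poly_sum by (rule sum.cong) (auto simp: poly_monom)
  moreover have "\<forall>i<Suc n. ?x i \<in> G i ?x"
    using x z(1) G by (auto simp: less_Suc_eq)
  ultimately show ?case using z(2) by metis
qed

lemma mpoly_eval_nonzero_in_infinite: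
  fixes G :: "nat \<Rightarrow> (nat \<Rightarrow> complex) \<Rightarrow> complex set"
  assumes "p \<noteq> 0" and "\<And>i x. infinite (G i x)"
    and "\<And>i x x'. (\<And>j. j < i \<Longrightarrow> x j = x' j) \<Longrightarrow> G i x = G i x'"
  shows "\<exists>x. (\<forall>i\<le>m. x i \<in> G i x) \<and> mpoly_eval p x \<noteq> 0"
proof -
  have "finite (mpoly_vars p)" by (simp add: mpoly_vars_def)
  then obtain N where N: "mpoly_vars p \<subseteq> {..<N}"
    by (meson finite_nat_iff_bounded)
  \<comment> \<open>Large enough for the variables of p and also for all indices up to m, which are
    to be constrained even where p does not involve them.\<close>
  define n where "n = Suc m + N"
  have n: "i < n" if "i \<in> mpoly_vars p" for i
    using that N by (auto simp: n_def)
  have nm: "n > m" by (simp add: n_def)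
  have n': "Poly_Mapping.lookup t i = 0" if "t \<in> Poly_Mapping.keys p" "i \<ge> n" for t i
    using that n[of i] by (force simp: mpoly_vars_def in_keys_iff)
  let ?K = "Poly_Mapping.lookup ` Poly_Mapping.keys p"
  let ?c = "\<lambda>t. of_int (Poly_Mapping.lookup p (Abs_poly_mapping t)) :: complex"
  obtain t where t: "t \<in> Poly_Mapping.keys p" using assms(1) by (metis all_not_in_conv keys_eq_empty)
  have "\<exists>x. (\<forall>i<n. x i \<in> G i x) \<and> (\<Sum>t\<in>?K. ?c t * (\<Prod>i<n. x i ^ t i)) \<noteq> 0"
  proof (rule exists_nonroot_in_infinite)
    show "\<exists>t\<in>?K. ?c t \<noteq> 0" using t
      by (intro bexI[of _ "Poly_Mapping.lookup t"] imageI) (simp_all add: in_keys_iff lookup_inverse)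
    show "t i = 0" if "t \<in> ?K" "i \<ge> n" for t i using that n' by auto
    show "infinite (G i x)" for i x by (rule assms(2))
    show "G i x = G i x'" if "\<And>j. j < i \<Longrightarrow> x j = x' j" for i x x'
      using that by (rule assms(3))
  qed simp
  then obtain x where x: "\<forall>i<n. x i \<in> G i x" "(\<Sum>t\<in>?K. ?c t * (\<Prod>i<n. x i ^ t i)) \<noteq> 0"
    by blast
  have "(\<Sum>t\<in>?K. ?c t * (\<Prod>i<n. x i ^ t i)) = mpoly_eval p x"
    unfolding mpoly_eval_def
  proof (subst sum.reindex)
    show "inj_on Poly_Mapping.lookup (Poly_Mapping.keys p)"
      by (metis inj_on_inverseI lookup_inverse)
    have "(\<Prod>i<n. x i ^ Poly_Mapping.lookup t i) =
        (\<Prod>i\<in>Poly_Mapping.keys t. x i ^ Poly_Mapping.lookup t i)" if "t \<in> Poly_Mapping.keys p" for t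
    proof (rule prod.mono_neutral_right)
      show "Poly_Mapping.keys t \<subseteq> {..<n}" using that n by (force simp: mpoly_vars_def)
    qed (auto simp: in_keys_iff)
    then show "sum ((\<lambda>t. ?c t * (\<Prod>i<n. x i ^ t i)) \<circ> Poly_Mapping.lookup) (Poly_Mapping.keys p) =
      (\<Sum>t\<in>Poly_Mapping.keys p. of_int (Poly_Mapping.lookup p t) *
        (\<Prod>i\<in>Poly_Mapping.keys t. x i ^ Poly_Mapping.lookup t i))"
      by (simp add: lookup_inverse)
  qed
  then show ?thesis using x nm by (intro exI[of _ x]) auto
qed

text \<open>At an integer point p and its inverse take integer values with product 1, so (p - 1)(p +
  1) vanishes at every integer point. A nonzero polynomial does not, as the integers are infinite,
  and the ring has no zero divisors.\<close>

lemma int_mpoly_unit: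
  fixes p :: int_mpoly
  assumes "p dvd 1"
  shows "p = 1 \<or> p = -1"
proof -
  obtain q where q: "p * q = 1" using assms by (metis dvdE)
  interpret e: comm_ring_hom "\<lambda>p. mpoly_eval p v" for v :: "nat \<Rightarrow> 'a::comm_ring_1"
    by (rule mpoly_eval_hom)
  have "(p - 1) * (p + 1) = 0"
  proof (rule ccontr)
    assume "(p - 1) * (p + 1) \<noteq> 0"
    have "finite (mpoly_vars ((p - 1) * (p + 1)))" by (simp add: mpoly_vars_def)
    then obtain n where n: "\<And>i. i \<in> mpoly_vars ((p - 1) * (p + 1)) \<Longrightarrow> i \<le> n"
      by (meson finite_nat_set_iff_bounded_le)
    have "infinite (range (of_int :: int \<Rightarrow> complex))"
      by (metis finite_imageD infinite_UNIV_int inj_onI of_int_eq_iff)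
    then have "infinite (\<int> :: complex set)" by (simp add: Ints_def)
    then obtain x where x: "\<forall>i\<le>n. x i \<in> (\<int> :: complex set)"
      and nz: "mpoly_eval ((p - 1) * (p + 1)) x \<noteq> 0"
      using mpoly_eval_nonzero_in_infinite[OF \<open>(p - 1) * (p + 1) \<noteq> 0\<close>, of "\<lambda>_ _. \<int>" n] by blast
    define z where "z i = (SOME k. x i = of_int k)" for i
    have z: "x i = of_int (z i)" if "i \<le> n" for i
      using x that unfolding z_def by (metis (mono_tags, lifting) Ints_cases someI_ex)
    have "mpoly_eval ((p - 1) * (p + 1)) x = mpoly_eval ((p - 1) * (p + 1)) (\<lambda>i. of_int (z i) :: complex)"
      unfolding mpoly_eval_def
      by (intro sum.cong prod.cong arg_cong2[where f = "(*)"] refl arg_cong2[where f = "(^)"])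
        (auto intro!: z n simp: mpoly_vars_def)
    also have "\<dots> = of_int (mpoly_eval ((p - 1) * (p + 1)) z)"
      by (rule mpoly_eval_comp_hom[symmetric]) (unfold_locales, auto)
    finally have "mpoly_eval ((p - 1) * (p + 1)) z \<noteq> 0" using nz by auto
    moreover have "mpoly_eval p z * mpoly_eval q z = 1"
      using q by (metis e.hom_mult e.hom_one)
    then have "mpoly_eval p z = 1 \<or> mpoly_eval p z = -1"
      by (metis zmult_eq_1_iff)
    ultimately show False by (auto simp: e.hom_mult e.hom_minus e.hom_add)
  qed
  then show ?thesis by (simp add: eq_neg_iff_add_eq_0)
qed

section \<open>Roots of the trinomials and the polynomial of their products\<close>

text \<open>Roots are listed with multiplicity, so products over all choices of roots stay correct
  where roots coincide. As an identity in w, the condition passes to limits of c and r.\<close>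

definition trinomial_roots :: "nat \<Rightarrow> complex \<Rightarrow> (nat \<Rightarrow> complex) \<Rightarrow> bool" where
  "trinomial_roots \<alpha> c r \<longleftrightarrow> (\<forall>w. (\<Prod>j<\<alpha>. w - r j) = w ^ \<alpha> - w ^ (\<alpha> - 1) - (- 1) ^ \<alpha> * c)"

definition index_set :: "nat \<Rightarrow> nat \<Rightarrow> (nat \<Rightarrow> nat) set" where
  "index_set m \<alpha> = PiE {1..m} (\<lambda>_. {..<\<alpha>})"

lemma finite_index_set [simp]: "finite (index_set m \<alpha>)"
  by (auto simp: index_set_def intro: finite_PiE)

lemma card_index_set: "card (index_set m \<alpha>) = \<alpha> ^ m"
  by (simp add: index_set_def card_PiE)

lemma trinomial_roots_exist:
  assumes "\<alpha> \<ge> 1"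
  shows "\<exists>r. trinomial_roots \<alpha> c r"
proof -
  define p :: "complex poly" where "p = monom 1 \<alpha> - monom 1 (\<alpha> - 1) - [:(- 1) ^ \<alpha> * c:]"
  have p_lead: "coeff p \<alpha> = 1" using assms by (simp add: p_def coeff_pCons split: nat.splits)
  have "degree p \<le> \<alpha>"
    unfolding p_def by (intro degree_diff_le degree_monom_le order.trans[OF degree_monom_le]) auto
  then have deg: "degree p = \<alpha>" using p_lead by (metis le_degree le_antisym zero_neq_one)
  then have "p \<noteq> 0" using p_lead by auto
  then obtain A where A: "size A = degree p" "p = Polynomial.smult (lead_coeff p) (\<Prod>x\<in>#A. [:-x, 1:])"
    using alg_closed_imp_factorization by blast
  obtain xs where xs: "mset xs = A" using ex_mset by blast
  have len: "length xs = \<alpha>" using A(1) deg xs by auto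
  have "p = (\<Prod>x\<leftarrow>xs. [:-x, 1:])"
    using A(2) p_lead deg unfolding xs[symmetric] by (simp flip: prod_mset_prod_list)
  also have "\<dots> = (\<Prod>j<\<alpha>. [:- (xs ! j), 1:])"
    using len by (simp add: prod.list_conv_set_nth atLeast0LessThan)
  finally have "poly p w = (\<Prod>j<\<alpha>. w - xs ! j)" for w
    by (simp add: poly_prod)
  then show ?thesis
    by (intro exI[of _ "\<lambda>j. xs ! j"]) (auto simp: trinomial_roots_def p_def poly_monom dest: sym)
qed

lemma trinomial_roots_root:
  assumes "trinomial_roots \<alpha> c r" "j < \<alpha>"
  shows "r j ^ \<alpha> = r j ^ (\<alpha> - 1) + (- 1) ^ \<alpha> * c"
proof -
  have "(\<Prod>i<\<alpha>. r j - r i) = 0" using assms(2) by (intro prod_zero) auto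
  then have "r j ^ \<alpha> - r j ^ (\<alpha> - 1) - (- 1) ^ \<alpha> * c = 0"
    using assms(1) unfolding trinomial_roots_def by metis
  then show ?thesis by (simp add: algebra_simps)
qed

lemma trinomial_roots_nonzero:
  assumes "trinomial_roots \<alpha> c r" "j < \<alpha>" "\<alpha> \<ge> 2" "c \<noteq> 0"
  shows "r j \<noteq> 0"
  using trinomial_roots_root[OF assms(1,2)] assms(3,4) by (auto simp: power_0_left split: if_splits)

text \<open>The vector of monomials in the w i is an eigenvector of the multiplication matrix with
  eigenvalue w 1 ... w m. Only the fact that these products are roots is obtained here; that they
  account for all roots with multiplicity follows later from generic points and continuity.\<close>

lemma exists_root_product_poly:
  assumes "\<alpha> \<ge> 1"
  shows "\<exists>T :: int_mpoly poly. degree T = \<alpha> ^ m \<and> lead_coeff T = 1 \<and>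
    (\<forall>x w. (\<forall>i\<in>{1..m}. w i ^ \<alpha> = w i ^ (\<alpha> - 1) + (- 1) ^ \<alpha> * x i) \<longrightarrow>
       poly (map_poly (\<lambda>p. mpoly_eval p x) T) (\<Prod>i\<in>{1..m}. w i :: complex) = 0)"
proof -
  let ?N = "\<alpha> ^ m"
  \<comment> \<open>The coefficient of the e'-th power in w i times the e-th power of w i, reduced
    by the trinomial: a companion matrix whose last row holds the relation.\<close>
  define cf :: "nat \<Rightarrow> nat \<Rightarrow> nat \<Rightarrow> int_mpoly" where
    "cf i e e' = (if e + 1 < \<alpha> then (if e' = e + 1 then 1 else 0)
       else (if e' = \<alpha> - 1 then 1 else 0) + (if e' = 0 then (- 1) ^ \<alpha> * mvar i else 0))" for i e e'
  obtain b where b: "bij_betw b {0..<?N} (index_set m \<alpha>)"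
    using ex_bij_betw_nat_finite[OF finite_index_set] by (metis card_index_set)
  \<comment> \<open>The Kronecker product of the companion matrices; b enumerates the exponent
    vectors.\<close>
  define M where "M = Matrix.mat ?N ?N (\<lambda>(n, n'). \<Prod>i\<in>{1..m}. cf i (b n i) (b n' i))"
  have M: "M \<in> carrier_mat ?N ?N" by (simp add: M_def)
  have "poly (map_poly (\<lambda>p. mpoly_eval p x) (char_poly M)) (\<Prod>i\<in>{1..m}. w i) = 0"
    if w: "\<forall>i\<in>{1..m}. w i ^ \<alpha> = w i ^ (\<alpha> - 1) + (- 1) ^ \<alpha> * x i"
    for x :: "nat \<Rightarrow> complex" and w
  proof -
    interpret e: comm_ring_hom "\<lambda>p. mpoly_eval p x" by (rule mpoly_eval_hom)
    let ?A = "map_mat (\<lambda>p. mpoly_eval p x) M"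
    define v where "v = Matrix.vec ?N (\<lambda>n. \<Prod>i\<in>{1..m}. w i ^ b n i)"
    have cf: "(\<Sum>e'<\<alpha>. mpoly_eval (cf i e e') x * w i ^ e') = w i * w i ^ e"
      if "i \<in> {1..m}" "e < \<alpha>" for i e
    proof (cases "e + 1 < \<alpha>")
      case True
      then have "(\<Sum>e'<\<alpha>. mpoly_eval (cf i e e') x * w i ^ e') =
          (\<Sum>e'<\<alpha>. if e' = e + 1 then w i ^ e' else 0)"
        by (intro sum.cong) (auto simp: cf_def)
      then show ?thesis using True by simp
    next
      case False
      then have e: "e = \<alpha> - 1" using that by auto
      have "(\<Sum>e'<\<alpha>. mpoly_eval (cf i e e') x * w i ^ e') =
          (\<Sum>e'<\<alpha>. (if e' = \<alpha> - 1 then w i ^ e' else 0) + (if e' = 0 then (- 1) ^ \<alpha> * x i else 0))"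
        using False
        by (intro sum.cong)
          (auto simp: cf_def e.hom_add e.hom_mult e.hom_power e.hom_uminus distrib_right)
      also have "\<dots> = w i ^ (\<alpha> - 1) + (- 1) ^ \<alpha> * x i"
        using assms by (simp add: sum.distrib)
      also have "\<dots> = w i ^ \<alpha>" using w that by auto
      finally show ?thesis using assms e by (simp flip: power_Suc)
    qed
    have "?A *\<^sub>v v = (\<Prod>i\<in>{1..m}. w i) \<cdot>\<^sub>v v"
    proof (rule eq_vecI)
      fix n assume "n < dim_vec ((\<Prod>i\<in>{1..m}. w i) \<cdot>\<^sub>v v)"
      then have n: "n < ?N" by (simp add: v_def)
      then have bn: "b n \<in> index_set m \<alpha>" using b by (auto simp: bij_betw_def)
      have "(?A *\<^sub>v v) $ n = (\<Sum>n'\<in>{0..<?N}. mpoly_eval (\<Prod>i\<in>{1..m}. cf i (b n i) (b n' i)) x *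
          (\<Prod>i\<in>{1..m}. w i ^ b n' i))"
        using n by (simp add: M_def v_def scalar_prod_def)
      also have "\<dots> = (\<Sum>n'\<in>{0..<?N}. \<Prod>i\<in>{1..m}. mpoly_eval (cf i (b n i) (b n' i)) x * w i ^ b n' i)"
        by (simp add: e.hom_prod prod.distrib)
      also have "\<dots> = (\<Sum>k\<in>index_set m \<alpha>. \<Prod>i\<in>{1..m}. mpoly_eval (cf i (b n i) (k i)) x * w i ^ k i)"
        by (rule sum.reindex_bij_betw[OF b])
      also have "\<dots> = (\<Prod>i\<in>{1..m}. \<Sum>e'<\<alpha>. mpoly_eval (cf i (b n i) e') x * w i ^ e')"
        unfolding index_set_def by (rule prod_sum_PiE[symmetric]) auto
      also have "\<dots> = (\<Prod>i\<in>{1..m}. w i * w i ^ b n i)"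
        using bn by (intro prod.cong cf) (auto simp: index_set_def)
      finally show "(?A *\<^sub>v v) $ n = ((\<Prod>i\<in>{1..m}. w i) \<cdot>\<^sub>v v) $ n"
        using n by (simp add: v_def prod.distrib)
    qed (simp add: M_def v_def)
    moreover have "v \<noteq> 0\<^sub>v ?N"
    proof
      assume v0: "v = 0\<^sub>v ?N"
      \<comment> \<open>The exponent vector 0 gives the entry 1 even if some w i is 0.\<close>
      have "restrict (\<lambda>_. 0) {1..m} \<in> index_set m \<alpha>"
        using assms by (auto simp: index_set_def)
      then have "restrict (\<lambda>_. 0) {1..m} \<in> b ` {0..<?N}" using b by (simp add: bij_betw_def)
      then obtain n where n: "n < ?N" "b n = restrict (\<lambda>_. 0) {1..m}" by auto
      have "(\<Prod>i\<in>{1..m}. w i ^ restrict (\<lambda>_. 0) {1..m} i) = 1" by (rule prod.neutral) auto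
      then have "v $ n = 1" using n by (simp add: v_def)
      then show False using v0 n by simp
    qed
    ultimately have "eigenvalue ?A (\<Prod>i\<in>{1..m}. w i)"
      unfolding eigenvalue_def eigenvector_def by (intro exI[of _ v]) (simp add: M_def v_def)
    then have "poly (char_poly ?A) (\<Prod>i\<in>{1..m}. w i) = 0"
      using eigenvalue_root_char_poly[of ?A ?N] M by auto
    then show ?thesis using e.char_poly_hom[OF M] by simp
  qed
  then show ?thesis using degree_monic_char_poly[OF M] by (intro exI[of _ "char_poly M"]) auto
qed

section \<open>Generic points\<close>

text \<open>At a double root the derivative \<alpha> w^(\<alpha>-1) - (\<alpha>-1) w^(\<alpha>-2)
  vanishes, and w is nonzero because c is.\<close>

lemma trinomial_double_root:
  assumes "trinomial_roots \<alpha> c r" "j < \<alpha>" "j' < \<alpha>" "j \<noteq> j'" "r j = r j'" "\<alpha> \<ge> 2" "c \<noteq> 0"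
  shows "r j = (of_nat \<alpha> - 1) / of_nat \<alpha>"
proof -
  let ?w = "r j"
  let ?p = "monom 1 \<alpha> - monom 1 (\<alpha> - 1) - [:(- 1) ^ \<alpha> * c:] :: complex poly"
  have "poly ?p w = poly (\<Prod>i<\<alpha>. [:- r i, 1:]) w" for w
    using assms(1) by (simp add: poly_prod poly_monom trinomial_roots_def)
  then have "?p = (\<Prod>i<\<alpha>. [:- r i, 1:])" by (intro iffD1[OF poly_eq_poly_eq_iff] ext)
  also have "\<dots> = [:- r j, 1:] * (\<Prod>i\<in>{..<\<alpha>} - {j}. [:- r i, 1:])"
    using assms by (intro prod.remove) auto
  also have "(\<Prod>i\<in>{..<\<alpha>} - {j}. [:- r i, 1:]) =
      [:- r j', 1:] * (\<Prod>i\<in>{..<\<alpha>} - {j} - {j'}. [:- r i, 1:])"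
    using assms by (intro prod.remove) auto
  finally obtain h where "?p = [:- ?w, 1:] * ([:- ?w, 1:] * h)" using assms(5) by metis
  then have "poly (pderiv ?p) ?w = 0"
    by (simp only: pderiv_mult) simp
  then have "of_nat \<alpha> * ?w ^ (\<alpha> - 1) = of_nat (\<alpha> - 1) * ?w ^ (\<alpha> - 2)"
    by (simp add: pderiv_diff pderiv_monom pderiv_pCons poly_monom diff_diff_left numeral_2_eq_2)
  moreover have "?w ^ (\<alpha> - 1) = ?w * ?w ^ (\<alpha> - 2)"
    using assms(6) by (simp add: numeral_2_eq_2 Suc_diff_Suc flip: power_Suc)
  moreover have "?w \<noteq> 0" using trinomial_roots_nonzero assms by blast
  ultimately have "of_nat \<alpha> * ?w = of_nat (\<alpha> - 1)" by simp
  then show ?thesis using assms(6) by (simp add: field_simps of_nat_diff)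
qed

text \<open>If v and \<rho> v are both roots for the same c, eliminating c gives v (1 -
  \<rho>^\<alpha>) = 1 - \<rho>^(\<alpha>-1). For \<rho> \<noteq> 1 this determines v, and for
  \<rho> = 1 two labels share a double root. In either case v is determined by \<rho>, and c by v,
  so at most one c is excluded per ratio.\<close>

lemma finite_trinomial_root_ratio:
  fixes rt :: "complex \<Rightarrow> nat \<Rightarrow> complex"
  assumes "\<And>c. trinomial_roots \<alpha> c (rt c)" "\<alpha> \<ge> 2"
  shows "finite {c. c \<noteq> 0 \<and> (\<exists>j<\<alpha>. \<exists>j'<\<alpha>. j \<noteq> j' \<and> rt c j = \<rho> * rt c j')}" (is "finite ?S")
proof -
  \<comment> \<open>The only value that the root with label j' can have.\<close>
  define w where "w = (if \<rho> = 1 then (of_nat \<alpha> - 1) / of_nat \<alpha> else (1 - \<rho> ^ (\<alpha> - 1)) / (1 - \<rho> ^ \<alpha>))"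
  have "c = (- 1) ^ \<alpha> * (w ^ \<alpha> - w ^ (\<alpha> - 1))" if S: "c \<in> ?S" for c
  proof -
    obtain j j' where c: "c \<noteq> 0" and j: "j < \<alpha>" "j' < \<alpha>" "j \<noteq> j'" "rt c j = \<rho> * rt c j'"
      using S by auto
    let ?v = "rt c j'"
    have root: "?v ^ \<alpha> = ?v ^ (\<alpha> - 1) + (- 1) ^ \<alpha> * c"
      by (rule trinomial_roots_root[OF assms(1) j(2)])
    have root': "(\<rho> * ?v) ^ \<alpha> = (\<rho> * ?v) ^ (\<alpha> - 1) + (- 1) ^ \<alpha> * c"
      using trinomial_roots_root[OF assms(1) j(1)] j(4) by metis
    have v0: "?v \<noteq> 0" using trinomial_roots_nonzero[OF assms(1) j(2) assms(2) c] .
    have pw: "a ^ \<alpha> = a * a ^ (\<alpha> - 1)" for a :: complex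
      using assms(2) by (simp flip: power_Suc)
    have "?v = w"
    proof (cases "\<rho> = 1")
      case True
      then have "rt c j' = (of_nat \<alpha> - 1) / of_nat \<alpha>"
        using j c by (intro trinomial_double_root[OF assms(1), of j' j]) (auto simp: assms(2))
      then show ?thesis using True by (simp add: w_def)
    next
      case False
      have "?v ^ (\<alpha> - 1) * (?v - 1) = ?v ^ (\<alpha> - 1) * (\<rho> ^ \<alpha> * ?v - \<rho> ^ (\<alpha> - 1))"
      proof -
        have "?v ^ (\<alpha> - 1) * (?v - 1) = (- 1) ^ \<alpha> * c"
          using root unfolding pw[of ?v] by (simp add: algebra_simps)
        moreover have "?v ^ (\<alpha> - 1) * (\<rho> ^ \<alpha> * ?v - \<rho> ^ (\<alpha> - 1)) = (- 1) ^ \<alpha> * c"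
          using root' unfolding pw[of ?v] power_mult_distrib by (simp add: algebra_simps)
        ultimately show ?thesis by simp
      qed
      then have "?v - 1 = \<rho> ^ \<alpha> * ?v - \<rho> ^ (\<alpha> - 1)" using v0 by simp
      then have eq: "?v * (1 - \<rho> ^ \<alpha>) = 1 - \<rho> ^ (\<alpha> - 1)" by (simp add: algebra_simps)
      have "\<rho> ^ \<alpha> \<noteq> 1"
      proof
        assume 1: "\<rho> ^ \<alpha> = 1"
        then have "\<rho> ^ (\<alpha> - 1) = 1" using eq by simp
        then show False using 1 pw[of \<rho>] False by simp
      qed
      then show ?thesis using eq False by (simp add: w_def field_simps)
    qed
    then have "(- 1) ^ \<alpha> * (w ^ \<alpha> - w ^ (\<alpha> - 1)) = (- 1) ^ \<alpha> * ((- 1) ^ \<alpha> * c)"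
      using root by (simp add: algebra_simps)
    also have "\<dots> = c" by (simp flip: mult.assoc power_mult_distrib)
    finally show ?thesis by simp
  qed
  then have "?S \<subseteq> {(- 1) ^ \<alpha> * (w ^ \<alpha> - w ^ (\<alpha> - 1))}" by blast
  then show ?thesis by (rule finite_subset) simp
qed

text \<open>If two choices of roots have the same product, cancel the common roots above the largest
  index i where the choices differ. The ratio of the two i-th roots is then a ratio of products of
  roots of smaller index. There are finitely many such ratios, so \<open>x i\<close> has only
  finitely many values to avoid once the earlier coordinates are fixed. The sets \<open>B\<close>
  are left open: all of the complex numbers for the divisibility argument, small balls for the
  approximation argument.\<close>

lemma generic_trinomials:
  fixes B :: "nat \<Rightarrow> complex set"
  assumes "\<alpha> \<ge> 2" "p \<noteq> 0" "\<And>i. infinite (B i)"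
  shows "\<exists>x r. (\<forall>i\<le>M. x i \<in> B i) \<and> mpoly_eval p x \<noteq> 0 \<and>
    (\<forall>i\<in>{1..m}. x i \<noteq> 0 \<and> trinomial_roots \<alpha> (x i) (r i)) \<and>
    inj_on (\<lambda>k. \<Prod>i\<in>{1..m}. r i (k i)) (index_set m \<alpha>)"
proof -
  have "\<exists>rt. \<forall>c. trinomial_roots \<alpha> c (rt c)"
    using trinomial_roots_exist assms(1) by (intro choice) auto
  then obtain rt where rt: "\<And>c. trinomial_roots \<alpha> c (rt c)" by blast
  \<comment> \<open>The ratios include 1, from k = k', so avoiding them also rules out double
    roots.\<close>
  define Q where "Q i x = (\<lambda>(k, k'). (\<Prod>l\<in>{1..<i}. rt (x l) (k l)) / (\<Prod>l\<in>{1..<i}. rt (x l) (k' l))) `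
      (PiE {1..<i} (\<lambda>_. {..<\<alpha>}) \<times> PiE {1..<i} (\<lambda>_. {..<\<alpha>}))" for i :: nat and x :: "nat \<Rightarrow> complex"
  define bad where "bad i x = {0} \<union>
    (\<Union>\<rho>\<in>Q i x. {c. c \<noteq> 0 \<and> (\<exists>j<\<alpha>. \<exists>j'<\<alpha>. j \<noteq> j' \<and> rt c j = \<rho> * rt c j')})" for i :: nat and x :: "nat \<Rightarrow> complex"
  have "finite (Q i x)" for i x unfolding Q_def by (intro finite_imageI finite_cartesian_product finite_PiE) auto
  then have fin: "finite (bad i x)" for i x
    unfolding bad_def using finite_trinomial_root_ratio[OF rt assms(1)] by auto
  have "\<exists>x. (\<forall>i\<le>max M m. x i \<in> B i - bad i x) \<and> mpoly_eval p x \<noteq> 0"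
  proof (rule mpoly_eval_nonzero_in_infinite[OF assms(2)])
    show "infinite (B i - bad i x)" for i x using fin assms(3) by simp
    fix i and x x' :: "nat \<Rightarrow> complex" assume "\<And>j. j < i \<Longrightarrow> x j = x' j"
    then have "Q i x = Q i x'" unfolding Q_def
      by (intro image_cong refl) (auto intro!: arg_cong2[where f = "(/)"] prod.cong)
    then show "B i - bad i x = B i - bad i x'" by (simp add: bad_def)
  qed
  then obtain x where x: "\<And>i. i \<le> max M m \<Longrightarrow> x i \<in> B i - bad i x" and p: "mpoly_eval p x \<noteq> 0"
    by blast
  have nz: "x i \<noteq> 0" if "i \<in> {1..m}" for i
    using x[of i] that by (auto simp: bad_def le_max_iff_disj)
  have rnz: "rt (x i) j \<noteq> 0" if "i \<in> {1..m}" "j < \<alpha>" for i j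
    using trinomial_roots_nonzero[OF rt that(2) assms(1) nz[OF that(1)]] .
  have "inj_on (\<lambda>k. \<Prod>i\<in>{1..m}. rt (x i) (k i)) (index_set m \<alpha>)"
  proof (rule inj_onI, rule ccontr)
    fix k k' assume k: "k \<in> index_set m \<alpha>" "k' \<in> index_set m \<alpha>"
      and eq: "(\<Prod>i\<in>{1..m}. rt (x i) (k i)) = (\<Prod>i\<in>{1..m}. rt (x i) (k' i))" and ne: "k \<noteq> k'"
    have lt: "k l < \<alpha>" "k' l < \<alpha>" if "l \<in> {1..m}" for l
      using k that unfolding index_set_def by (meson PiE_mem lessThan_iff)+
    define D where "D = {i\<in>{1..m}. k i \<noteq> k' i}"
    have "D \<noteq> {}"
      using ne k unfolding index_set_def D_def by (metis (mono_tags, lifting) PiE_ext empty_iff mem_Collect_eq)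
    \<comment> \<open>The largest index is taken because \<open>Q i x\<close> knows only the roots
      below i; the roots above i agree and cancel.\<close>
    define i where "i = Max D"
    have fD: "finite D" by (simp add: D_def)
    then have i: "i \<in> {1..m}" "k i \<noteq> k' i"
      using Max_in[OF fD \<open>D \<noteq> {}\<close>] by (auto simp: D_def i_def)
    have above: "k l = k' l" if "l \<in> {i<..m}" for l
    proof (rule ccontr)
      assume "k l \<noteq> k' l"
      then have "l \<le> i" using Max_ge[OF fD, of l] that i(1) unfolding i_def by (simp add: D_def)
      then show False using that by simp
    qed
    have split: "(\<Prod>l\<in>{1..m}. f l) = (\<Prod>l\<in>{1..<i}. f l) * f i * (\<Prod>l\<in>{i<..m}. f l)"
      for f :: "nat \<Rightarrow> complex"
    proof -
      have "{1..m} = insert i ({1..<i} \<union> {i<..m})" using i by auto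
      then have "prod f {1..m} = prod f (insert i ({1..<i} \<union> {i<..m}))" by simp
      also have "\<dots> = f i * prod f ({1..<i} \<union> {i<..m})" by (rule prod.insert) auto
      also have "prod f ({1..<i} \<union> {i<..m}) = prod f {1..<i} * prod f {i<..m}"
        by (rule prod.union_disjoint) auto
      finally show ?thesis by simp
    qed
    let ?P = "\<lambda>k. \<Prod>l\<in>{1..<i}. rt (x l) (k l)"
    have tail: "(\<Prod>l\<in>{i<..m}. rt (x l) (k l)) = (\<Prod>l\<in>{i<..m}. rt (x l) (k' l))"
      using above by (intro prod.cong) auto
    have "(\<Prod>l\<in>{i<..m}. rt (x l) (k' l)) \<noteq> 0"
      using i(1) by (subst prod_zero_iff) (auto simp: rnz lt)
    then have "?P k * rt (x i) (k i) = ?P k' * rt (x i) (k' i)"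
      using eq unfolding split tail by simp
    moreover have "?P k \<noteq> 0"
      using i(1) by (subst prod_zero_iff) (auto simp: rnz lt)
    ultimately have r: "rt (x i) (k i) = ?P k' / ?P k * rt (x i) (k' i)" by (simp add: field_simps)
    have "(restrict k' {1..<i}, restrict k {1..<i}) \<in> PiE {1..<i} (\<lambda>_. {..<\<alpha>}) \<times> PiE {1..<i} (\<lambda>_. {..<\<alpha>})"
      using lt i by auto
    then have "?P k' / ?P k \<in> Q i x"
      unfolding Q_def by (rule rev_image_eqI) simp
    then have "x i \<in> bad i x"
      using r i lt nz[OF i(1)] unfolding bad_def by blast
    then show False using x[of i] i(1) by (auto simp: le_max_iff_disj)
  qed
  then show ?thesis using x p nz rt by (intro exI[of _ x] exI[of _ "\<lambda>i. rt (x i)"]) auto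
qed

lemma monic_poly_eq_prod_roots:
  fixes p :: "complex poly"
  assumes "finite I" "inj_on f I" "degree p = card I" "lead_coeff p = 1" "\<And>k. k \<in> I \<Longrightarrow> poly p (f k) = 0"
  shows "p = (\<Prod>k\<in>I. [:- f k, 1:])"
proof (rule ccontr)
  let ?q = "\<Prod>k\<in>I. [:- f k, 1:]"
  assume "p \<noteq> ?q"
  then have nz: "p - ?q \<noteq> 0" by simp
  have deg: "degree ?q = card I" using assms(1) by (subst degree_prod_eq_sum_degree) auto
  have "lead_coeff ?q = 1" by (subst lead_coeff_prod) simp
  then have "coeff (p - ?q) (card I) = 0" using assms(3,4) deg by simp
  moreover have "degree (p - ?q) \<le> card I" using deg assms(3) by (intro degree_diff_le) auto
  ultimately have lt: "degree (p - ?q) < card I"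
    using nz by (metis le_neq_implies_less leading_coeff_0_iff)
  have "f ` I \<subseteq> {x. poly (p - ?q) x = 0}"
    using assms(1,5) by (auto simp: poly_prod)
  then have "card (f ` I) \<le> card {x. poly (p - ?q) x = 0}"
    using poly_roots_finite[OF nz] by (intro card_mono)
  also have "\<dots> \<le> degree (p - ?q)" using nz by (rule card_poly_roots_bound)
  finally show False using lt assms(2) by (simp add: card_image)
qed

text \<open>This replaces a continuous labelling of roots: one subsequence serves all roots at
  once.\<close>

lemma finite_family_convergent_subseq:
  fixes r :: "nat \<Rightarrow> 'i \<Rightarrow> complex"
  assumes "finite I" "\<And>i. i \<in> I \<Longrightarrow> bounded (range (\<lambda>n. r n i))"
  shows "\<exists>s l. strict_mono (s :: nat \<Rightarrow> nat) \<and> (\<forall>i\<in>I. (\<lambda>n. r (s n) i) \<longlonglongrightarrow> l i)"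
  using assms
proof (induction I rule: finite_induct)
  case empty
  show ?case by (intro exI[of _ id]) (auto simp: strict_mono_def)
next
  case (insert a I)
  then obtain s l where s: "strict_mono (s :: nat \<Rightarrow> nat)" "\<forall>i\<in>I. (\<lambda>n. r (s n) i) \<longlonglongrightarrow> l i"
    by auto
  have "bounded (range (\<lambda>n. r (s n) a))"
    using insert.prems[of a] by (auto intro: bounded_subset)
  then obtain b t where t: "strict_mono (t :: nat \<Rightarrow> nat)" "((\<lambda>n. r (s n) a) \<circ> t) \<longlonglongrightarrow> b"
    using bounded_imp_convergent_subsequence by blast
  have "(\<lambda>n. r (s (t n)) i) \<longlonglongrightarrow> l i" if "i \<in> I" for i
    using LIMSEQ_subseq_LIMSEQ[OF _ t(1)] s(2) that by (force simp: o_def)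
  moreover have "strict_mono (\<lambda>n. s (t n))" using s(1) t(1) by (simp add: strict_mono_def)
  ultimately show ?case using t(2) insert.hyps(2)
    by (intro exI[of _ "\<lambda>n. s (t n)"] exI[of _ "l(a := b)"]) (auto simp: o_def)
qed

text \<open>If cmod w > 1, divide by the (\<alpha>-1)-th power of cmod w. The coefficient a is kept
  general because rescaled trinomials have a middle coefficient other than 1.\<close>

lemma cmod_trinomial_root_le:
  fixes w :: complex
  assumes "w ^ \<alpha> = a * w ^ (\<alpha> - 1) + c" "\<alpha> \<ge> 1"
  shows "cmod w \<le> 1 + cmod a + cmod c"
proof (cases "cmod w \<le> 1")
  case False
  have "cmod w * cmod w ^ (\<alpha> - 1) = cmod (w ^ \<alpha>)"
    using assms(2) by (simp add: norm_power flip: power_Suc)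
  also have "\<dots> \<le> cmod a * cmod w ^ (\<alpha> - 1) + cmod c"
    unfolding assms(1) by (rule order.trans[OF norm_triangle_ineq]) (simp add: norm_mult norm_power)
  also have "\<dots> \<le> cmod a * cmod w ^ (\<alpha> - 1) + cmod c * cmod w ^ (\<alpha> - 1)"
    using False mult_left_mono[of 1 "cmod w ^ (\<alpha> - 1)" "cmod c"] by (simp add: one_le_power)
  finally have "cmod w * cmod w ^ (\<alpha> - 1) \<le> (cmod a + cmod c) * cmod w ^ (\<alpha> - 1)"
    by (simp add: algebra_simps)
  then have "cmod w \<le> cmod a + cmod c"
    by (rule mult_right_le_imp_le) (use False in \<open>auto intro!: zero_less_power\<close>)
  then show ?thesis by simp
qed (use norm_ge_zero[of a] norm_ge_zero[of c] in linarith)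

section \<open>Factorization at all points\<close>

lemma poly_map_poly_altdef:
  fixes h :: "'a::zero \<Rightarrow> 'b::comm_ring_1"
  assumes "h 0 = 0" "degree p \<le> n"
  shows "poly (map_poly h p) w = (\<Sum>i\<le>n. h (coeff p i) * w ^ i)"
proof -
  have "degree (map_poly h p) \<le> n" using assms(2) map_poly_degree_leq le_trans by blast
  then have "(\<Sum>i\<le>n. coeff (map_poly h p) i * w ^ i) = poly (map_poly h p) w"
    unfolding poly_altdef by (intro sum.mono_neutral_right) (auto simp: coeff_eq_0)
  then show ?thesis using assms(1) by (simp add: coeff_map_poly)
qed

text \<open>Reflection is taken before h is applied, and the exponent is the degree of p itself, so
  the formula survives a drop of degree under h.\<close>

lemma poly_map_reflect_poly:
  fixes p :: "'a::comm_ring_1 poly" and w :: "'b::field"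
  assumes "h 0 = 0" "w \<noteq> 0"
  shows "poly (map_poly h (reflect_poly p)) w = w ^ degree p * poly (map_poly h p) (1 / w)"
proof -
  let ?n = "degree p"
  have "poly (map_poly h (reflect_poly p)) w = (\<Sum>i\<le>?n. h (coeff (reflect_poly p) i) * w ^ i)"
    using assms(1) degree_reflect_poly_le by (rule poly_map_poly_altdef)
  also have "\<dots> = (\<Sum>i\<le>?n. h (coeff p (?n - i)) * w ^ i)"
    by (intro sum.cong) (auto simp: coeff_reflect_poly)
  also have "\<dots> = (\<Sum>i\<le>?n. h (coeff p i) * w ^ (?n - i))"
    by (rule sum.reindex_bij_witness[of _ "\<lambda>i. ?n - i" "\<lambda>i. ?n - i"]) auto
  also have "\<dots> = w ^ ?n * (\<Sum>i\<le>?n. h (coeff p i) * (1 / w) ^ i)"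
    unfolding sum_distrib_left using assms(2)
    by (intro sum.cong) (auto simp: power_diff power_one_over)
  also have "\<dots> = w ^ ?n * poly (map_poly h p) (1 / w)"
    using poly_map_poly_altdef[of h p ?n] assms(1) by simp
  finally show ?thesis .
qed

text \<open>For nonzero p, reflection lowers the degree by the order of vanishing at 0. Reflecting
  twice loses exactly this power of the variable.\<close>

lemma eq_monom_mult_reflect_reflect:
  fixes p :: "'a::comm_ring_1 poly"
  shows "p = monom 1 (degree p - degree (reflect_poly p)) * reflect_poly (reflect_poly p)"
proof (cases "p = 0")
  case False
  obtain k where k: "k \<le> degree p" "degree (reflect_poly p) = degree p - k" "\<And>i. i < k \<Longrightarrow> coeff p i = 0"
  proof (rule that[of "degree p - degree (reflect_poly p)"])
    show "degree p - degree (reflect_poly p) \<le> degree p" by simp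
    show "degree (reflect_poly p) = degree p - (degree p - degree (reflect_poly p))"
      using degree_reflect_poly_le[of p] by simp
    fix i assume i: "i < degree p - degree (reflect_poly p)"
    then have "coeff (reflect_poly p) (degree p - i) = 0"
      by (intro coeff_eq_0) simp
    then have "coeff p (degree p - (degree p - i)) = 0"
      by (simp add: coeff_reflect_poly split: if_splits)
    then show "coeff p i = 0" using i by simp
  qed
  show ?thesis
    using k by (intro poly_eqI) (auto simp: coeff_monom_mult coeff_reflect_poly intro: coeff_eq_0)
qed simp

lemma comm_ring_hom_poly_map_poly:
  assumes "comm_ring_hom h"
  shows "comm_ring_hom (\<lambda>q. poly (map_poly h q) y)"
proof -
  interpret comm_ring_hom h by fact
  interpret m: map_poly_comm_ring_hom h ..
  show ?thesis by unfold_locales (simp_all add: m.hom_add m.hom_mult)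
qed

lemma tendsto_mpoly_eval:
  fixes v :: "'b \<Rightarrow> nat \<Rightarrow> complex"
  assumes "\<And>k. k \<in> mpoly_vars p \<Longrightarrow> ((\<lambda>n. v n k) \<longlongrightarrow> u k) F"
  shows "((\<lambda>n. mpoly_eval p (v n)) \<longlongrightarrow> mpoly_eval p u) F"
  unfolding mpoly_eval_def
  by (intro tendsto_sum tendsto_mult tendsto_prod tendsto_power tendsto_const assms)
    (auto simp: mpoly_vars_def)

text \<open>Convergent coefficients keep the roots bounded; along a common convergent subsequence
  the product identity passes to the limit.\<close>

lemma trinomial_roots_limit:
  fixes x :: "nat \<Rightarrow> nat \<Rightarrow> complex"
  assumes "\<And>i n. i \<in> I \<Longrightarrow> trinomial_roots \<alpha> (x n i) (r n i)" "\<alpha> \<ge> 1" "finite I"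
    and "\<And>i. i \<in> I \<Longrightarrow> (\<lambda>n. x n i) \<longlonglongrightarrow> x0 i"
  shows "\<exists>s r0. strict_mono (s :: nat \<Rightarrow> nat) \<and>
    (\<forall>i\<in>I. trinomial_roots \<alpha> (x0 i) (r0 i) \<and> (\<forall>j<\<alpha>. (\<lambda>n. r (s n) i j) \<longlonglongrightarrow> r0 i j))"
proof -
  have "bounded (range (\<lambda>n. r n i j))" if "i \<in> I" "j < \<alpha>" for i j
  proof -
    have "bounded (range (\<lambda>n. x n i))"
      using assms(4)[OF that(1)] convergentI convergent_imp_bounded by blast
    then obtain K where K: "\<And>n. cmod (x n i) \<le> K" by (auto simp: bounded_iff)
    have "cmod (r n i j) \<le> 2 + K" for n
    proof -
      have "cmod (r n i j) \<le> 1 + cmod 1 + cmod ((- 1) ^ \<alpha> * x n i)"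
        using trinomial_roots_root[OF assms(1)[OF that(1)] that(2), of n] assms(2)
        by (intro cmod_trinomial_root_le[of _ \<alpha>]) simp_all
      then show ?thesis using K[of n] by (simp add: norm_mult norm_power)
    qed
    then show ?thesis by (auto simp: bounded_iff)
  qed
  then obtain s l where s: "strict_mono (s :: nat \<Rightarrow> nat)"
    and l: "\<And>i j. i \<in> I \<Longrightarrow> j < \<alpha> \<Longrightarrow> (\<lambda>n. r (s n) i j) \<longlonglongrightarrow> l (i, j)"
    using finite_family_convergent_subseq[of "I \<times> {..<\<alpha>}" "\<lambda>n (i, j). r n i j"] assms(3) by fastforce
  have "trinomial_roots \<alpha> (x0 i) (\<lambda>j. l (i, j))" if i: "i \<in> I" for i
    unfolding trinomial_roots_def
  proof
    fix w
    have "(\<lambda>n. \<Prod>j<\<alpha>. w - r (s n) i j) \<longlonglongrightarrow> (\<Prod>j<\<alpha>. w - l (i, j))"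
      using i l by (intro tendsto_intros) auto
    moreover have "(\<lambda>n. \<Prod>j<\<alpha>. w - r (s n) i j) = (\<lambda>n. w ^ \<alpha> - w ^ (\<alpha> - 1) - (- 1) ^ \<alpha> * x (s n) i)"
      using assms(1)[OF i] by (simp add: trinomial_roots_def)
    moreover have "(\<lambda>n. w ^ \<alpha> - w ^ (\<alpha> - 1) - (- 1) ^ \<alpha> * x (s n) i) \<longlonglongrightarrow>
        w ^ \<alpha> - w ^ (\<alpha> - 1) - (- 1) ^ \<alpha> * x0 i"
      using LIMSEQ_subseq_LIMSEQ[OF assms(4)[OF i] s] by (intro tendsto_intros) (simp add: o_def)
    ultimately show "(\<Prod>j<\<alpha>. w - l (i, j)) = w ^ \<alpha> - w ^ (\<alpha> - 1) - (- 1) ^ \<alpha> * x0 i"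
      using LIMSEQ_unique by metis
  qed
  then show ?thesis using s l by (intro exI[of _ s] exI[of _ "\<lambda>i j. l (i, j)"]) auto
qed

text \<open>At a generic point the \<alpha>^m products are distinct and exhaust the roots of the
  monic T. Any other point is approached by generic ones in balls of radius 1/(n+1), and both sides
  of the factorization converge.\<close>

lemma root_product_poly_factorization:
  fixes T :: "int_mpoly poly" and x :: "nat \<Rightarrow> complex"
  assumes "\<alpha> \<ge> 2" "degree T = \<alpha> ^ m" "lead_coeff T = 1"
    and T: "\<And>x w. \<forall>i\<in>{1..m}. w i ^ \<alpha> = w i ^ (\<alpha> - 1) + (- 1) ^ \<alpha> * x i \<Longrightarrow>
       poly (map_poly (\<lambda>p. mpoly_eval p x) T) (\<Prod>i\<in>{1..m}. w i :: complex) = 0"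
  shows "\<exists>r. (\<forall>i\<in>{1..m}. trinomial_roots \<alpha> (x i) (r i)) \<and>
    (\<forall>w. poly (map_poly (\<lambda>p. mpoly_eval p x) T) w =
       (\<Prod>k\<in>index_set m \<alpha>. w - (\<Prod>i\<in>{1..m}. r i (k i))))"
proof -
  let ?ev = "\<lambda>x. map_poly (\<lambda>p. mpoly_eval p x) T"
  let ?W = "\<lambda>r. \<lambda>k. \<Prod>i\<in>{1..m}. r i (k i) :: complex"
  have gen: "poly (?ev x) w = (\<Prod>k\<in>index_set m \<alpha>. w - ?W r k)"
    if r: "\<forall>i\<in>{1..m}. trinomial_roots \<alpha> (x i) (r i)" and inj: "inj_on (?W r) (index_set m \<alpha>)" for x r w
  proof -
    have "degree (?ev x) = \<alpha> ^ m \<and> lead_coeff (?ev x) = 1"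
      using assms(2,3) by (subst (1 2) degree_map_poly) (auto simp: coeff_map_poly)
    moreover have "poly (?ev x) (?W r k) = 0" if "k \<in> index_set m \<alpha>" for k
    proof (rule T, rule ballI)
      fix i assume i: "i \<in> {1..m}"
      then have "k i < \<alpha>" using that unfolding index_set_def by (metis PiE_mem lessThan_iff)
      then show "r i (k i) ^ \<alpha> = r i (k i) ^ (\<alpha> - 1) + (- 1) ^ \<alpha> * x i"
        using trinomial_roots_root r i by blast
    qed
    ultimately have "?ev x = (\<Prod>k\<in>index_set m \<alpha>. [:- ?W r k, 1:])"
      using inj by (intro monic_poly_eq_prod_roots) (auto simp: card_index_set)
    then show ?thesis by (simp add: poly_prod)
  qed
  have "finite (\<Union>i\<le>degree T. mpoly_vars (coeff T i))" by (simp add: mpoly_vars_def)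
  then obtain M0 where M0: "(\<Union>i\<le>degree T. mpoly_vars (coeff T i)) \<subseteq> {..M0}"
    by (meson finite_nat_iff_bounded_le)
  \<comment> \<open>Covers every variable in a coefficient of T, so that all coefficients converge
    at the approximating points.\<close>
  define M where "M = max m M0"
  have "\<exists>x' r'. (\<forall>i\<le>M. x' i \<in> ball (x i) (1 / real (Suc n))) \<and>
      (\<forall>i\<in>{1..m}. trinomial_roots \<alpha> (x' i) (r' i)) \<and> inj_on (?W r') (index_set m \<alpha>)" for n
  proof -
    have "infinite (ball (x i) (1 / real (Suc n)))" for i
      by (intro uncountable_infinite uncountable_ball) simp
    from generic_trinomials[of \<alpha> 1 "\<lambda>i. ball (x i) (1 / real (Suc n))" M m, OF assms(1) one_neq_zero this]
    show ?thesis by blast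
  qed
  then obtain x' r' where x': "\<And>n i. i \<le> M \<Longrightarrow> x' n i \<in> ball (x i) (1 / real (Suc n))"
    and r': "\<And>n. \<forall>i\<in>{1..m}. trinomial_roots \<alpha> (x' n i) (r' n i)"
    and inj: "\<And>n. inj_on (?W (r' n)) (index_set m \<alpha>)" by metis
  have lim: "(\<lambda>n. x' n i) \<longlonglongrightarrow> x i" if "i \<le> M" for i
  proof (rule LIM_zero_cancel, rule LIMSEQ_norm_0)
    show "cmod (x' n i - x i) < 1 / real (Suc n)" for n
      using x'[OF that, of n] by (simp add: dist_norm norm_minus_commute)
  qed
  obtain s r where s: "strict_mono (s :: nat \<Rightarrow> nat)"
    and r: "\<forall>i\<in>{1..m}. trinomial_roots \<alpha> (x i) (r i) \<and> (\<forall>j<\<alpha>. (\<lambda>n. r' (s n) i j) \<longlonglongrightarrow> r i j)"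
    using trinomial_roots_limit[of "{1..m}" \<alpha> x' r' x] r' assms(1) lim
    by (fastforce simp: M_def)
  have "poly (?ev x) w = (\<Prod>k\<in>index_set m \<alpha>. w - ?W r k)" for w
  proof -
    have ev: "poly (?ev x) w = (\<Sum>i\<le>degree T. mpoly_eval (coeff T i) x * w ^ i)" for x
      by (rule poly_map_poly_altdef) auto
    have "(\<lambda>n. poly (?ev (x' (s n))) w) \<longlonglongrightarrow> poly (?ev x) w"
      unfolding ev
    proof (intro tendsto_intros tendsto_mpoly_eval)
      fix i k assume "i \<in> {..degree T}" "k \<in> mpoly_vars (coeff T i)"
      then have "k \<le> M" using M0 by (fastforce simp: M_def)
      then show "(\<lambda>n. x' (s n) k) \<longlonglongrightarrow> x k"
        using LIMSEQ_subseq_LIMSEQ[OF lim s] by (simp add: o_def)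
    qed
    moreover have "(\<lambda>n. \<Prod>k\<in>index_set m \<alpha>. w - ?W (r' (s n)) k) \<longlonglongrightarrow> (\<Prod>k\<in>index_set m \<alpha>. w - ?W r k)"
    proof (intro tendsto_intros)
      fix k i assume "k \<in> index_set m \<alpha>" "i \<in> {1..m}"
      then have "k i < \<alpha>" unfolding index_set_def by (metis PiE_mem lessThan_iff)
      then show "(\<lambda>n. r' (s n) i (k i)) \<longlonglongrightarrow> r i (k i)" using r \<open>i \<in> {1..m}\<close> by blast
    qed
    ultimately show ?thesis
      unfolding gen[OF r' inj] by (rule LIMSEQ_unique)
  qed
  then show ?thesis using r by blast
qed

section \<open>The quiver resultant\<close>

text \<open>The case v 0 = 0 is left out because the reflected polynomial is evaluated through 1 / v
  0. The sign c is uniform in v, whereas the labelled roots r are chosen separately for each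
  v.\<close>

lemma quiver_resultant_factorization:
  fixes A :: int_mpoly
  assumes "\<alpha> \<ge> 2" "is_quiver_resultant m (\<lambda>i j. if i = j then int \<alpha> else 0) A"
  shows "\<exists>c::complex. (c = 1 \<or> c = -1) \<and> (\<forall>v. v 0 \<noteq> 0 \<longrightarrow>
    (\<exists>r. (\<forall>i\<in>{1..m}. trinomial_roots \<alpha> (v i) (r i)) \<and>
      mpoly_eval A v = c * (\<Prod>k\<in>index_set m \<alpha>. 1 - v 0 * (\<Prod>i\<in>{1..m}. r i (k i)))))"
proof -
  let ?W = "\<lambda>r. \<lambda>k. \<Prod>i\<in>{1..m}. r i (k i) :: complex"
  let ?ev = "\<lambda>x q. map_poly (\<lambda>p. mpoly_eval p (x :: nat \<Rightarrow> complex)) q"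
  have irr: "irreducible A" using assms(2) unfolding is_quiver_resultant_def by blast
  have van: "mpoly_eval A (\<lambda>k. if k = 0 then y else x k) = 0"
    if "\<forall>i\<in>{1..m}. z i \<noteq> 0" "quiver_F0 m y z = 0"
      "\<forall>i\<in>{1..m}. quiver_F m (\<lambda>i j. if i = j then int \<alpha> else 0) i x z = 0" for x y z
    using assms(2) that unfolding is_quiver_resultant_def by blast
  obtain T :: "int_mpoly poly" where degT: "degree T = \<alpha> ^ m" and monT: "lead_coeff T = 1"
    and T: "\<And>x w. \<forall>i\<in>{1..m}. w i ^ \<alpha> = w i ^ (\<alpha> - 1) + (- 1) ^ \<alpha> * x i \<Longrightarrow>
       poly (?ev x T) (\<Prod>i\<in>{1..m}. w i) = 0"
    using exists_root_product_poly[of \<alpha> m] assms(1) by auto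
  have T0: "T \<noteq> 0" using monT by auto
  define hA :: "int_mpoly poly" where "hA = mpoly_eval A (\<lambda>k. if k = 0 then [:0, 1:] else [:mvar k:])"
  have hA_eval: "poly (?ev x hA) y = mpoly_eval A (\<lambda>k. if k = 0 then y else x k)" for x y
    unfolding hA_def mpoly_eval_comp_hom[OF comm_ring_hom_poly_map_poly[OF mpoly_eval_hom]]
    by (intro arg_cong[where f = "mpoly_eval A"] ext) (auto simp: Polynomial.map_poly_pCons)
  have hA_back: "poly hA (mvar 0) = A"
  proof -
    have "comm_ring_hom (\<lambda>q. poly q (mvar 0))" by unfold_locales auto
    then have "poly hA (mvar 0) = mpoly_eval A (\<lambda>k. poly (if k = 0 then [:0, 1:] else [:mvar k:]) (mvar 0))"
      unfolding hA_def by (rule mpoly_eval_comp_hom)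
    also have "(\<lambda>k. poly (if k = 0 then [:0, 1:] else [:mvar k:]) (mvar 0)) = mvar" by auto
    finally show ?thesis by (simp add: mpoly_eval_mvars)
  qed
  \<comment> \<open>A vanishes at y = 1 / (w 1 ... w m), whereas T vanishes at w 1 ... w m;
    reflection in y reconciles the two.\<close>
  define B where "B = reflect_poly hA"
  obtain q r where qr: "pseudo_divmod B T = (q, r)" by force
  \<comment> \<open>Pseudo-division would multiply B by a power of the leading coefficient of T,
    which is 1.\<close>
  have div: "B = T * q + r" and deg_r: "r = 0 \<or> degree r < degree T"
    using pseudo_divmod[OF T0 qr] monT by auto
  have r0: "r = 0"
  proof (rule ccontr)
    assume "r \<noteq> 0"
    then have "lead_coeff r \<noteq> 0" by simp
    \<comment> \<open>The point is generic and also keeps the leading coefficient of r nonzero, so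
      the specialised remainder is a nonzero polynomial of degree below \<alpha>^m with \<alpha>^m
      distinct roots.\<close>
    from generic_trinomials[OF assms(1) this, of "\<lambda>_. UNIV" 0 m]
    obtain x rt where nz: "mpoly_eval (lead_coeff r) x \<noteq> 0"
      and rt: "\<forall>i\<in>{1..m}. x i \<noteq> 0 \<and> trinomial_roots \<alpha> (x i) (rt i)"
      and inj: "inj_on (?W rt) (index_set m \<alpha>)"
      using infinite_UNIV_char_0 by blast
    have "poly (?ev x r) (?W rt k) = 0" if k: "k \<in> index_set m \<alpha>" for k
    proof -
      have ki: "k i < \<alpha>" if "i \<in> {1..m}" for i
        using k that unfolding index_set_def by (metis PiE_mem lessThan_iff)
      have root: "rt i (k i) ^ \<alpha> = rt i (k i) ^ (\<alpha> - 1) + (- 1) ^ \<alpha> * x i" if "i \<in> {1..m}" for i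
        using trinomial_roots_root rt ki that by blast
      have nz: "rt i (k i) \<noteq> 0" if "i \<in> {1..m}" for i
        using trinomial_roots_nonzero[of \<alpha>] rt ki that assms(1) by blast
      have W0: "?W rt k \<noteq> 0" using nz by simp
      have "mpoly_eval A (\<lambda>j. if j = 0 then (\<Prod>i\<in>{1..m}. 1 / rt i (k i)) else x j) = 0"
      proof (rule van[of "\<lambda>i. 1 / rt i (k i)"])
        show "\<forall>i\<in>{1..m}. quiver_F m (\<lambda>i j. if i = j then int \<alpha> else 0) i x (\<lambda>i. 1 / rt i (k i)) = 0"
        proof
          fix i assume i: "i \<in> {1..m}"
          let ?w = "rt i (k i)"
          have "(\<Prod>j\<in>{1..m}. (1 / rt j (k j)) powi (if i = j then int \<alpha> else 0)) =
              (\<Prod>j\<in>{1..m}. if i = j then (1 / ?w) ^ \<alpha> else 1)"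
            by (intro prod.cong) auto
          also have "\<dots> = (1 / ?w) ^ \<alpha>" using i by simp
          finally have "quiver_F m (\<lambda>i j. if i = j then int \<alpha> else 0) i x (\<lambda>i. 1 / rt i (k i)) =
              1 / ?w - 1 + (- 1) ^ \<alpha> * x i * (1 / ?w) ^ \<alpha>"
            by (simp add: quiver_F_def)
          also have "\<dots> = (?w ^ (\<alpha> - 1) - ?w ^ \<alpha> + (- 1) ^ \<alpha> * x i) / ?w ^ \<alpha>"
            using nz[OF i] assms(1)
            by (simp add: field_simps power_one_over power_diff)
          finally show "quiver_F m (\<lambda>i j. if i = j then int \<alpha> else 0) i x (\<lambda>i. 1 / rt i (k i)) = 0"
            using root[OF i] by simp
        qed
      qed (use nz in \<open>auto simp: quiver_F0_def\<close>)
      moreover have "(\<Prod>i\<in>{1..m}. 1 / rt i (k i)) = 1 / ?W rt k" by (simp add: prod_dividef)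
      ultimately have "poly (?ev x hA) (1 / ?W rt k) = 0" by (simp only: hA_eval)
      then have B: "poly (?ev x B) (?W rt k) = 0"
        unfolding B_def using W0 by (subst poly_map_reflect_poly) auto
      interpret h: comm_ring_hom "\<lambda>q. poly (?ev x q) (?W rt k)"
        by (rule comm_ring_hom_poly_map_poly[OF mpoly_eval_hom])
      have "poly (?ev x T) (?W rt k) = 0" using root by (intro T) auto
      then show ?thesis using B unfolding div h.hom_add h.hom_mult by simp
    qed
    then have "?W rt ` index_set m \<alpha> \<subseteq> {w. poly (?ev x r) w = 0}" by auto
    moreover have nzr: "?ev x r \<noteq> 0"
      using nz by (metis coeff_0 coeff_map_poly mpoly_eval_0)
    ultimately have "card (?W rt ` index_set m \<alpha>) \<le> card {w. poly (?ev x r) w = 0}"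
      by (intro card_mono poly_roots_finite)
    also have "\<dots> \<le> degree (?ev x r)" using nzr by (rule card_poly_roots_bound)
    also have "\<dots> \<le> degree r" by (rule map_poly_degree_leq)
    also have "\<dots> < \<alpha> ^ m" using deg_r \<open>r \<noteq> 0\<close> degT by simp
    finally show False using inj by (simp add: card_image card_index_set)
  qed
  define R where "R = poly (reflect_poly T) (mvar 0)"
  obtain n where hA: "hA = monom 1 n * (reflect_poly T * reflect_poly q)"
  proof
    have rB: "reflect_poly B = reflect_poly T * reflect_poly q"
      unfolding div r0 by (simp add: reflect_poly_mult)
    show "hA = monom 1 (degree hA - degree B) * (reflect_poly T * reflect_poly q)"
      by (fact eq_monom_mult_reflect_reflect[of hA, folded B_def, unfolded rB])
  qed
  define Q where "Q = mvar 0 ^ n * poly (reflect_poly q) (mvar 0)"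
  have A: "A = R * Q"
    unfolding hA_back[symmetric] hA by (simp add: R_def Q_def poly_monom)
  have R_ev: "mpoly_eval R v = v 0 ^ degree T * poly (?ev v T) (1 / v 0)" if "v 0 \<noteq> 0" for v :: "nat \<Rightarrow> complex"
  proof -
    interpret e: comm_ring_hom "\<lambda>p. mpoly_eval p v" by (rule mpoly_eval_hom)
    have "mpoly_eval R v = poly (?ev v (reflect_poly T)) (v 0)"
      using e.poly_map_poly[of "reflect_poly T" "mvar 0"] by (simp add: R_def)
    also have "\<dots> = v 0 ^ degree T * poly (?ev v T) (1 / v 0)"
      using that by (intro poly_map_reflect_poly) auto
    finally show ?thesis .
  qed
  have R_eval: "\<exists>r. (\<forall>i\<in>{1..m}. trinomial_roots \<alpha> (v i) (r i)) \<and>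
      mpoly_eval R v = (\<Prod>k\<in>index_set m \<alpha>. 1 - v 0 * ?W r k)" if v0: "v 0 \<noteq> 0" for v :: "nat \<Rightarrow> complex"
  proof -
    obtain r where r: "\<forall>i\<in>{1..m}. trinomial_roots \<alpha> (v i) (r i)"
      and fac: "\<And>w. poly (?ev v T) w = (\<Prod>k\<in>index_set m \<alpha>. w - ?W r k)"
      using root_product_poly_factorization[OF assms(1) degT monT T, of v] by blast
    have "mpoly_eval R v = v 0 ^ degree T * (\<Prod>k\<in>index_set m \<alpha>. 1 / v 0 - ?W r k)"
      using v0 by (simp add: R_ev fac)
    also have "\<dots> = (\<Prod>k\<in>index_set m \<alpha>. v 0 * (1 / v 0 - ?W r k))"
      by (simp add: prod.distrib card_index_set degT)
    also have "\<dots> = (\<Prod>k\<in>index_set m \<alpha>. 1 - v 0 * ?W r k)"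
      using v0 by (intro prod.cong) (auto simp: right_diff_distrib)
    finally show ?thesis using r by blast
  qed
  have "\<not> R dvd 1"
  proof
    assume "R dvd 1"
    then have R: "R = 1 \<or> R = -1" by (rule int_mpoly_unit)
    interpret e: comm_ring_hom "\<lambda>p. mpoly_eval p v" for v :: "nat \<Rightarrow> complex" by (rule mpoly_eval_hom)
    have R: "mpoly_eval R v = 1 \<or> mpoly_eval R v = -1" for v :: "nat \<Rightarrow> complex"
      using R by (auto simp: e.hom_uminus)
    \<comment> \<open>A zero of R, showing that R is not a unit: w i = 2 solves every trinomial
      since 2^\<alpha> - 2^(\<alpha>-1) = 2^(\<alpha>-1), and y is the inverse of the product
      2^m.\<close>
    define v :: "nat \<Rightarrow> complex" where
      "v = (\<lambda>i. if i = 0 then 1 / (\<Prod>i\<in>{1..m}. 2) else (- 1) ^ \<alpha> * 2 ^ (\<alpha> - 1))"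
    have "poly (?ev v T) (\<Prod>i\<in>{1..m}. 2) = 0"
    proof (rule T, rule ballI)
      fix i assume "i \<in> {1..m}"
      moreover have "(2::complex) ^ \<alpha> = 2 * 2 ^ (\<alpha> - 1)" using assms(1) by (simp add: power_eq_if)
      ultimately show "(2::complex) ^ \<alpha> = 2 ^ (\<alpha> - 1) + (- 1) ^ \<alpha> * v i"
        by (cases "even \<alpha>") (auto simp: v_def)
    qed
    then have "mpoly_eval R v = 0" by (simp add: R_ev v_def)
    then show False using R[of v] by simp
  qed
  then have "Q dvd 1"
    using irreducibleD[OF irr A] by blast
  then have "Q = 1 \<or> Q = -1"
    by (rule int_mpoly_unit)
  then consider "A = R" | "A = - R" using A by force
  then obtain c :: complex where c: "c = 1 \<or> c = -1" "\<And>v. mpoly_eval A v = c * mpoly_eval R v"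
  proof cases
    case 1
    then show ?thesis using that[of 1] by simp
  next
    case 2
    interpret e: comm_ring_hom "\<lambda>p. mpoly_eval p v" for v :: "nat \<Rightarrow> complex" by (rule mpoly_eval_hom)
    show ?thesis using that[of "-1"] 2 by (simp add: e.hom_uminus)
  qed
  show ?thesis
  proof (intro exI[of _ c] conjI allI impI)
    fix v :: "nat \<Rightarrow> complex" assume "v 0 \<noteq> 0"
    from R_eval[of v, OF this] obtain r where "\<forall>i\<in>{1..m}. trinomial_roots \<alpha> (v i) (r i)"
      "mpoly_eval R v = (\<Prod>k\<in>index_set m \<alpha>. 1 - v 0 * ?W r k)" by auto
    then show "\<exists>r. (\<forall>i\<in>{1..m}. trinomial_roots \<alpha> (v i) (r i)) \<and>
        mpoly_eval A v = c * (\<Prod>k\<in>index_set m \<alpha>. 1 - v 0 * ?W r k)"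
      by (intro exI[of _ r]) (simp add: c(2))
  qed (fact c(1))
qed

section \<open>Limits of products\<close>

text \<open>The limit of \<open>s powr (- max 0 \<theta>) * (1 - s powr \<theta> * z)\<close> as \<open>s\<close> tends to infinity.\<close>

definition factor_limit :: "real \<Rightarrow> complex \<Rightarrow> complex" where
  "factor_limit \<theta> z = (if \<theta> < 0 then 1 else if \<theta> = 0 then 1 - z else - z)"

lemma tendsto_factor_limit:
  fixes s :: "nat \<Rightarrow> real"
  assumes s: "filterlim s at_top sequentially" and z: "z \<longlonglongrightarrow> z0" and pos: "\<And>n. s n > 0"
  shows "(\<lambda>n. of_real (s n powr (- max 0 \<theta>)) * (1 - of_real (s n powr \<theta>) * z n)) \<longlonglongrightarrow>
    factor_limit \<theta> z0"
proof -
  have neg: "(\<lambda>n. of_real (s n powr a) :: complex) \<longlonglongrightarrow> 0" if "a < 0" for a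
    using tendsto_neg_powr[OF that s] tendsto_of_real[of "\<lambda>n. s n powr a" 0] by simp
  have nz: "s n \<noteq> 0" for n using pos[of n] by simp
  consider "\<theta> < 0" | "\<theta> = 0" | "\<theta> > 0" by linarith
  then show ?thesis
  proof cases
    case 1
    have "(\<lambda>n. 1 - of_real (s n powr \<theta>) * z n) \<longlonglongrightarrow> 1 - 0 * z0"
      using neg[OF 1] z by (intro tendsto_intros)
    then show ?thesis using 1 nz by (simp add: factor_limit_def)
  next
    case 2
    have "(\<lambda>n. 1 - z n) \<longlonglongrightarrow> 1 - z0" using z by (intro tendsto_intros)
    then show ?thesis using 2 nz by (simp add: factor_limit_def)
  next
    case 3
    have "(\<lambda>n. of_real (s n powr (- \<theta>)) - z n) \<longlonglongrightarrow> 0 - z0"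
      using neg[of "- \<theta>"] 3 z by (intro tendsto_intros) auto
    moreover have "of_real (s n powr (- max 0 \<theta>)) * (1 - of_real (s n powr \<theta>) * z n) =
        of_real (s n powr (- \<theta>)) - z n" for n
      using 3 pos[of n] by (simp add: right_diff_distrib powr_minus field_simps)
    ultimately show ?thesis using 3 by (simp add: factor_limit_def)
  qed
qed

lemma tendsto_prod_factor_limit:
  fixes s :: "nat \<Rightarrow> real"
  assumes "filterlim s at_top sequentially" "\<And>n. s n > 0" "finite K"
    and "\<And>k. k \<in> K \<Longrightarrow> (\<lambda>n. z n k) \<longlonglongrightarrow> z0 k"
  shows "(\<lambda>n. of_real (s n powr (- (\<Sum>k\<in>K. max 0 (\<theta> k)))) * (\<Prod>k\<in>K. 1 - of_real (s n powr \<theta> k) * z n k)) \<longlonglongrightarrow>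
    (\<Prod>k\<in>K. factor_limit (\<theta> k) (z0 k))"
proof -
  have "s n powr (- (\<Sum>k\<in>K. max 0 (\<theta> k))) = (\<Prod>k\<in>K. s n powr (- max 0 (\<theta> k)))" for n
    using assms(2)[of n] by (simp add: powr_sum sum_negf[symmetric])
  then have "of_real (s n powr (- (\<Sum>k\<in>K. max 0 (\<theta> k)))) * (\<Prod>k\<in>K. 1 - of_real (s n powr \<theta> k) * z n k) =
      (\<Prod>k\<in>K. of_real (s n powr (- max 0 (\<theta> k))) * (1 - of_real (s n powr \<theta> k) * z n k))" for n
    by (simp add: prod.distrib)
  then show ?thesis using assms by (auto intro!: tendsto_prod tendsto_factor_limit)
qed

text \<open>The shape of \<open>factor_limit\<close> is preserved in every regime. For \<theta> = 0
  the product of 1 - a u j comes from the root identity at w = 1/a (a = 0 being trivial); for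
  \<theta> > 0 the product of - a u j comes from the identity at w = 0.\<close>

lemma prod_factor_limit_binomial_roots:
  assumes "finite J" "d \<ge> 1" "card J = d" and roots: "\<And>w. (\<Prod>j\<in>J. w - u j) = w ^ d - b"
  shows "(\<Prod>j\<in>J. factor_limit \<theta> (a * u j)) = factor_limit \<theta> (a ^ d * b)"
proof -
  consider "\<theta> < 0" | "\<theta> = 0" "a = 0" | "\<theta> = 0" "a \<noteq> 0" | "\<theta> > 0" by linarith
  then show ?thesis
  proof cases
    case 3
    have "(\<Prod>j\<in>J. 1 - a * u j) = (\<Prod>j\<in>J. a * (1 / a - u j))"
      using 3 by (intro prod.cong) (auto simp: right_diff_distrib)
    also have "\<dots> = 1 - a ^ d * b"
      unfolding prod.distrib roots using 3 assms(3) by (simp add: right_diff_distrib power_one_over)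
    finally show ?thesis using 3 by (simp add: factor_limit_def)
  next
    case 4
    have "(\<Prod>j\<in>J. - (a * u j)) = (\<Prod>j\<in>J. a * (0 - u j))" by (intro prod.cong) auto
    also have "\<dots> = - (a ^ d * b)"
      unfolding prod.distrib roots using assms(2,3) by (simp add: power_0_left)
    finally show ?thesis using 4 by (simp add: factor_limit_def)
  qed (use assms(2) in \<open>simp_all add: factor_limit_def\<close>)
qed

text \<open>This is where the binomials arise. Single out one index of S and multiply over its d
  roots with the other choices fixed. The fixed roots then enter only through their d-th powers b l,
  so the result is the same for all d^(card S - 1) remaining choices.\<close>

lemma prod_PiE_factor_limit:
  fixes u :: "nat \<Rightarrow> nat \<Rightarrow> complex"
  assumes "finite S" "S \<noteq> {}" "d \<ge> 1" and J: "\<And>i. i \<in> S \<Longrightarrow> finite (J i) \<and> card (J i) = d"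
    and roots: "\<And>i w. i \<in> S \<Longrightarrow> (\<Prod>j\<in>J i. w - u i j) = w ^ d - b i"
  shows "(\<Prod>k\<in>PiE S J. factor_limit \<theta> (c * (\<Prod>i\<in>S. u i (k i)))) =
    factor_limit \<theta> (c ^ d * (\<Prod>i\<in>S. b i)) ^ (d ^ (card S - 1))"
proof -
  obtain i S' where S: "S = insert i S'" "i \<notin> S'" using assms(2) by (metis mk_disjoint_insert ex_in_conv)
  have fin: "finite S'" using assms(1) S by simp
  have pow: "u l j ^ d = b l" if "l \<in> S" "j \<in> J l" for l j
  proof -
    have "(\<Prod>j'\<in>J l. u l j - u l j') = 0" using that J by (intro prod_zero) auto
    then show ?thesis using roots[OF that(1), of "u l j"] by simp
  qed
  let ?U = "\<lambda>g. \<Prod>l\<in>S'. u l (g l)"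
  have inj: "inj_on (\<lambda>(y, g). g(i := y)) (J i \<times> PiE S' J)" using inj_combinator[OF S(2)] .
  have "(\<Prod>k\<in>PiE S J. factor_limit \<theta> (c * (\<Prod>l\<in>S. u l (k l)))) =
      (\<Prod>(y, g)\<in>J i \<times> PiE S' J. factor_limit \<theta> (c * ?U g * u i y))"
    unfolding S(1) PiE_insert_eq prod.reindex[OF inj]
  proof (rule prod.cong[OF refl], clarsimp)
    fix y g
    have "(\<Prod>l\<in>S'. u l (if l = i then y else g l)) = ?U g" using S(2) by (intro prod.cong) auto
    then show "factor_limit \<theta> (c * (\<Prod>l\<in>insert i S'. u l (if l = i then y else g l))) = factor_limit \<theta> (c * ?U g * u i y)"
      using fin S(2) by (simp add: mult_ac)
  qed
  also have "\<dots> = (\<Prod>g\<in>PiE S' J. \<Prod>y\<in>J i. factor_limit \<theta> (c * ?U g * u i y))"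
    by (subst prod.swap) (simp add: prod.cartesian_product)
  also have "\<dots> = (\<Prod>g\<in>PiE S' J. factor_limit \<theta> (c ^ d * (\<Prod>l\<in>S. b l)))"
  proof (rule prod.cong[OF refl])
    fix g assume g: "g \<in> PiE S' J"
    have "?U g ^ d = (\<Prod>l\<in>S'. b l)"
      unfolding prod_power_distrib using g S by (intro prod.cong pow) auto
    then have "(c * ?U g) ^ d * b i = c ^ d * (\<Prod>l\<in>S. b l)"
      using fin S by (simp add: power_mult_distrib)
    moreover have "(\<Prod>y\<in>J i. factor_limit \<theta> (c * ?U g * u i y)) = factor_limit \<theta> ((c * ?U g) ^ d * b i)"
      using J[of i] roots[of i] S assms(3) by (intro prod_factor_limit_binomial_roots) auto
    ultimately show "(\<Prod>y\<in>J i. factor_limit \<theta> (c * ?U g * u i y)) = factor_limit \<theta> (c ^ d * (\<Prod>l\<in>S. b l))"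
      by simp
  qed
  also have "\<dots> = factor_limit \<theta> (c ^ d * (\<Prod>l\<in>S. b l)) ^ card (PiE S' J)" by simp
  also have "card (PiE S' J) = d ^ (card S - 1)"
    using fin S J by (simp add: card_PiE)
  finally show ?thesis .
qed

text \<open>Multi-indices are grouped by the set \<open>S\<close> of positions where they differ from \<open>j0\<close>.\<close>

lemma prod_PiE_by_support:
  assumes "finite I" "\<And>i. i \<in> I \<Longrightarrow> j0 i \<in> J i" "\<And>i. i \<in> I \<Longrightarrow> finite (J i)"
  shows "(\<Prod>k\<in>PiE I J. F k) =
    (\<Prod>(S, k)\<in>(SIGMA S:Pow I. PiE S (\<lambda>i. J i - {j0 i})). F (\<lambda>i\<in>I. if i \<in> S then k i else j0 i))"
proof (rule prod.reindex_bij_witness[of _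
    "\<lambda>(S, k). \<lambda>i\<in>I. if i \<in> S then k i else j0 i"
    "\<lambda>k. ({i\<in>I. k i \<noteq> j0 i}, restrict k {i\<in>I. k i \<noteq> j0 i})"])
  fix k assume k: "k \<in> PiE I J"
  let ?S = "{i\<in>I. k i \<noteq> j0 i}"
  have eq: "(\<lambda>i\<in>I. if i \<in> ?S then restrict k ?S i else j0 i) = k"
    using k by (auto simp: fun_eq_iff PiE_def extensional_def)
  show "(case (?S, restrict k ?S) of (S, k) \<Rightarrow> \<lambda>i\<in>I. if i \<in> S then k i else j0 i) = k"
    using eq by simp
  show "(?S, restrict k ?S) \<in> (SIGMA S:Pow I. PiE S (\<lambda>i. J i - {j0 i}))"
    using k by auto
  show "(case (?S, restrict k ?S) of (S, k) \<Rightarrow> F (\<lambda>i\<in>I. if i \<in> S then k i else j0 i)) = F k"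
    using eq by simp
next
  fix b assume "b \<in> (SIGMA S:Pow I. PiE S (\<lambda>i. J i - {j0 i}))"
  then obtain S k where b: "b = (S, k)" "S \<subseteq> I" "k \<in> PiE S (\<lambda>i. J i - {j0 i})" by auto
  let ?g = "\<lambda>i\<in>I. if i \<in> S then k i else j0 i"
  have supp: "{i\<in>I. ?g i \<noteq> j0 i} = S" using b by auto
  have "restrict ?g S = k" using b by (auto simp: fun_eq_iff PiE_def extensional_def)
  then show "({i\<in>I. (case b of (S, k) \<Rightarrow> \<lambda>i\<in>I. if i \<in> S then k i else j0 i) i \<noteq> j0 i},
      restrict (case b of (S, k) \<Rightarrow> \<lambda>i\<in>I. if i \<in> S then k i else j0 i)
        {i\<in>I. (case b of (S, k) \<Rightarrow> \<lambda>i\<in>I. if i \<in> S then k i else j0 i) i \<noteq> j0 i}) = b"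
    using supp by (simp add: b(1))
  show "(case b of (S, k) \<Rightarrow> \<lambda>i\<in>I. if i \<in> S then k i else j0 i) \<in> PiE I J"
    using b assms(2) by auto
qed

section \<open>Asymptotics of the trinomial roots\<close>

lemma tendsto_one_over_Suc: "(\<lambda>n. 1 / complex_of_real (real (Suc n))) \<longlonglongrightarrow> 0"
proof -
  have "(\<lambda>n. complex_of_real (inverse (real (Suc n)))) \<longlonglongrightarrow> of_real 0"
    by (intro tendsto_of_real LIMSEQ_inverse_real_of_nat)
  then show ?thesis by (simp only: inverse_eq_divide of_real_divide of_real_0 of_real_1)
qed

lemma bounded_of_power:
  fixes v :: "nat \<Rightarrow> complex"
  assumes "bounded (range (\<lambda>n. v n ^ d))" "d \<ge> 1"
  shows "bounded (range v)"
proof -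
  obtain K where K: "\<And>n. cmod (v n ^ d) \<le> K" using assms(1) by (auto simp: bounded_iff)
  have "cmod (v n) \<le> 1 + K" for n
  proof (cases "cmod (v n) \<le> 1")
    case True
    then show ?thesis using K[of n] norm_ge_zero[of "v n ^ d"] by linarith
  next
    case False
    then have "cmod (v n) \<le> cmod (v n) ^ d" using assms(2) by (intro self_le_power) auto
    then show ?thesis using K[of n] by (simp add: norm_power)
  qed
  then show ?thesis by (auto simp: bounded_iff)
qed

text \<open>Put s = n + 1 and c = s^\<alpha> b. The numbers w / s are the roots of w^\<alpha> -
  w^(\<alpha>-1) / s - (-1)^\<alpha> b, whose middle term disappears in the limit.\<close>

lemma trinomial_roots_at_infinity:
  fixes r :: "nat \<Rightarrow> nat \<Rightarrow> nat \<Rightarrow> complex"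
  assumes r: "\<And>n i. i \<in> I \<Longrightarrow> trinomial_roots \<alpha> (of_real (real (Suc n) powr real \<alpha>) * b i) (r n i)"
    and "finite I" "\<alpha> \<ge> 2"
  shows "\<exists>t u. strict_mono (t :: nat \<Rightarrow> nat) \<and>
    (\<forall>i\<in>I. (\<forall>w. (\<Prod>j<\<alpha>. w - u i j) = w ^ \<alpha> - (- 1) ^ \<alpha> * b i) \<and>
      (\<forall>j<\<alpha>. (\<lambda>n. r (t n) i j / of_real (real (Suc (t n)))) \<longlonglongrightarrow> u i j))"
proof -
  define s where "s n = complex_of_real (real (Suc n))" for n
  have s0: "s n \<noteq> 0" for n by (simp add: s_def flip: of_nat_Suc)
  have sp: "of_real (real (Suc n) powr real \<alpha>) = s n ^ \<alpha>" for n
    unfolding s_def by (subst powr_realpow) simp_all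
  have pw: "a ^ \<alpha> = a * a ^ (\<alpha> - 1)" for a :: complex
    using assms(3) by (simp add: power_eq_if)
  have lim0: "(\<lambda>n. 1 / s n) \<longlonglongrightarrow> 0"
    unfolding s_def by (rule tendsto_one_over_Suc)
  have prod: "(\<Prod>j<\<alpha>. w - r n i j / s n) = w ^ \<alpha> - w ^ (\<alpha> - 1) * (1 / s n) - (- 1) ^ \<alpha> * b i"
    if "i \<in> I" for i n w
  proof -
    have "s n ^ \<alpha> * (\<Prod>j<\<alpha>. w - r n i j / s n) = (\<Prod>j<\<alpha>. s n * (w - r n i j / s n))"
      by (simp add: prod.distrib)
    also have "\<dots> = (\<Prod>j<\<alpha>. s n * w - r n i j)"
      using s0[of n] by (intro prod.cong) (auto simp: right_diff_distrib)
    also have "\<dots> = (s n * w) ^ \<alpha> - (s n * w) ^ (\<alpha> - 1) - (- 1) ^ \<alpha> * (s n ^ \<alpha> * b i)"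
      using r[OF that, of n] unfolding trinomial_roots_def sp by metis
    also have "\<dots> = s n ^ \<alpha> * (w ^ \<alpha> - w ^ (\<alpha> - 1) * (1 / s n) - (- 1) ^ \<alpha> * b i)"
      using s0[of n] by (simp add: power_mult_distrib pw[of "s n"] field_simps)
    finally show ?thesis using s0[of n] by simp
  qed
  have bnd: "bounded (range (\<lambda>n. r n i j / s n))" if "i \<in> I" "j < \<alpha>" for i j
  proof -
    have "cmod (r n i j / s n) \<le> 1 + cmod (1 / s n) + cmod ((- 1) ^ \<alpha> * b i)" for n
    proof (rule cmod_trinomial_root_le)
      have "(\<Prod>j'<\<alpha>. r n i j / s n - r n i j' / s n) = 0" using that by (intro prod_zero) auto
      then show "(r n i j / s n) ^ \<alpha> = 1 / s n * (r n i j / s n) ^ (\<alpha> - 1) + (- 1) ^ \<alpha> * b i"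
        unfolding prod[OF that(1)] by (simp add: algebra_simps)
    qed (use assms in simp)
    moreover have "cmod (1 / s n) \<le> 1" for n 
      unfolding s_def norm_divide norm_of_real by simp
    ultimately have "cmod (r n i j / s n) \<le> 2 + cmod ((- 1) ^ \<alpha> * b i)" for n
      by (smt (verit, best))
    then show ?thesis by (auto simp: bounded_iff)
  qed
  obtain t l where t: "strict_mono (t :: nat \<Rightarrow> nat)"
    and l: "\<And>i j. i \<in> I \<Longrightarrow> j < \<alpha> \<Longrightarrow> (\<lambda>n. r (t n) i j / s (t n)) \<longlonglongrightarrow> l (i, j)"
    using finite_family_convergent_subseq[of "I \<times> {..<\<alpha>}" "\<lambda>n (i, j). r n i j / s n"] assms(2) bnd
    by fastforce
  have "(\<Prod>j<\<alpha>. w - l (i, j)) = w ^ \<alpha> - (- 1) ^ \<alpha> * b i" if i: "i \<in> I" for i w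
  proof -
    have "(\<lambda>n. \<Prod>j<\<alpha>. w - r (t n) i j / s (t n)) \<longlonglongrightarrow> (\<Prod>j<\<alpha>. w - l (i, j))"
      using i l by (intro tendsto_intros) auto
    moreover have "(\<lambda>n. w ^ \<alpha> - w ^ (\<alpha> - 1) * (1 / s (t n)) - (- 1) ^ \<alpha> * b i) \<longlonglongrightarrow>
        w ^ \<alpha> - w ^ (\<alpha> - 1) * 0 - (- 1) ^ \<alpha> * b i"
      using LIMSEQ_subseq_LIMSEQ[OF lim0 t] by (intro tendsto_intros) (simp add: o_def)
    ultimately show ?thesis unfolding prod[OF i] using LIMSEQ_unique by fastforce
  qed
  then show ?thesis using t l unfolding s_def by (intro exI[of _ t] exI[of _ "\<lambda>i j. l (i, j)"]) auto
qed

text \<open>For c = 0 the trinomial is (w - 1) w^(\<alpha>-1), in which 1 is a simple root.\<close>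

lemma trinomial_roots_zero:
  assumes "trinomial_roots \<alpha> 0 r" "\<alpha> \<ge> 2"
  shows "\<exists>j0<\<alpha>. r j0 = 1 \<and> (\<forall>j<\<alpha>. j \<noteq> j0 \<longrightarrow> r j = 0)"
proof -
  have pw: "a ^ \<alpha> = a * a ^ (\<alpha> - 1)" for a :: complex
    using assms(2) by (simp add: power_eq_if)
  have "(\<Prod>j<\<alpha>. 1 - r j) = 0" using assms(1) by (simp add: trinomial_roots_def)
  then obtain j0 where j0: "j0 < \<alpha>" "r j0 = 1" by (auto simp: prod_zero_iff)
  let ?q = "\<Prod>j\<in>{..<\<alpha>} - {j0}. [:- r j, 1:]"
  have "poly ([:- 1, 1:] * ?q) w = poly ([:- 1, 1:] * monom 1 (\<alpha> - 1)) w" for w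
  proof -
    have "(\<Prod>j<\<alpha>. w - r j) = (w - r j0) * (\<Prod>j\<in>{..<\<alpha>} - {j0}. w - r j)"
      using j0(1) by (intro prod.remove) auto
    then have "poly ([:- 1, 1:] * ?q) w = (\<Prod>j<\<alpha>. w - r j)"
      unfolding poly_mult poly_prod using j0(2) by simp
    also have "\<dots> = poly ([:- 1, 1:] * monom 1 (\<alpha> - 1)) w"
      using assms(1) by (simp add: trinomial_roots_def poly_monom pw algebra_simps)
    finally show ?thesis .
  qed
  then have "[:- 1, 1:] * ?q = [:- 1, 1:] * monom 1 (\<alpha> - 1)"
    by (intro iffD1[OF poly_eq_poly_eq_iff] ext)
  then have q: "?q = monom 1 (\<alpha> - 1)" by (subst (asm) mult_cancel_left) simp
  have "r j = 0" if "j < \<alpha>" "j \<noteq> j0" for j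
  proof -
    have "poly ?q (r j) = 0" unfolding poly_prod using that by (intro prod_zero) auto
    then show ?thesis unfolding q using assms(2) by (simp add: poly_monom)
  qed
  then show ?thesis using j0 by auto
qed

text \<open>Two successive subsequences are needed. Along one the roots converge to those for c = 0,
  which singles out the label \<open>j0 i\<close> of the root near 1. The remaining roots tend to 0,
  which makes them bounded after multiplication by s = n + 1, and a further subsequence makes the
  rescaled roots converge.\<close>

lemma trinomial_roots_at_zero:
  fixes r :: "nat \<Rightarrow> nat \<Rightarrow> nat \<Rightarrow> complex"
  assumes r: "\<And>n i. i \<in> I \<Longrightarrow> trinomial_roots \<alpha> (of_real (real (Suc n) powr (1 - real \<alpha>)) * b i) (r n i)"
    and "finite I" "\<alpha> \<ge> 2" "\<And>i. i \<in> I \<Longrightarrow> b i \<noteq> 0"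
  shows "\<exists>t j0 u. strict_mono (t :: nat \<Rightarrow> nat) \<and>
    (\<forall>i\<in>I. j0 i < \<alpha> \<and> (\<lambda>n. r (t n) i (j0 i)) \<longlonglongrightarrow> 1 \<and>
      (\<forall>w. (\<Prod>j\<in>{..<\<alpha>} - {j0 i}. w - u i j) = w ^ (\<alpha> - 1) + (- 1) ^ \<alpha> * b i) \<and>
      (\<forall>j<\<alpha>. j \<noteq> j0 i \<longrightarrow> (\<lambda>n. of_real (real (Suc (t n))) * r (t n) i j) \<longlonglongrightarrow> u i j))"
proof -
  define s where "s n = complex_of_real (real (Suc n))" for n
  have s0: "s n \<noteq> 0" for n by (simp add: s_def flip: of_nat_Suc)
  have sp: "of_real (real (Suc n) powr (1 - real \<alpha>)) = 1 / s n ^ (\<alpha> - 1)" for n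
  proof -
    have "real (Suc n) powr (1 - real \<alpha>) = real (Suc n) powr (- real (\<alpha> - 1))"
      using assms(3) by (simp add: of_nat_diff)
    also have "\<dots> = 1 / real (Suc n) ^ (\<alpha> - 1)"
      by (simp only: powr_minus powr_realpow[of "real (Suc n)"] inverse_eq_divide of_nat_0_less_iff zero_less_Suc)
    finally show ?thesis unfolding s_def by simp
  qed
  have pw: "a ^ \<alpha> = a * a ^ (\<alpha> - 1)" for a :: complex
    using assms(3) by (simp add: power_eq_if)
  have lim0: "(\<lambda>n. 1 / s n) \<longlonglongrightarrow> 0"
    unfolding s_def by (rule tendsto_one_over_Suc)
  have "(\<lambda>n. (1 / s n) ^ (\<alpha> - 1) * b i) \<longlonglongrightarrow> 0 ^ (\<alpha> - 1) * b i" for i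
    by (intro tendsto_intros lim0)
  then have xlim: "(\<lambda>n. of_real (real (Suc n) powr (1 - real \<alpha>)) * b i) \<longlonglongrightarrow> 0" for i
    unfolding sp using assms(3) by (simp add: power_one_over power_0_left)
  have "\<exists>t1 r0. strict_mono (t1 :: nat \<Rightarrow> nat) \<and>
      (\<forall>i\<in>I. trinomial_roots \<alpha> 0 (r0 i) \<and> (\<forall>j<\<alpha>. (\<lambda>n. r (t1 n) i j) \<longlonglongrightarrow> r0 i j))"
    by (rule trinomial_roots_limit[of I \<alpha> "\<lambda>n i. of_real (real (Suc n) powr (1 - real \<alpha>)) * b i" r "\<lambda>_. 0"])
      (use r xlim assms(2,3) in \<open>auto simp del: of_nat_Suc\<close>)
  then obtain t1 r0 where t1: "strict_mono (t1 :: nat \<Rightarrow> nat)"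
    and r0: "\<And>i. i \<in> I \<Longrightarrow> trinomial_roots \<alpha> 0 (r0 i)"
    and lim_r: "\<And>i j. i \<in> I \<Longrightarrow> j < \<alpha> \<Longrightarrow> (\<lambda>n. r (t1 n) i j) \<longlonglongrightarrow> r0 i j"
    by blast
  have "\<exists>j0. \<forall>i\<in>I. j0 i < \<alpha> \<and> r0 i (j0 i) = 1 \<and> (\<forall>j<\<alpha>. j \<noteq> j0 i \<longrightarrow> r0 i j = 0)"
    using trinomial_roots_zero[OF r0 assms(3)] by (intro bchoice) blast
  then obtain j0 where j0: "\<And>i. i \<in> I \<Longrightarrow> j0 i < \<alpha>" "\<And>i. i \<in> I \<Longrightarrow> r0 i (j0 i) = 1"
    "\<And>i j. i \<in> I \<Longrightarrow> j < \<alpha> \<Longrightarrow> j \<noteq> j0 i \<Longrightarrow> r0 i j = 0" by blast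
  let ?v = "\<lambda>n i j. s n * r n i j"
  have bnd: "bounded (range (\<lambda>n. ?v (t1 n) i j))" if ij: "i \<in> I" "j < \<alpha>" "j \<noteq> j0 i" for i j
  proof (rule bounded_of_power)
    \<comment> \<open>The trinomial in the form w^(\<alpha>-1) (w - 1) = (-1)^\<alpha> c, with c = b
      / s^(\<alpha>-1). As b is nonzero, w = 1 cannot occur.\<close>
    have eq: "?v n i j ^ (\<alpha> - 1) = (- 1) ^ \<alpha> * b i / (r n i j - 1)" for n
    proof -
      have "r n i j ^ (\<alpha> - 1) * (r n i j - 1) = (- 1) ^ \<alpha> * (1 / s n ^ (\<alpha> - 1) * b i)"
        using trinomial_roots_root[OF r[OF ij(1), of n] ij(2)] unfolding sp pw[of "r n i j"]
        by (simp add: algebra_simps)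
      then have *: "?v n i j ^ (\<alpha> - 1) * (r n i j - 1) = (- 1) ^ \<alpha> * b i"
        using s0[of n] by (simp add: power_mult_distrib field_simps)
      then have "r n i j - 1 \<noteq> 0" using assms(4)[OF ij(1)] by auto
      then show ?thesis using * by (simp add: field_simps)
    qed
    have "(\<lambda>n. (- 1) ^ \<alpha> * b i / (r (t1 n) i j - 1)) \<longlonglongrightarrow> (- 1) ^ \<alpha> * b i / (0 - 1)"
      using lim_r[OF ij(1,2)] j0(3)[OF ij] by (intro tendsto_intros) auto
    then show "bounded (range (\<lambda>n. ?v (t1 n) i j ^ (\<alpha> - 1)))"
      unfolding eq using convergentI convergent_imp_bounded by blast
  qed (use assms(3) in simp)
  define K where "K = {(i, j). i \<in> I \<and> j < \<alpha> \<and> j \<noteq> j0 i}"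
  have "K \<subseteq> I \<times> {..<\<alpha>}" by (auto simp: K_def)
  then have "finite K" using assms(2) finite_subset by blast
  then obtain t2 l where t2: "strict_mono (t2 :: nat \<Rightarrow> nat)"
    and l: "\<And>i j. i \<in> I \<Longrightarrow> j < \<alpha> \<Longrightarrow> j \<noteq> j0 i \<Longrightarrow> (\<lambda>n. ?v (t1 (t2 n)) i j) \<longlonglongrightarrow> l (i, j)"
    using finite_family_convergent_subseq[of K "\<lambda>n (i, j). ?v (t1 n) i j"] bnd
    unfolding K_def by fastforce
  define t where "t n = t1 (t2 n)" for n
  have t: "strict_mono t" using t1 t2 by (simp add: t_def strict_mono_def)
  have one: "(\<lambda>n. r (t n) i (j0 i)) \<longlonglongrightarrow> 1" if "i \<in> I" for i
    using LIMSEQ_subseq_LIMSEQ[OF lim_r[OF that j0(1)[OF that]] t2] j0(2)[OF that]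
    by (simp add: o_def t_def)
  have "(\<Prod>j\<in>{..<\<alpha>} - {j0 i}. w - l (i, j)) = w ^ (\<alpha> - 1) + (- 1) ^ \<alpha> * b i" if i: "i \<in> I" for i w
  proof -
    let ?J = "{..<\<alpha>} - {j0 i}"
    have cJ: "card ?J = \<alpha> - 1" using j0(1)[OF i] by simp
    \<comment> \<open>The product identity at w / s, multiplied by s^(\<alpha>-1): the \<alpha> - 1
      small roots are rescaled and the root near 1 is not.\<close>
    have eq: "(w * (1 / s n) - r n i (j0 i)) * (\<Prod>j\<in>?J. w - ?v n i j) =
        w ^ \<alpha> * (1 / s n) - w ^ (\<alpha> - 1) - (- 1) ^ \<alpha> * b i" for n
    proof -
      have "(w * (1 / s n) - r n i (j0 i)) * (\<Prod>j\<in>?J. w - ?v n i j) =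
          (w / s n - r n i (j0 i)) * (\<Prod>j\<in>?J. s n * (w / s n - r n i j))"
        using s0[of n] by (simp add: right_diff_distrib)
      also have "\<dots> = s n ^ (\<alpha> - 1) * (\<Prod>j<\<alpha>. w / s n - r n i j)"
        using j0(1)[OF i] cJ by (subst prod.remove[of "{..<\<alpha>}" "j0 i"]) (auto simp: prod.distrib)
      also have "(\<Prod>j<\<alpha>. w / s n - r n i j) =
          (w / s n) ^ \<alpha> - (w / s n) ^ (\<alpha> - 1) - (- 1) ^ \<alpha> * (1 / s n ^ (\<alpha> - 1) * b i)"
        using r[OF i, of n] unfolding trinomial_roots_def sp by metis
      also have "s n ^ (\<alpha> - 1) * \<dots> = w ^ \<alpha> * (1 / s n) - w ^ (\<alpha> - 1) - (- 1) ^ \<alpha> * b i"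
        using s0[of n] by (simp add: power_divide pw[of "s n"] right_diff_distrib)
      finally show ?thesis .
    qed
    have lim0t: "(\<lambda>n. 1 / s (t n)) \<longlonglongrightarrow> 0"
      using LIMSEQ_subseq_LIMSEQ[OF lim0 t] by (simp add: o_def)
    have "(\<lambda>n. (w * (1 / s (t n)) - r (t n) i (j0 i)) * (\<Prod>j\<in>?J. w - ?v (t n) i j)) \<longlonglongrightarrow>
        (w * 0 - 1) * (\<Prod>j\<in>?J. w - l (i, j))"
      using i l by (intro tendsto_intros lim0t one) (auto simp: t_def)
    moreover have "(\<lambda>n. w ^ \<alpha> * (1 / s (t n)) - w ^ (\<alpha> - 1) - (- 1) ^ \<alpha> * b i) \<longlonglongrightarrow>
        w ^ \<alpha> * 0 - w ^ (\<alpha> - 1) - (- 1) ^ \<alpha> * b i"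
      by (intro tendsto_intros lim0t)
    ultimately have "(w * 0 - 1) * (\<Prod>j\<in>?J. w - l (i, j)) = w ^ \<alpha> * 0 - w ^ (\<alpha> - 1) - (- 1) ^ \<alpha> * b i"
      unfolding eq by (rule LIMSEQ_unique)
    then have "- (\<Prod>j\<in>?J. w - l (i, j)) = - (w ^ (\<alpha> - 1) + (- 1) ^ \<alpha> * b i)" by simp
    then show ?thesis by (simp only: neg_equal_iff_equal)
  qed
  then show ?thesis using t j0(1) one l unfolding s_def t_def
    by (intro exI[of _ "\<lambda>n. t1 (t2 n)"] exI[of _ j0] exI[of _ "\<lambda>i j. l (i, j)"]) auto
qed

section \<open>Limits of the A-polynomial under weighted scaling\<close>

text \<open>A multiplicative set containing every constant of the binomials. It serves both claims
  at once: its elements lie in \<open>int_adjoin m lam\<close>, and have modulus 1 if all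
  \<open>lam i\<close> do.\<close>

definition unit_monomials :: "nat \<Rightarrow> (nat \<Rightarrow> complex) \<Rightarrow> complex set" where
  "unit_monomials m lam = {c * (\<Prod>i\<in>{1..m}. lam i ^ e i) |c e. c = 1 \<or> c = -1}"

lemma unit_monomialsI: "c = 1 \<or> c = -1 \<Longrightarrow> c * (\<Prod>i\<in>{1..m}. lam i ^ e i) \<in> unit_monomials m lam"
  unfolding unit_monomials_def by blast

lemma sign_in_unit_monomials: "c = 1 \<or> c = -1 \<Longrightarrow> c \<in> unit_monomials m lam"
  using unit_monomialsI[of c lam "\<lambda>_. 0" m] by simp

lemma unit_monomials_mult:
  assumes "x \<in> unit_monomials m lam" "y \<in> unit_monomials m lam"
  shows "x * y \<in> unit_monomials m lam"
proof -
  obtain c e where x: "x = c * (\<Prod>i\<in>{1..m}. lam i ^ e i)" "c = 1 \<or> c = -1"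
    using assms(1) unfolding unit_monomials_def by blast
  obtain d f where y: "y = d * (\<Prod>i\<in>{1..m}. lam i ^ f i)" "d = 1 \<or> d = -1"
    using assms(2) unfolding unit_monomials_def by blast
  have "x * y = (c * d) * (\<Prod>i\<in>{1..m}. lam i ^ (e i + f i))"
    unfolding x(1) y(1) by (simp add: power_add prod.distrib)
  moreover have "c * d = 1 \<or> c * d = -1" using x(2) y(2) by auto
  ultimately show ?thesis using unit_monomialsI by metis
qed

lemma unit_monomials_uminus: "x \<in> unit_monomials m lam \<Longrightarrow> - x \<in> unit_monomials m lam"
  using unit_monomials_mult[OF sign_in_unit_monomials[of "-1"], of x] by simp

lemma unit_monomials_power: "x \<in> unit_monomials m lam \<Longrightarrow> x ^ n \<in> unit_monomials m lam"
  by (induction n) (auto intro: unit_monomials_mult sign_in_unit_monomials)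

lemma unit_monomials_prod:
  "(\<And>i. i \<in> S \<Longrightarrow> f i \<in> unit_monomials m lam) \<Longrightarrow> prod f S \<in> unit_monomials m lam"
  by (induction S rule: infinite_finite_induct) (auto intro: unit_monomials_mult sign_in_unit_monomials)

lemma lam_in_unit_monomials:
  assumes "i \<in> {1..m}"
  shows "lam i \<in> unit_monomials m lam"
proof -
  have "(\<Prod>l\<in>{1..m}. lam l ^ (if l = i then 1 else 0)) = lam i"
    using assms by (subst prod.remove[of _ i]) (auto intro!: prod.neutral)
  then show ?thesis using unit_monomialsI[of 1 lam "\<lambda>l. if l = i then 1 else 0" m] by simp
qed

lemma unit_monomials_nonzero:
  assumes "x \<in> unit_monomials m lam" "\<forall>i\<in>{1..m}. lam i \<noteq> 0"
  shows "x \<noteq> 0"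
  using assms by (auto simp: unit_monomials_def)

lemma unit_monomials_cmod:
  assumes "x \<in> unit_monomials m lam" "\<forall>i\<in>{1..m}. cmod (lam i) = 1"
  shows "cmod x = 1"
proof -
  obtain c e where x: "x = c * (\<Prod>i\<in>{1..m}. lam i ^ e i)" "c = 1 \<or> c = -1"
    using assms(1) unfolding unit_monomials_def by blast
  have "(\<Prod>i\<in>{1..m}. cmod (lam i) ^ e i) = 1" using assms(2) by (intro prod.neutral) simp
  then show ?thesis using x by (auto simp: norm_mult norm_power prod_norm[symmetric])
qed

lemma unit_monomials_int_adjoin: "unit_monomials m lam \<subseteq> int_adjoin m lam"
proof
  fix x assume "x \<in> unit_monomials m lam"
  then obtain c e where x: "x = c * (\<Prod>i\<in>{1..m}. lam i ^ e i)" "c = 1 \<or> c = -1"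
    unfolding unit_monomials_def by blast
  obtain k :: int where k: "c = of_int k" using x(2) by (metis of_int_1 of_int_minus)
  define t where "t = (\<Sum>i\<in>{1..m}. Poly_Mapping.single i (e i))"
  have lookup: "Poly_Mapping.lookup t i = (if i \<in> {1..m} then e i else 0)" for i
    by (simp add: t_def lookup_sum lookup_single when_def)
  then have keys: "Poly_Mapping.keys t \<subseteq> {1..m}" by (auto simp: in_keys_iff split: if_splits)
  have "mpoly_eval (Poly_Mapping.single t k) lam = of_int k * (\<Prod>i\<in>{1..m}. lam i ^ Poly_Mapping.lookup t i)"
    unfolding mpoly_eval_single using keys
    by (intro arg_cong2[where f = "(*)"] refl prod.mono_neutral_left) (auto simp: in_keys_iff)
  also have "\<dots> = x" using lookup x(1) k by simp
  finally have "x = mpoly_eval (Poly_Mapping.single t k) lam" ..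
  moreover have "mpoly_vars (Poly_Mapping.single t k) \<subseteq> {1..m}"
    using keys by (auto simp: mpoly_vars_def)
  ultimately show "x \<in> int_adjoin m lam" unfolding int_adjoin_def by blast
qed

lemma zero_in_int_adjoin: "0 \<in> int_adjoin m lam"
proof -
  have "mpoly_vars 0 \<subseteq> {1..m}" by (simp add: mpoly_vars_def)
  then show ?thesis unfolding int_adjoin_def by (intro CollectI exI[of _ 0]) simp
qed

text \<open>All binomials share one exponent vector (g, h), which points along the edge but need not
  be primitive. The list \<open>bs\<close> may be empty, so monomials are included.\<close>

definition binomial_product ::
  "complex set \<Rightarrow> nat \<Rightarrow> nat \<Rightarrow> (complex \<Rightarrow> complex \<Rightarrow> complex) \<Rightarrow> bool" where
  "binomial_product U g h L \<longleftrightarrow>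
     (\<exists>\<mu> a b bs. \<mu> \<in> U \<and> set bs \<subseteq> U \<and>
        (\<forall>X Y. L X Y = \<mu> * X ^ a * Y ^ b * (\<Prod>\<beta>\<leftarrow>bs. 1 - \<beta> * (X ^ g * Y ^ h))))"

lemma binomial_product_monomial:
  "\<mu> \<in> U \<Longrightarrow> binomial_product U g h (\<lambda>X Y. \<mu> * X ^ a * Y ^ b)"
  unfolding binomial_product_def by (intro exI[of _ \<mu>] exI[of _ a] exI[of _ b] exI[of _ "[]"]) simp

lemma binomial_product_one_minus:
  "1 \<in> U \<Longrightarrow> \<beta> \<in> U \<Longrightarrow> binomial_product U g h (\<lambda>X Y. 1 - \<beta> * (X ^ g * Y ^ h))"
  unfolding binomial_product_def by (intro exI[of _ 1] exI[of _ 0] exI[of _ "[\<beta>]"]) simp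

lemma binomial_product_mult:
  assumes "binomial_product (unit_monomials m lam) g h L" "binomial_product (unit_monomials m lam) g h L'"
  shows "binomial_product (unit_monomials m lam) g h (\<lambda>X Y. L X Y * L' X Y)"
proof -
  obtain \<mu> a b bs where L: "\<mu> \<in> unit_monomials m lam" "set bs \<subseteq> unit_monomials m lam"
    "\<And>X Y. L X Y = \<mu> * X ^ a * Y ^ b * (\<Prod>\<beta>\<leftarrow>bs. 1 - \<beta> * (X ^ g * Y ^ h))"
    using assms(1) unfolding binomial_product_def by blast
  obtain \<mu>' a' b' bs' where L': "\<mu>' \<in> unit_monomials m lam" "set bs' \<subseteq> unit_monomials m lam"
    "\<And>X Y. L' X Y = \<mu>' * X ^ a' * Y ^ b' * (\<Prod>\<beta>\<leftarrow>bs'. 1 - \<beta> * (X ^ g * Y ^ h))"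
    using assms(2) unfolding binomial_product_def by blast
  show ?thesis
    unfolding binomial_product_def L(3) L'(3)
    using L(1,2) L'(1,2)
    by (intro exI[of _ "\<mu> * \<mu>'"] exI[of _ "a + a'"] exI[of _ "b + b'"] exI[of _ "bs @ bs'"])
      (auto simp: unit_monomials_mult power_add mult_ac)
qed

lemma binomial_product_prod:
  assumes "\<And>i. i \<in> S \<Longrightarrow> binomial_product (unit_monomials m lam) g h (L i)"
  shows "binomial_product (unit_monomials m lam) g h (\<lambda>X Y. \<Prod>i\<in>S. L i X Y)"
proof -
  have one: "binomial_product (unit_monomials m lam) g h (\<lambda>X Y. 1)"
    using binomial_product_monomial[OF sign_in_unit_monomials[of 1], of m lam g h 0 0] by simp
  show ?thesis
    using assms
  proof (induction S rule: infinite_finite_induct)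
    case (insert i S)
    then show ?case using binomial_product_mult[of m lam g h "L i" "\<lambda>X Y. \<Prod>i\<in>S. L i X Y"] by simp
  qed (use one in auto)
qed

lemma binomial_product_power:
  assumes "binomial_product (unit_monomials m lam) g h L"
  shows "binomial_product (unit_monomials m lam) g h (\<lambda>X Y. L X Y ^ n)"
  using binomial_product_prod[of "{..<n}" m lam g h "\<lambda>_. L"] assms by simp

text \<open>The subsequence t may depend on X and Y, since it comes from the labelling of the roots.
  The exponent N is fixed and will be matched with the weight of the edge.\<close>

definition scaled_limit ::
  "(complex \<Rightarrow> complex \<Rightarrow> complex) \<Rightarrow> real \<Rightarrow> real \<Rightarrow> real \<Rightarrow> complex \<Rightarrow> complex \<Rightarrow> complex \<Rightarrow> bool" where
  "scaled_limit E p q N X Y l \<longleftrightarrow> (\<exists>t. strict_mono (t :: nat \<Rightarrow> nat) \<and>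
     (\<lambda>n. of_real (real (Suc (t n)) powr (- N)) *
        E (of_real (real (Suc (t n)) powr p) * X) (of_real (real (Suc (t n)) powr q) * Y)) \<longlonglongrightarrow> l)"

lemma filterlim_Suc_strict_mono:
  assumes "strict_mono (t :: nat \<Rightarrow> nat)"
  shows "filterlim (\<lambda>n. real (Suc (t n))) at_top sequentially"
proof -
  have "filterlim (\<lambda>n. Suc (t n)) at_top sequentially"
    using filterlim_subseq[OF assms] filterlim_compose filterlim_Suc by blast
  then show ?thesis using filterlim_compose[OF filterlim_real_sequentially] by blast
qed

section \<open>Scaling limits for p positive, zero and negative\<close>

context
  fixes E :: "complex \<Rightarrow> complex \<Rightarrow> complex" and m \<alpha> :: nat and lam :: "nat \<Rightarrow> complex" and c :: complex
  assumes \<alpha>: "\<alpha> \<ge> 2" and m: "m \<ge> 1" and lam: "\<forall>i\<in>{1..m}. lam i \<noteq> 0" and c: "c = 1 \<or> c = -1"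
    and E: "\<And>x y. y \<noteq> 0 \<Longrightarrow> \<exists>r. (\<forall>i\<in>{1..m}. trinomial_roots \<alpha> (lam i * x) (r i)) \<and>
      E x y = c * (\<Prod>k\<in>index_set m \<alpha>. 1 - y * (\<Prod>i\<in>{1..m}. r i (k i)))"
begin

lemma scaled_roots:
  assumes "Y \<noteq> 0"
  shows "\<exists>r. \<forall>n. (\<forall>i\<in>{1..m}. trinomial_roots \<alpha> (of_real (real (Suc n) powr p) * (lam i * X)) (r n i)) \<and>
    E (of_real (real (Suc n) powr p) * X) (of_real (real (Suc n) powr q) * Y) =
      c * (\<Prod>k\<in>index_set m \<alpha>. 1 - of_real (real (Suc n) powr q) * Y * (\<Prod>i\<in>{1..m}. r n i (k i)))"
proof (intro choice allI)
  fix n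
  have "of_real (real (Suc n) powr q) * Y \<noteq> 0" using assms by simp
  from E[OF this, of "of_real (real (Suc n) powr p) * X"]
  show "\<exists>r. (\<forall>i\<in>{1..m}. trinomial_roots \<alpha> (of_real (real (Suc n) powr p) * (lam i * X)) (r i)) \<and>
    E (of_real (real (Suc n) powr p) * X) (of_real (real (Suc n) powr q) * Y) =
      c * (\<Prod>k\<in>index_set m \<alpha>. 1 - of_real (real (Suc n) powr q) * Y * (\<Prod>i\<in>{1..m}. r i (k i)))"
    by (simp only: mult.left_commute)
qed

text \<open>Each root grows like s, so y w 1 ... w m has order s^(q + m) for every choice of roots.
  All factors share the same \<theta>, and a genuine binomial can occur only for q = - m.\<close>

lemma scaled_limit_at_infinity:
  assumes "X \<noteq> 0" "Y \<noteq> 0"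
  shows "scaled_limit E \<alpha> q (\<Sum>k\<in>index_set m \<alpha>. max 0 (q + real m)) X Y
    (c * factor_limit (q + real m) (Y ^ \<alpha> * (\<Prod>i\<in>{1..m}. (- 1) ^ \<alpha> * (lam i * X))) ^ (\<alpha> ^ (m - 1)))"
proof -
  obtain r where r: "\<And>n i. i \<in> {1..m} \<Longrightarrow> trinomial_roots \<alpha> (of_real (real (Suc n) powr real \<alpha>) * (lam i * X)) (r n i)"
    and Er: "\<And>n. E (of_real (real (Suc n) powr real \<alpha>) * X) (of_real (real (Suc n) powr q) * Y) =
      c * (\<Prod>k\<in>index_set m \<alpha>. 1 - of_real (real (Suc n) powr q) * Y * (\<Prod>i\<in>{1..m}. r n i (k i)))"
    using scaled_roots[OF assms(2), of "real \<alpha>" X q] by blast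
  have "\<exists>t u. strict_mono (t :: nat \<Rightarrow> nat) \<and>
    (\<forall>i\<in>{1..m}. (\<forall>w. (\<Prod>j<\<alpha>. w - u i j) = w ^ \<alpha> - (- 1) ^ \<alpha> * (lam i * X)) \<and>
      (\<forall>j<\<alpha>. (\<lambda>n. r (t n) i j / of_real (real (Suc (t n)))) \<longlonglongrightarrow> u i j))"
    by (rule trinomial_roots_at_infinity[OF r _ \<alpha>]) auto
  then obtain t u where t: "strict_mono (t :: nat \<Rightarrow> nat)"
    and u: "\<And>i w. i \<in> {1..m} \<Longrightarrow> (\<Prod>j<\<alpha>. w - u i j) = w ^ \<alpha> - (- 1) ^ \<alpha> * (lam i * X)"
    and lim: "\<And>i j. i \<in> {1..m} \<Longrightarrow> j < \<alpha> \<Longrightarrow> (\<lambda>n. r (t n) i j / of_real (real (Suc (t n)))) \<longlonglongrightarrow> u i j"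
    by blast
  let ?s = "\<lambda>n. real (Suc (t n))"
  let ?z = "\<lambda>n k. Y * (\<Prod>i\<in>{1..m}. r (t n) i (k i) / of_real (?s n))"
  have fac: "1 - of_real (?s n powr q) * Y * (\<Prod>i\<in>{1..m}. r (t n) i (k i)) =
      1 - of_real (?s n powr (q + real m)) * ?z n k" for n k
  proof -
    have "complex_of_real (?s n powr (q + real m)) = of_real (?s n powr q) * of_real (?s n) ^ m"
      by (simp only: powr_add powr_realpow[of "?s n"] of_nat_0_less_iff zero_less_Suc of_real_mult of_real_power)
    moreover have "complex_of_real (?s n) \<noteq> 0" by (simp flip: of_nat_Suc)
    ultimately show ?thesis by (simp add: prod_dividef del: of_real_of_nat_eq of_nat_Suc)
  qed
  have "(\<lambda>n. of_real (?s n powr (- (\<Sum>k\<in>index_set m \<alpha>. max 0 (q + real m)))) *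
      (\<Prod>k\<in>index_set m \<alpha>. 1 - of_real (?s n powr (q + real m)) * ?z n k)) \<longlonglongrightarrow>
      (\<Prod>k\<in>index_set m \<alpha>. factor_limit (q + real m) (Y * (\<Prod>i\<in>{1..m}. u i (k i))))"
  proof (intro tendsto_prod_factor_limit filterlim_Suc_strict_mono t)
    fix k assume "k \<in> index_set m \<alpha>"
    then have "k i < \<alpha>" if "i \<in> {1..m}" for i
      using that unfolding index_set_def by (metis PiE_mem lessThan_iff)
    then show "(\<lambda>n. ?z n k) \<longlonglongrightarrow> Y * (\<Prod>i\<in>{1..m}. u i (k i))"
      using lim by (intro tendsto_intros) auto
  qed auto
  also have "(\<Prod>k\<in>index_set m \<alpha>. factor_limit (q + real m) (Y * (\<Prod>i\<in>{1..m}. u i (k i)))) =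
      factor_limit (q + real m) (Y ^ \<alpha> * (\<Prod>i\<in>{1..m}. (- 1) ^ \<alpha> * (lam i * X))) ^ (\<alpha> ^ (card {1..m} - 1))"
    unfolding index_set_def using \<alpha> m u
    by (intro prod_PiE_factor_limit) auto
  finally have "(\<lambda>n. of_real (?s n powr (- (\<Sum>k\<in>index_set m \<alpha>. max 0 (q + real m)))) *
      (\<Prod>k\<in>index_set m \<alpha>. 1 - of_real (?s n powr q) * Y * (\<Prod>i\<in>{1..m}. r (t n) i (k i)))) \<longlonglongrightarrow>
      factor_limit (q + real m) (Y ^ \<alpha> * (\<Prod>i\<in>{1..m}. (- 1) ^ \<alpha> * (lam i * X))) ^ (\<alpha> ^ (m - 1))"
    unfolding fac by simp
  from tendsto_mult_left[OF this, of c]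
  show ?thesis
    unfolding scaled_limit_def Er using t by (intro exI[of _ t]) (simp add: mult.left_commute)
qed

text \<open>With x fixed the roots do not scale and none of them is 0. For q \<noteq> 0 each factor
  tends to 1 or to a nonzero multiple of Y.\<close>

lemma scaled_limit_horizontal_nonzero:
  assumes "X \<noteq> 0" "Y \<noteq> 0" "q \<noteq> 0"
  shows "\<exists>l. l \<noteq> 0 \<and> scaled_limit E 0 q (\<Sum>k\<in>index_set m \<alpha>. max 0 q) X Y l"
proof -
  obtain r where r: "\<And>n i. i \<in> {1..m} \<Longrightarrow> trinomial_roots \<alpha> (of_real (real (Suc n) powr 0) * (lam i * X)) (r n i)"
    and Er: "\<And>n. E (of_real (real (Suc n) powr 0) * X) (of_real (real (Suc n) powr q) * Y) =
      c * (\<Prod>k\<in>index_set m \<alpha>. 1 - of_real (real (Suc n) powr q) * Y * (\<Prod>i\<in>{1..m}. r n i (k i)))"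
    using scaled_roots[OF assms(2), of 0 X q] by blast
  have "\<exists>t u. strict_mono (t :: nat \<Rightarrow> nat) \<and>
    (\<forall>i\<in>{1..m}. trinomial_roots \<alpha> (lam i * X) (u i) \<and> (\<forall>j<\<alpha>. (\<lambda>n. r (t n) i j) \<longlonglongrightarrow> u i j))"
    using r \<alpha> by (intro trinomial_roots_limit[where x = "\<lambda>_ i. lam i * X"]) auto
  then obtain t u where t: "strict_mono (t :: nat \<Rightarrow> nat)"
    and u: "\<And>i. i \<in> {1..m} \<Longrightarrow> trinomial_roots \<alpha> (lam i * X) (u i)"
    and lim: "\<And>i j. i \<in> {1..m} \<Longrightarrow> j < \<alpha> \<Longrightarrow> (\<lambda>n. r (t n) i j) \<longlonglongrightarrow> u i j"
    by blast
  let ?s = "\<lambda>n. real (Suc (t n))"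
  have ki: "k i < \<alpha>" if "k \<in> index_set m \<alpha>" "i \<in> {1..m}" for k i
    using that unfolding index_set_def by (metis PiE_mem lessThan_iff)
  have "(\<lambda>n. of_real (?s n powr (- (\<Sum>k\<in>index_set m \<alpha>. max 0 q))) *
      (\<Prod>k\<in>index_set m \<alpha>. 1 - of_real (?s n powr q) * (Y * (\<Prod>i\<in>{1..m}. r (t n) i (k i))))) \<longlonglongrightarrow>
      (\<Prod>k\<in>index_set m \<alpha>. factor_limit q (Y * (\<Prod>i\<in>{1..m}. u i (k i))))" (is "_ \<longlonglongrightarrow> ?l")
  proof (intro tendsto_prod_factor_limit filterlim_Suc_strict_mono t)
    fix k assume "k \<in> index_set m \<alpha>"
    then show "(\<lambda>n. Y * (\<Prod>i\<in>{1..m}. r (t n) i (k i))) \<longlonglongrightarrow> Y * (\<Prod>i\<in>{1..m}. u i (k i))"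
      using lim ki by (intro tendsto_intros) auto
  qed auto
  from tendsto_mult_left[OF this, of c]
  have "scaled_limit E 0 q (\<Sum>k\<in>index_set m \<alpha>. max 0 q) X Y (c * ?l)"
    unfolding scaled_limit_def Er using t by (intro exI[of _ t]) (simp add: mult.left_commute mult.assoc)
  moreover have "u i (k i) \<noteq> 0" if "k \<in> index_set m \<alpha>" "i \<in> {1..m}" for k i
    using trinomial_roots_nonzero[OF u[OF that(2)] ki[OF that] \<alpha>] lam that(2) assms(1) by auto
  then have "c * ?l \<noteq> 0"
    using c assms(2,3) by (auto simp: factor_limit_def)
  ultimately show ?thesis by blast
qed

text \<open>Let S be the set of indices at which a small root is chosen. The product of the chosen
  roots has order s^(- card S), so \<theta> = q - card S, and (\<alpha>-1)^card S choices belong to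
  S. The empty set contributes the single factor in which all roots tend to 1.\<close>

lemma scaled_limit_at_zero:
  assumes "X \<noteq> 0" "Y \<noteq> 0"
  shows "scaled_limit E (1 - real \<alpha>) q
    (\<Sum>S\<in>Pow {1..m}. real ((\<alpha> - 1) ^ card S) * max 0 (q - real (card S))) X Y
    (c * (factor_limit q Y * (\<Prod>S\<in>Pow {1..m} - {{}}. factor_limit (q - real (card S))
       (Y ^ (\<alpha> - 1) * (\<Prod>i\<in>S. - ((- 1) ^ \<alpha> * (lam i * X)))) ^ ((\<alpha> - 1) ^ (card S - 1)))))"
proof -
  obtain r where r: "\<And>n i. i \<in> {1..m} \<Longrightarrow> trinomial_roots \<alpha> (of_real (real (Suc n) powr (1 - real \<alpha>)) * (lam i * X)) (r n i)"
    and Er: "\<And>n. E (of_real (real (Suc n) powr (1 - real \<alpha>)) * X) (of_real (real (Suc n) powr q) * Y) =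
      c * (\<Prod>k\<in>index_set m \<alpha>. 1 - of_real (real (Suc n) powr q) * Y * (\<Prod>i\<in>{1..m}. r n i (k i)))"
    using scaled_roots[OF assms(2), of "1 - real \<alpha>" X q] by blast
  have "\<exists>t j0 u. strict_mono (t :: nat \<Rightarrow> nat) \<and>
    (\<forall>i\<in>{1..m}. j0 i < \<alpha> \<and> (\<lambda>n. r (t n) i (j0 i)) \<longlonglongrightarrow> 1 \<and>
      (\<forall>w. (\<Prod>j\<in>{..<\<alpha>} - {j0 i}. w - u i j) = w ^ (\<alpha> - 1) + (- 1) ^ \<alpha> * (lam i * X)) \<and>
      (\<forall>j<\<alpha>. j \<noteq> j0 i \<longrightarrow> (\<lambda>n. of_real (real (Suc (t n))) * r (t n) i j) \<longlonglongrightarrow> u i j))"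
    by (rule trinomial_roots_at_zero[OF r _ \<alpha>]) (use lam assms(1) in auto)
  then obtain t j0 u where t: "strict_mono (t :: nat \<Rightarrow> nat)"
    and j0: "\<And>i. i \<in> {1..m} \<Longrightarrow> j0 i < \<alpha>"
    and lim1: "\<And>i. i \<in> {1..m} \<Longrightarrow> (\<lambda>n. r (t n) i (j0 i)) \<longlonglongrightarrow> 1"
    and u: "\<And>i w. i \<in> {1..m} \<Longrightarrow> (\<Prod>j\<in>{..<\<alpha>} - {j0 i}. w - u i j) = w ^ (\<alpha> - 1) - (- ((- 1) ^ \<alpha> * (lam i * X)))"
    and lim: "\<And>i j. i \<in> {1..m} \<Longrightarrow> j < \<alpha> \<Longrightarrow> j \<noteq> j0 i \<Longrightarrow>
      (\<lambda>n. of_real (real (Suc (t n))) * r (t n) i j) \<longlonglongrightarrow> u i j"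
    by (simp only: diff_minus_eq_add) blast
  let ?s = "\<lambda>n. real (Suc (t n))"
  let ?J = "\<lambda>i. {..<\<alpha>} - {j0 i}"
  let ?K = "SIGMA S:Pow {1..m}. PiE S ?J"
  \<comment> \<open>Exactly the small roots are multiplied by s, so that every entry
    converges.\<close>
  let ?z = "\<lambda>n Sk. Y * (\<Prod>i\<in>{1..m}. if i \<in> fst Sk then of_real (?s n) * r (t n) i (snd Sk i) else r (t n) i (j0 i))"
  have finPiE: "finite (PiE S ?J)" if "S \<subseteq> {1..m}" for S
    using that finite_subset by (intro finite_PiE) auto
  have cardJ: "card (?J i) = \<alpha> - 1" if "i \<in> {1..m}" for i
    using j0[OF that] by simp
  have fac: "1 - of_real (?s n powr q) * Y * (\<Prod>i\<in>{1..m}. r (t n) i ((\<lambda>i\<in>{1..m}. if i \<in> fst Sk then snd Sk i else j0 i) i)) =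
      1 - of_real (?s n powr (q - real (card (fst Sk)))) * ?z n Sk" if "Sk \<in> ?K" for n Sk
  proof -
    have S: "fst Sk \<subseteq> {1..m}" using that by auto
    have s0: "complex_of_real (?s n) \<noteq> 0" by (simp flip: of_nat_Suc)
    have "(\<Prod>i\<in>{1..m}. if i \<in> fst Sk then of_real (?s n) * r (t n) i (snd Sk i) else r (t n) i (j0 i)) =
      (\<Prod>i\<in>{1..m}. (if i \<in> fst Sk then of_real (?s n) else 1) *
        r (t n) i ((\<lambda>i\<in>{1..m}. if i \<in> fst Sk then snd Sk i else j0 i) i))"
      by (intro prod.cong) auto
    also have "\<dots> = (\<Prod>i\<in>{1..m}. if i \<in> fst Sk then of_real (?s n) else 1) *
        (\<Prod>i\<in>{1..m}. r (t n) i ((\<lambda>i\<in>{1..m}. if i \<in> fst Sk then snd Sk i else j0 i) i))"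
      by (rule prod.distrib)
    also have "(\<Prod>i\<in>{1..m}. if i \<in> fst Sk then of_real (?s n) else 1) = complex_of_real (?s n) ^ card (fst Sk)"
      using S by (simp add: prod.If_cases Int_absorb1 del: of_nat_Suc of_real_of_nat_eq)
    finally have z: "?z n Sk = Y * (complex_of_real (?s n) ^ card (fst Sk) *
        (\<Prod>i\<in>{1..m}. r (t n) i ((\<lambda>i\<in>{1..m}. if i \<in> fst Sk then snd Sk i else j0 i) i)))"
      by (simp only:)
    have "complex_of_real (?s n powr (q - real (card (fst Sk)))) =
        of_real (?s n powr q) / of_real (?s n) ^ card (fst Sk)"
      by (simp only: powr_diff powr_realpow[of "?s n"] of_nat_0_less_iff zero_less_Suc of_real_divide of_real_power)
    then show ?thesis unfolding z using s0 by (simp del: of_real_of_nat_eq of_nat_Suc)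
  qed
  have prodK: "(\<Prod>k\<in>index_set m \<alpha>. 1 - of_real (?s n powr q) * Y * (\<Prod>i\<in>{1..m}. r (t n) i (k i))) =
      (\<Prod>Sk\<in>?K. 1 - of_real (?s n powr (q - real (card (fst Sk)))) * ?z n Sk)" for n
  proof -
    let ?G = "\<lambda>k. 1 - of_real (?s n powr q) * Y * (\<Prod>i\<in>{1..m}. r (t n) i (k i))"
    have "(\<Prod>k\<in>index_set m \<alpha>. ?G k) = (\<Prod>(S, k)\<in>?K. ?G (\<lambda>i\<in>{1..m}. if i \<in> S then k i else j0 i))"
      unfolding index_set_def by (rule prod_PiE_by_support) (use j0 in auto)
    also have "\<dots> = (\<Prod>Sk\<in>?K. 1 - of_real (?s n powr (q - real (card (fst Sk)))) * ?z n Sk)"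
      unfolding split_def by (rule prod.cong[OF refl fac])
    finally show ?thesis .
  qed
  have sumK: "(\<Sum>Sk\<in>?K. max 0 (q - real (card (fst Sk)))) =
      (\<Sum>S\<in>Pow {1..m}. real ((\<alpha> - 1) ^ card S) * max 0 (q - real (card S)))"
  proof -
    have "(\<Sum>Sk\<in>?K. max 0 (q - real (card (fst Sk)))) =
        (\<Sum>S\<in>Pow {1..m}. \<Sum>k\<in>PiE S ?J. max 0 (q - real (card S)))"
      by (subst sum.Sigma) (auto simp: finPiE split_def)
    also have "\<dots> = (\<Sum>S\<in>Pow {1..m}. real (card (PiE S ?J)) * max 0 (q - real (card S)))"
      by simp
    also have "\<dots> = (\<Sum>S\<in>Pow {1..m}. real ((\<alpha> - 1) ^ card S) * max 0 (q - real (card S)))"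
    proof (rule sum.cong[OF refl])
      fix S assume S: "S \<in> Pow {1..m}"
      then have "finite S" using finite_subset by auto
      then have "card (PiE S ?J) = (\<Prod>i\<in>S. card (?J i))" by (rule card_PiE)
      also have "\<dots> = (\<Prod>i\<in>S. \<alpha> - 1)"
        by (rule prod.cong[OF refl cardJ]) (use S in auto)
      finally show "real (card (PiE S ?J)) * max 0 (q - real (card S)) =
          real ((\<alpha> - 1) ^ card S) * max 0 (q - real (card S))" by simp
    qed
    finally show ?thesis .
  qed
  let ?l = "\<Prod>Sk\<in>?K. factor_limit (q - real (card (fst Sk))) (Y * (\<Prod>i\<in>fst Sk. u i (snd Sk i)))"
  have "(\<lambda>n. of_real (?s n powr (- (\<Sum>Sk\<in>?K. max 0 (q - real (card (fst Sk)))))) *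
      (\<Prod>Sk\<in>?K. 1 - of_real (?s n powr (q - real (card (fst Sk)))) * ?z n Sk)) \<longlonglongrightarrow> ?l"
  proof (intro tendsto_prod_factor_limit filterlim_Suc_strict_mono t)
    show "finite ?K" using finPiE by (intro finite_SigmaI) auto
    fix Sk assume Sk: "Sk \<in> ?K"
    then have S: "fst Sk \<subseteq> {1..m}" "snd Sk \<in> PiE (fst Sk) ?J" by auto
    have "(\<lambda>n. ?z n Sk) \<longlonglongrightarrow> Y * (\<Prod>i\<in>{1..m}. if i \<in> fst Sk then u i (snd Sk i) else 1)"
    proof (intro tendsto_intros)
      fix i assume i: "i \<in> {1..m}"
      show "(\<lambda>n. if i \<in> fst Sk then of_real (?s n) * r (t n) i (snd Sk i) else r (t n) i (j0 i)) \<longlonglongrightarrow>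
          (if i \<in> fst Sk then u i (snd Sk i) else 1)"
      proof (cases "i \<in> fst Sk")
        case True
        then have "snd Sk i \<in> ?J i" using S(2) by (rule PiE_mem[rotated])
        then show ?thesis using lim[OF i, of "snd Sk i"] True by (simp del: of_nat_Suc of_real_of_nat_eq)
      qed (use lim1[OF i] in simp)
    qed
    also have "(\<Prod>i\<in>{1..m}. if i \<in> fst Sk then u i (snd Sk i) else 1) = (\<Prod>i\<in>fst Sk. u i (snd Sk i))"
      using S(1) by (simp add: prod.If_cases Int_absorb1)
    finally show "(\<lambda>n. ?z n Sk) \<longlonglongrightarrow> Y * (\<Prod>i\<in>fst Sk. u i (snd Sk i))" .
  qed auto
  then have "(\<lambda>n. of_real (?s n powr (- (\<Sum>S\<in>Pow {1..m}. real ((\<alpha> - 1) ^ card S) * max 0 (q - real (card S))))) *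
      (\<Prod>k\<in>index_set m \<alpha>. 1 - of_real (?s n powr q) * Y * (\<Prod>i\<in>{1..m}. r (t n) i (k i)))) \<longlonglongrightarrow> ?l"
    unfolding prodK sumK .
  from tendsto_mult_left[OF this, of c]
  have "scaled_limit E (1 - real \<alpha>) q
      (\<Sum>S\<in>Pow {1..m}. real ((\<alpha> - 1) ^ card S) * max 0 (q - real (card S))) X Y (c * ?l)"
    unfolding scaled_limit_def Er using t by (intro exI[of _ t]) (simp only: mult.left_commute simp_thms)
  moreover have "?l = (\<Prod>S\<in>Pow {1..m}. \<Prod>k\<in>PiE S ?J. factor_limit (q - real (card S)) (Y * (\<Prod>i\<in>S. u i (k i))))"
    by (subst prod.Sigma) (auto simp: finPiE split_def)
  also have "\<dots> = factor_limit q Y * (\<Prod>S\<in>Pow {1..m} - {{}}. \<Prod>k\<in>PiE S ?J. factor_limit (q - real (card S)) (Y * (\<Prod>i\<in>S. u i (k i))))"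
    by (subst prod.remove[of _ "{}"]) auto
  also have "(\<Prod>S\<in>Pow {1..m} - {{}}. \<Prod>k\<in>PiE S ?J. factor_limit (q - real (card S)) (Y * (\<Prod>i\<in>S. u i (k i)))) =
      (\<Prod>S\<in>Pow {1..m} - {{}}. factor_limit (q - real (card S))
       (Y ^ (\<alpha> - 1) * (\<Prod>i\<in>S. - ((- 1) ^ \<alpha> * (lam i * X)))) ^ ((\<alpha> - 1) ^ (card S - 1)))"
  proof (intro prod.cong refl prod_PiE_factor_limit)
    fix S assume S: "S \<in> Pow {1..m} - {{}}"
    then show "finite S" "S \<noteq> {}" using finite_subset by auto
    fix i assume "i \<in> S"
    then have i: "i \<in> {1..m}" using S by auto
    show "finite (?J i) \<and> card (?J i) = \<alpha> - 1" using cardJ[OF i] by simp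
    show "(\<Prod>j\<in>?J i. w - u i j) = w ^ (\<alpha> - 1) - - ((- 1) ^ \<alpha> * (lam i * X))" for w
      by (rule u[OF i])
  qed (use \<alpha> in simp)
  finally show ?thesis by simp
qed

text \<open>A dichotomy on the weight. If no factor has \<theta> = 0, the limit has no zero with X,
  Y \<noteq> 0. Otherwise all factors with \<theta> = 0 have the same exponent vector, orthogonal to
  (p, q), and the other factors contribute monomials. The two alternatives may overlap.\<close>

lemma scaled_limit_exists:
  assumes "p = real \<alpha> \<or> p = 1 - real \<alpha> \<or> p = 0 \<and> q \<noteq> 0"
  shows "\<exists>N L. (\<forall>X Y. X \<noteq> 0 \<longrightarrow> Y \<noteq> 0 \<longrightarrow> scaled_limit E p q N X Y (L X Y)) \<and>
    ((\<forall>X Y. X \<noteq> 0 \<longrightarrow> Y \<noteq> 0 \<longrightarrow> L X Y \<noteq> 0) \<or>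
     (\<exists>g h. (g, h) \<noteq> (0, 0) \<and> p * real g + q * real h = 0 \<and>
        binomial_product (unit_monomials m lam) g h L))"
  using assms
proof (elim disjE)
  let ?U = "unit_monomials m lam"
  have lamU: "\<And>i. i \<in> {1..m} \<Longrightarrow> lam i \<in> ?U" by (rule lam_in_unit_monomials)
  have cU: "c \<in> ?U" using c by (rule sign_in_unit_monomials)
  have sgn: "(- 1) ^ \<alpha> \<in> ?U" by (intro unit_monomials_power sign_in_unit_monomials) simp
  assume p: "p = real \<alpha>"
  let ?N = "\<Sum>k\<in>index_set m \<alpha>. max 0 (q + real m)"
  let ?L = "\<lambda>X Y. c * factor_limit (q + real m) (Y ^ \<alpha> * (\<Prod>i\<in>{1..m}. (- 1) ^ \<alpha> * (lam i * X))) ^ (\<alpha> ^ (m - 1))"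
  show ?thesis
  proof (intro exI[of _ ?N] exI[of _ ?L] conjI allI impI)
    show "scaled_limit E p q ?N X Y (?L X Y)" if "X \<noteq> 0" "Y \<noteq> 0" for X Y
      unfolding p using that by (rule scaled_limit_at_infinity)
    show "(\<forall>X Y. X \<noteq> 0 \<longrightarrow> Y \<noteq> 0 \<longrightarrow> ?L X Y \<noteq> 0) \<or>
     (\<exists>g h. (g, h) \<noteq> (0, 0) \<and> p * real g + q * real h = 0 \<and> binomial_product ?U g h ?L)"
    proof (cases "q + real m = 0")
      case False
      then have "\<forall>X Y. X \<noteq> 0 \<longrightarrow> Y \<noteq> 0 \<longrightarrow> ?L X Y \<noteq> 0"
        using c lam by (auto simp: factor_limit_def)
      then show ?thesis by blast
    next
      case True
      let ?B = "\<Prod>i\<in>{1..m}. (- 1) ^ \<alpha> * lam i"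
      have B: "?B \<in> ?U" by (intro unit_monomials_prod unit_monomials_mult sgn lamU)
      have "binomial_product ?U m \<alpha> (\<lambda>X Y. 1 - ?B * (X ^ m * Y ^ \<alpha>))"
        by (rule binomial_product_one_minus[OF sign_in_unit_monomials B]) simp
      then have "binomial_product ?U m \<alpha> (\<lambda>X Y. (c * X ^ 0 * Y ^ 0) * (1 - ?B * (X ^ m * Y ^ \<alpha>)) ^ (\<alpha> ^ (m - 1)))"
        by (intro binomial_product_mult binomial_product_power binomial_product_monomial cU)
      also have "(\<lambda>X Y. (c * X ^ 0 * Y ^ 0) * (1 - ?B * (X ^ m * Y ^ \<alpha>)) ^ (\<alpha> ^ (m - 1))) = ?L"
      proof (intro ext)
        fix X Y
        have "(\<Prod>i\<in>{1..m}. (- 1) ^ \<alpha> * (lam i * X)) = ?B * X ^ m"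
          by (simp add: prod.distrib)
        then show "(c * X ^ 0 * Y ^ 0) * (1 - ?B * (X ^ m * Y ^ \<alpha>)) ^ (\<alpha> ^ (m - 1)) = ?L X Y"
          using True by (simp add: factor_limit_def mult_ac)
      qed
      finally have "binomial_product ?U m \<alpha> ?L" .
      moreover have "p * real m + q * real \<alpha> = (q + real m) * real \<alpha>"
        unfolding p by (simp add: algebra_simps)
      then have "p * real m + q * real \<alpha> = 0" using True by simp
      ultimately show ?thesis using \<alpha> by (intro disjI2 exI[of _ m] exI[of _ \<alpha>]) auto
    qed
  qed
next
  let ?U = "unit_monomials m lam"
  have lamU: "\<And>i. i \<in> {1..m} \<Longrightarrow> lam i \<in> ?U" by (rule lam_in_unit_monomials)
  have cU: "c \<in> ?U" using c by (rule sign_in_unit_monomials)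
  have sgn: "(- 1) ^ \<alpha> \<in> ?U" by (intro unit_monomials_power sign_in_unit_monomials) simp
  assume p: "p = 1 - real \<alpha>"
  let ?N = "\<Sum>S\<in>Pow {1..m}. real ((\<alpha> - 1) ^ card S) * max 0 (q - real (card S))"
  let ?F = "\<lambda>S X Y. factor_limit (q - real (card S)) (Y ^ (\<alpha> - 1) * (\<Prod>i\<in>S. - ((- 1) ^ \<alpha> * (lam i * X))))"
  let ?L = "\<lambda>X Y. c * (factor_limit q Y * (\<Prod>S\<in>Pow {1..m} - {{}}. ?F S X Y ^ ((\<alpha> - 1) ^ (card S - 1))))"
  show ?thesis
  proof (intro exI[of _ ?N] exI[of _ ?L] conjI allI impI)
    show "scaled_limit E p q ?N X Y (?L X Y)" if "X \<noteq> 0" "Y \<noteq> 0" for X Y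
      unfolding p using that by (rule scaled_limit_at_zero)
    show "(\<forall>X Y. X \<noteq> 0 \<longrightarrow> Y \<noteq> 0 \<longrightarrow> ?L X Y \<noteq> 0) \<or>
     (\<exists>g h. (g, h) \<noteq> (0, 0) \<and> p * real g + q * real h = 0 \<and> binomial_product ?U g h ?L)"
    proof (cases "\<exists>K :: nat. q = real K")
      case False
      then have "q \<noteq> real n" for n by blast
      then have nz: "factor_limit (q - real n) z \<noteq> 0" if "z \<noteq> 0" for z n
        using that by (simp add: factor_limit_def)
      have "?L X Y \<noteq> 0" if XY: "X \<noteq> 0" "Y \<noteq> 0" for X Y
      proof -
        have "?F S X Y \<noteq> 0" if "S \<in> Pow {1..m} - {{}}" for S
        proof (rule nz)
          have "finite S" using that finite_subset by auto
          then show "Y ^ (\<alpha> - 1) * (\<Prod>i\<in>S. - ((- 1) ^ \<alpha> * (lam i * X))) \<noteq> 0"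
            using XY lam that by (auto simp: subset_iff)
        qed
        then have "(\<Prod>S\<in>Pow {1..m} - {{}}. ?F S X Y ^ ((\<alpha> - 1) ^ (card S - 1))) \<noteq> 0"
          by (subst prod_zero_iff) auto
        moreover have "factor_limit q Y \<noteq> 0" using nz[OF XY(2), of 0] by simp
        ultimately show ?thesis using c by auto
      qed
      then show ?thesis by blast
    next
      case True
      then obtain K :: nat where q: "q = real K" ..
      \<comment> \<open>For K > 0 the sets S of cardinality K contribute powers of 1 - \<beta> X^K
        Y^(\<alpha>-1). For K = 0 only the empty set has \<theta> = 0, and its factor is 1 -
        Y.\<close>
      define h where "h = (if K = 0 then 1 else \<alpha> - 1)"
      have F: "binomial_product ?U K h (?F S)" if S: "S \<in> Pow {1..m} - {{}}" for S
      proof -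
        let ?B = "\<Prod>i\<in>S. - ((- 1) ^ \<alpha> * lam i)"
        have B: "?B \<in> ?U" using S
          by (intro unit_monomials_prod unit_monomials_mult unit_monomials_uminus sgn lamU) auto
        have eq: "(\<Prod>i\<in>S. - ((- 1) ^ \<alpha> * (lam i * X))) = ?B * X ^ card S" for X
        proof -
          have "(\<Prod>i\<in>S. - ((- 1) ^ \<alpha> * (lam i * X))) = (\<Prod>i\<in>S. - ((- 1) ^ \<alpha> * lam i) * X)"
            by (intro prod.cong) auto
          then show ?thesis unfolding prod.distrib by simp
        qed
        have "S \<noteq> {}" "finite S" using S finite_subset by auto
        then have cS: "card S \<noteq> 0" by simp
        consider "K < card S" | "K = card S" | "K > card S" by linarith
        then show ?thesis
        proof cases
          case 1
          then have "?F S = (\<lambda>X Y. 1 * X ^ 0 * Y ^ 0)" by (simp add: q factor_limit_def)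
          then show ?thesis
            using binomial_product_monomial[OF sign_in_unit_monomials[of 1], of m lam K h 0 0] by simp
        next
          case 2
          then have "?F S = (\<lambda>X Y. 1 - ?B * (X ^ K * Y ^ h))"
            using cS unfolding eq by (simp add: q factor_limit_def h_def mult_ac)
          then show ?thesis
            using binomial_product_one_minus[OF sign_in_unit_monomials[of 1] B, of K h] by simp
        next
          case 3
          then have "?F S = (\<lambda>X Y. (- ?B) * X ^ card S * Y ^ (\<alpha> - 1))"
            unfolding eq by (simp add: q factor_limit_def mult_ac)
          then show ?thesis
            using binomial_product_monomial[OF unit_monomials_uminus[OF B], of K h "card S" "\<alpha> - 1"] by simp
        qed
      qed
      have F0: "binomial_product ?U K h (\<lambda>X Y. factor_limit q Y)"
      proof (cases "K = 0")
        case True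
        then have "(\<lambda>X Y. factor_limit q Y) = (\<lambda>X Y. 1 - 1 * (X ^ K * Y ^ h))"
          by (simp add: q factor_limit_def h_def)
        then show ?thesis
          using binomial_product_one_minus[OF sign_in_unit_monomials[of 1] sign_in_unit_monomials[of 1], of m lam K h]
          by simp
      next
        case False
        then have "(\<lambda>X Y. factor_limit q Y) = (\<lambda>X Y. (- 1) * X ^ 0 * Y ^ 1)"
          by (simp add: q factor_limit_def)
        then show ?thesis
          using binomial_product_monomial[OF sign_in_unit_monomials[of "-1"], of m lam K h 0 1] by simp
      qed
      have "binomial_product ?U K h (\<lambda>X Y. (c * X ^ 0 * Y ^ 0) * (factor_limit q Y *
          (\<Prod>S\<in>Pow {1..m} - {{}}. ?F S X Y ^ ((\<alpha> - 1) ^ (card S - 1)))))"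
        by (intro binomial_product_mult binomial_product_prod binomial_product_power
            binomial_product_monomial cU F F0)
      then have "binomial_product ?U K h ?L" by simp
      moreover have "p * real K + q * real h = 0"
        unfolding p q h_def using \<alpha> by (simp add: of_nat_diff algebra_simps)
      moreover have "(K, h) \<noteq> (0, 0)" by (simp add: h_def)
      ultimately show ?thesis by blast
    qed
  qed
next
  assume p: "p = 0 \<and> q \<noteq> 0"
  let ?N = "\<Sum>k\<in>index_set m \<alpha>. max 0 q"
  \<comment> \<open>The limit depends on the labelling of the roots through the subsequence; only a
    nonzero value is needed, so one is picked for each (X, Y).\<close>
  define L where "L X Y = (SOME l. l \<noteq> 0 \<and> scaled_limit E 0 q ?N X Y l)" for X Y
  have "L X Y \<noteq> 0 \<and> scaled_limit E 0 q ?N X Y (L X Y)" if "X \<noteq> 0" "Y \<noteq> 0" for X Y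
    unfolding L_def using that p by (intro someI_ex[OF scaled_limit_horizontal_nonzero]) auto
  then show ?thesis using p by (intro exI[of _ ?N] exI[of _ L]) auto
qed

end

section \<open>Newton polygon and initial forms\<close>

definition eval2 :: "complex poly poly \<Rightarrow> complex \<Rightarrow> complex \<Rightarrow> complex" where
  "eval2 P x y = poly (poly P [:y:]) x"

definition support2 :: "complex poly poly \<Rightarrow> (nat \<times> nat) set" where
  "support2 P = {(i, j). coeff2 P i j \<noteq> 0}"

text \<open>M need not be attained on the support; if it is not, the form is 0.\<close>

definition initial_form :: "complex poly poly \<Rightarrow> real \<Rightarrow> real \<Rightarrow> real \<Rightarrow> complex \<Rightarrow> complex \<Rightarrow> complex" where
  "initial_form P p q M X Y =
     (\<Sum>(i, j)\<in>{(i, j)\<in>support2 P. p * real i + q * real j = M}. coeff2 P i j * X ^ i * Y ^ j)"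

lemma finite_support2: "finite (support2 P)"
proof -
  have "support2 P \<subseteq> (\<Union>j\<le>degree P. (\<lambda>i. (i, j)) ` {..degree (coeff P j)})"
  proof
    fix z assume "z \<in> support2 P"
    then obtain i j where z: "z = (i, j)" "coeff (coeff P j) i \<noteq> 0"
      by (auto simp: support2_def coeff2_def)
    then have "i \<le> degree (coeff P j)" "j \<le> degree P"
      using le_degree by (blast, metis coeff_0 le_degree)
    then show "z \<in> (\<Union>j\<le>degree P. (\<lambda>i. (i, j)) ` {..degree (coeff P j)})" using z by auto
  qed
  then show ?thesis by (rule finite_subset) auto
qed

lemma eval2_altdef: "eval2 P x y = (\<Sum>(i, j)\<in>support2 P. coeff2 P i j * x ^ i * y ^ j)"
proof -
  have "eval2 P x y = (\<Sum>j\<le>degree P. \<Sum>i\<le>degree (coeff P j). coeff2 P i j * x ^ i * y ^ j)"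
    unfolding eval2_def poly_altdef[of P] poly_sum
  proof (rule sum.cong[OF refl])
    fix j
    have "poly (coeff P j * [:y:] ^ j) x = poly (coeff P j) x * y ^ j" by (simp add: poly_power)
    also have "\<dots> = (\<Sum>i\<le>degree (coeff P j). coeff2 P i j * x ^ i * y ^ j)"
      by (simp add: poly_altdef sum_distrib_right coeff2_def)
    finally show "poly (coeff P j * [:y:] ^ j) x = (\<Sum>i\<le>degree (coeff P j). coeff2 P i j * x ^ i * y ^ j)" .
  qed
  also have "\<dots> = (\<Sum>(j, i)\<in>(SIGMA j:{..degree P}. {..degree (coeff P j)}). coeff2 P i j * x ^ i * y ^ j)"
    by (rule sum.Sigma) auto
  also have "\<dots> = (\<Sum>(j, i)\<in>prod.swap ` support2 P. coeff2 P i j * x ^ i * y ^ j)"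
  proof (rule sum.mono_neutral_right)
    show "prod.swap ` support2 P \<subseteq> (SIGMA j:{..degree P}. {..degree (coeff P j)})"
      by (auto simp: support2_def coeff2_def intro: le_degree)
    show "\<forall>z\<in>(SIGMA j:{..degree P}. {..degree (coeff P j)}) - prod.swap ` support2 P.
        (case z of (j, i) \<Rightarrow> coeff2 P i j * x ^ i * y ^ j) = 0"
      by (force simp: support2_def)
  qed auto
  also have "\<dots> = (\<Sum>(i, j)\<in>support2 P. coeff2 P i j * x ^ i * y ^ j)"
    by (subst sum.reindex) (auto intro!: sum.cong)
  finally show ?thesis .
qed

lemma tendsto_initial_form:
  assumes "\<And>i j. (i, j) \<in> support2 P \<Longrightarrow> p * real i + q * real j \<le> M" "strict_mono (t :: nat \<Rightarrow> nat)"
  shows "(\<lambda>n. of_real (real (Suc (t n)) powr (- M)) *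
      eval2 P (of_real (real (Suc (t n)) powr p) * X) (of_real (real (Suc (t n)) powr q) * Y))
    \<longlonglongrightarrow> initial_form P p q M X Y"
proof -
  let ?s = "\<lambda>n. real (Suc (t n))"
  have powr_nat: "(s powr a) ^ i = s powr (a * real i)" if "s > 0" for s a :: real and i
    using that by (simp add: powr_powr flip: powr_realpow)
  have scale: "of_real (?s n powr (- M)) * (coeff2 P i j * (of_real (?s n powr p) * X) ^ i * (of_real (?s n powr q) * Y) ^ j) =
      of_real (?s n powr (p * real i + q * real j - M)) * (coeff2 P i j * X ^ i * Y ^ j)" for n i j
  proof -
    have "complex_of_real (?s n powr (p * real i + q * real j - M)) =
        of_real (?s n powr (- M)) * of_real (?s n powr p) ^ i * of_real (?s n powr q) ^ j"
    proof -
      have "?s n powr (p * real i + q * real j - M) = ?s n powr (- M) * (?s n powr p) ^ i * (?s n powr q) ^ j"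
      proof -
        have "p * real i + q * real j - M = - M + p * real i + q * real j" by simp
        moreover have "?s n > 0" by simp
        ultimately show ?thesis by (simp only: powr_nat powr_add)
      qed
      then show ?thesis by (simp only: of_real_mult of_real_power)
    qed
    then show ?thesis by (simp only: power_mult_distrib mult_ac)
  qed
  have lim: "(\<lambda>n. complex_of_real (?s n powr (p * real i + q * real j - M))) \<longlonglongrightarrow>
      (if p * real i + q * real j = M then 1 else 0)" if "(i, j) \<in> support2 P" for i j
  proof (cases "p * real i + q * real j = M")
    case False
    then have "p * real i + q * real j - M < 0" using assms(1)[OF that] by simp
    from tendsto_of_real[OF tendsto_neg_powr[OF this filterlim_Suc_strict_mono[OF assms(2)]]]
    show ?thesis using False by simp
  qed simp
  have "(\<lambda>n. \<Sum>(i, j)\<in>support2 P. of_real (?s n powr (p * real i + q * real j - M)) * (coeff2 P i j * X ^ i * Y ^ j))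
    \<longlonglongrightarrow> (\<Sum>(i, j)\<in>support2 P. (if p * real i + q * real j = M then 1 else 0) * (coeff2 P i j * X ^ i * Y ^ j))"
    unfolding split_def by (intro tendsto_intros lim) simp
  also have "(\<Sum>(i, j)\<in>support2 P. (if p * real i + q * real j = M then 1 else 0) * (coeff2 P i j * X ^ i * Y ^ j)) =
      initial_form P p q M X Y"
    unfolding initial_form_def
    by (rule sum.mono_neutral_cong_right[OF finite_support2]) (auto split: if_splits)
  finally show ?thesis
    unfolding eval2_altdef sum_distrib_left split_def
    using scale by (simp only: split_def)
qed

text \<open>A limit for the smaller of two normalising exponents forces the limit for the larger one
  to be 0. One nonzero value on each side therefore gives M = N. Since the initial form is a limit
  along every subsequence, it then agrees with L.\<close>

lemma initial_form_eq_scaled_limit: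
  assumes M: "\<And>i j. (i, j) \<in> support2 P \<Longrightarrow> p * real i + q * real j \<le> M"
    and L: "\<And>X Y. X \<noteq> 0 \<Longrightarrow> Y \<noteq> 0 \<Longrightarrow> scaled_limit (eval2 P) p q N X Y (L X Y)"
    and nz1: "X1 \<noteq> 0" "Y1 \<noteq> 0" "initial_form P p q M X1 Y1 \<noteq> 0"
    and nz2: "X2 \<noteq> 0" "Y2 \<noteq> 0" "L X2 Y2 \<noteq> 0"
    and "X \<noteq> 0" "Y \<noteq> 0"
  shows "initial_form P p q M X Y = L X Y"
proof -
  define v where "v K t X Y n = of_real (real (Suc (t n)) powr (- K)) *
      eval2 P (of_real (real (Suc (t n)) powr p) * X) (of_real (real (Suc (t n)) powr q) * Y)"
    for K and t :: "nat \<Rightarrow> nat" and X Y n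
  have lim_in: "v M t X Y \<longlonglongrightarrow> initial_form P p q M X Y" if "strict_mono t" for t X Y
    unfolding v_def by (rule tendsto_initial_form[OF M that])
  have lim_L: "\<exists>t. strict_mono t \<and> v N t X Y \<longlonglongrightarrow> L X Y" if "X \<noteq> 0" "Y \<noteq> 0" for X Y
    using L[OF that] unfolding scaled_limit_def v_def .
  have shift: "v K t X Y n = of_real (real (Suc (t n)) powr (K' - K)) * v K' t X Y n" for K t X Y n K'
  proof -
    have "real (Suc (t n)) powr (- K) = real (Suc (t n)) powr (K' - K) * real (Suc (t n)) powr (- K')"
      by (simp flip: powr_add)
    then show ?thesis unfolding v_def by (simp only: of_real_mult mult.assoc)
  qed
  have zero: "l = 0" if "K' < K" "strict_mono t" "v K' t X Y \<longlonglongrightarrow> l'" "v K t X Y \<longlonglongrightarrow> l"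
    for K K' t X Y l l'
  proof -
    have "K' - K < 0" using that(1) by simp
    from tendsto_mult[OF tendsto_of_real[OF tendsto_neg_powr[OF this filterlim_Suc_strict_mono[OF that(2)]]] that(3)]
    have "(\<lambda>n. of_real (real (Suc (t n)) powr (K' - K)) * v K' t X Y n) \<longlonglongrightarrow> 0"
      by (simp only: of_real_0 mult_zero_left)
    then have "v K t X Y \<longlonglongrightarrow> 0" unfolding shift[of K t X Y _ K', symmetric] .
    then show ?thesis using that(4) LIMSEQ_unique by blast
  qed
  have "\<not> N < M"
  proof
    assume "N < M"
    obtain t where t: "strict_mono t" "v N t X1 Y1 \<longlonglongrightarrow> L X1 Y1" using lim_L[OF nz1(1,2)] by blast
    from zero[OF \<open>N < M\<close> t lim_in[OF t(1)]] show False using nz1(3) by blast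
  qed
  moreover have "\<not> M < N"
  proof
    assume "M < N"
    obtain t where t: "strict_mono t" "v N t X2 Y2 \<longlonglongrightarrow> L X2 Y2" using lim_L[OF nz2(1,2)] by blast
    from zero[OF \<open>M < N\<close> t(1) lim_in[OF t(1)] t(2)] show False using nz2(3) by blast
  qed
  ultimately have "N = M" by simp
  obtain t where t: "strict_mono t" "v N t X Y \<longlonglongrightarrow> L X Y" using lim_L[OF assms(9,10)] by blast
  show ?thesis
    using LIMSEQ_unique[OF lim_in[OF t(1)]] t(2) unfolding \<open>N = M\<close> by blast
qed

text \<open>Faces of a polytope are exposed, which supplies the functional unless the edge is the
  whole polygon. The endpoints are extreme points of the hull and hence belong to S.\<close>

lemma edge_supporting_functional:
  fixes S :: "(real \<times> real) set"
  assumes "finite S" "e edge_of (convex hull S)" "e = closed_segment A B"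
  shows "\<exists>p q M. (p, q) \<noteq> (0, 0) \<and> (\<forall>z\<in>S. p * fst z + q * snd z \<le> M) \<and>
    (\<forall>z\<in>S. p * fst z + q * snd z = M \<longrightarrow> z \<in> e) \<and> (\<forall>z\<in>e. p * fst z + q * snd z = M) \<and> A \<noteq> B \<and> A \<in> S \<and> B \<in> S"
proof -
  let ?H = "convex hull S"
  have face: "e face_of ?H" and dim: "aff_dim e = 1" using assms(2) by (auto simp: edge_of_def)
  have AB: "A \<noteq> B" using dim assms(3) by auto
  have "A extreme_point_of e" "B extreme_point_of e" using assms(3) by (auto simp: extreme_point_of_segment)
  then have "A extreme_point_of ?H" "B extreme_point_of ?H"
    using extreme_point_of_face[OF face] by auto
  then have ends: "A \<in> S" "B \<in> S" by (auto dest: extreme_point_of_convex_hull)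
  have "polytope ?H" using assms(1) unfolding polytope_def by blast
  then have "polyhedron ?H" by (rule polytope_imp_polyhedron)
  then have "e exposed_face_of ?H" using face exposed_face_of_polyhedron by blast
  then consider "e = {}" | "e = ?H"
    | a b where "a \<noteq> 0" "?H \<subseteq> {x. a \<bullet> x \<le> b}" "e = ?H \<inter> {x. a \<bullet> x = b}"
    unfolding exposed_face_of by blast
  then show ?thesis
  proof cases
    case 1
    then show ?thesis using dim by simp
  next
    case 2
    \<comment> \<open>The polygon is a segment here; the normal of its line is constant on
      it.\<close>
    let ?p = "snd B - snd A" and ?q = "fst A - fst B"
    have line: "?p * fst z + ?q * snd z = ?p * fst A + ?q * snd A" if "z \<in> e" for z
    proof -
      obtain u where z: "z = (1 - u) *\<^sub>R A + u *\<^sub>R B" using \<open>z \<in> e\<close> assms(3) by (auto simp: in_segment)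
      show ?thesis unfolding z by (simp add: algebra_simps)
    qed
    have Se: "S \<subseteq> e" using 2 hull_subset[of S convex] by simp
    have "(?p, ?q) \<noteq> (0, 0)" using AB by (auto simp: prod_eq_iff)
    moreover have "\<forall>z\<in>S. ?p * fst z + ?q * snd z \<le> ?p * fst A + ?q * snd A"
      using Se line by (metis order_refl subsetD)
    moreover have "\<forall>z\<in>S. ?p * fst z + ?q * snd z = ?p * fst A + ?q * snd A \<longrightarrow> z \<in> e"
      using Se by blast
    moreover have "\<forall>z\<in>e. ?p * fst z + ?q * snd z = ?p * fst A + ?q * snd A"
      using line by blast
    ultimately show ?thesis using AB ends by blast
  next
    case 3
    have inner: "a \<bullet> z = fst a * fst z + snd a * snd z" for z by (simp add: inner_prod_def)
    have SH: "S \<subseteq> ?H" by (rule hull_subset)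
    have "(fst a, snd a) \<noteq> (0, 0)" using 3(1) by (auto simp: prod_eq_iff)
    moreover have "\<forall>z\<in>S. fst a * fst z + snd a * snd z \<le> b"
      using SH 3(2) unfolding inner by blast
    moreover have "\<forall>z\<in>S. fst a * fst z + snd a * snd z = b \<longrightarrow> z \<in> e"
      using SH unfolding 3(3) inner by blast
    moreover have "\<forall>z\<in>e. fst a * fst z + snd a * snd z = b"
      unfolding 3(3) inner by blast
    ultimately show ?thesis using AB ends by blast
  qed
qed

text \<open>The k-th monomial on the edge is X^a Y^b times the k-th power of X^u Y^v. Both endpoints
  are in the support, so the first and the last coefficient of f are nonzero; hence f has degree at
  least 1 and 0 is not a root.\<close>

lemma face_poly_initial_form:
  assumes "is_face_poly P e f"
  shows "\<exists>p q M u v a b. (p, q) \<noteq> (0, 0) \<and> coprime u v \<and> p * real_of_int u + q * real_of_int v = 0 \<and>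
    (\<forall>(i, j)\<in>support2 P. p * real i + q * real j \<le> M) \<and>
    (\<forall>X Y. X \<noteq> 0 \<longrightarrow> Y \<noteq> 0 \<longrightarrow> initial_form P p q M X Y = X ^ a * Y ^ b * poly f (X powi u * Y powi v)) \<and>
    poly f 0 \<noteq> 0 \<and> degree f \<noteq> 0"
proof -
  let ?S = "{(real i, real j) |i j. coeff2 P i j \<noteq> 0}"
  obtain a b n :: nat and u v :: int where edge: "e edge_of newton_polygon P" and uv: "coprime u v"
    and e: "e = closed_segment (real a, real b) (real a + real n * of_int u, real b + real n * of_int v)"
    and f: "f = (\<Sum>k\<le>n. monom (coeff2 P (nat (int a + int k * u)) (nat (int b + int k * v))) k)"
    using assms unfolding is_face_poly_def by blast
  have S: "?S = (\<lambda>(i, j). (real i, real j)) ` support2 P" by (auto simp: support2_def)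
  have "finite ?S" unfolding S by (intro finite_imageI finite_support2)
  from edge_supporting_functional[OF this edge[unfolded newton_polygon_def] e]
  obtain p q M where pq: "(p, q) \<noteq> (0, 0)"
    and le: "\<And>z. z \<in> ?S \<Longrightarrow> p * fst z + q * snd z \<le> M"
    and inS: "\<And>z. z \<in> ?S \<Longrightarrow> p * fst z + q * snd z = M \<Longrightarrow> z \<in> e"
    and one: "\<And>z. z \<in> e \<Longrightarrow> p * fst z + q * snd z = M"
    and AB: "(real a, real b) \<noteq> (real a + real n * of_int u, real b + real n * of_int v)"
    and A: "(real a, real b) \<in> ?S"
    and B: "(real a + real n * of_int u, real b + real n * of_int v) \<in> ?S" by blast
  have n: "n \<noteq> 0" using AB by auto
  have Aw: "p * real a + q * real b = M" using one[of "(real a, real b)"] e by simp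
  have "p * (real a + real n * of_int u) + q * (real b + real n * of_int v) = M"
    using one[of "(real a + real n * of_int u, real b + real n * of_int v)"] e by simp
  then have "real n * (p * of_int u + q * of_int v) = 0" using Aw by (simp add: algebra_simps)
  then have perp: "p * of_int u + q * of_int v = 0" using n by simp
  obtain i1 j1 where B1: "real a + real n * of_int u = real i1" "real b + real n * of_int v = real j1"
    "coeff2 P i1 j1 \<noteq> 0" using B by auto
  have "real_of_int (int a + int n * u) = real_of_int (int i1)" "real_of_int (int b + int n * v) = real_of_int (int j1)"
    using B1 by simp_all
  then have B2: "int a + int n * u = int i1" "int b + int n * v = int j1" by linarith+
  \<comment> \<open>Points between two points of the quadrant stay in it, so \<open>nat\<close>
    truncates nothing along the edge.\<close>
  have nonneg: "0 \<le> int c + int k * w" if "k \<le> n" "0 \<le> int c + int n * w" for c k w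
  proof (cases "w \<ge> 0")
    case False
    then have "int n * w \<le> int k * w" using that(1) by (intro mult_right_mono_neg) auto
    then show ?thesis using that(2) by linarith
  qed simp
  have kx: "0 \<le> int a + int k * u" and ky: "0 \<le> int b + int k * v" if "k \<le> n" for k
    using nonneg[OF that] B2 by simp_all
  let ?\<phi> = "\<lambda>k. (nat (int a + int k * u), nat (int b + int k * v))"
  obtain a' b' where bez: "a' * u + b' * v = 1"
    using uv bezout_int[of u v] by auto
  have inj: "inj_on ?\<phi> {..n}"
  proof (rule inj_onI)
    fix k k' assume k: "k \<in> {..n}" "k' \<in> {..n}" "?\<phi> k = ?\<phi> k'"
    then have "int a + int k * u = int a + int k' * u" "int b + int k * v = int b + int k' * v"
      using eq_nat_nat_iff[OF kx[of k] kx[of k']] eq_nat_nat_iff[OF ky[of k] ky[of k']] by simp_all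
    then have "int k * u = int k' * u" "int k * v = int k' * v" by linarith+
    then have "int k * (a' * u + b' * v) = int k' * (a' * u + b' * v)"
      by (metis distrib_left mult.left_commute)
    then show "k = k'" using bez by simp
  qed
  have on_edge: "z \<in> ?\<phi> ` {..n}" if z: "z \<in> support2 P" "p * real (fst z) + q * real (snd z) = M" for z
  proof -
    obtain i j where ij: "z = (i, j)" by force
    then have "(real i, real j) \<in> e" using inS[of "(real i, real j)"] z by (auto simp: support2_def)
    then obtain t where t: "0 \<le> t" "t \<le> 1" "real i = real a + t * real n * of_int u" "real j = real b + t * real n * of_int v"
      unfolding e in_segment by (auto simp: algebra_simps)
    \<comment> \<open>The Bezout coefficients read off the position of a lattice point on the edge
      as an integer, although a priori only the real multiple t n is available.\<close>
    define \<kappa> where "\<kappa> = a' * (int i - int a) + b' * (int j - int b)"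
    have "real_of_int \<kappa> = t * real n * real_of_int (a' * u + b' * v)"
      using t(3,4) by (simp add: \<kappa>_def algebra_simps)
    then have \<kappa>: "real_of_int \<kappa> = t * real n" using bez by simp
    then have "0 \<le> real_of_int \<kappa>" "real_of_int \<kappa> \<le> real n" using t(1,2) n by (auto simp: mult_le_cancel_right1)
    then have "0 \<le> \<kappa>" "\<kappa> \<le> int n" by linarith+
    moreover have "real_of_int (int i) = real_of_int (int a + \<kappa> * u)" "real_of_int (int j) = real_of_int (int b + \<kappa> * v)"
      using t(3,4) \<kappa> by simp_all
    then have "int i = int a + \<kappa> * u" "int j = int b + \<kappa> * v" by linarith+
    ultimately show ?thesis
      unfolding ij by (intro image_eqI[of _ _ "nat \<kappa>"]) (auto simp flip: \<open>int i = _\<close> \<open>int j = _\<close>)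
  qed
  have "initial_form P p q M X Y = X ^ a * Y ^ b * poly f (X powi u * Y powi v)"
    if XY: "X \<noteq> 0" "Y \<noteq> 0" for X Y
  proof -
    let ?c = "\<lambda>(i, j). coeff2 P i j * X ^ i * Y ^ j"
    have "initial_form P p q M X Y = sum ?c (?\<phi> ` {..n})"
      unfolding initial_form_def
    proof (rule sum.mono_neutral_left)
      show "{(i, j). (i, j) \<in> support2 P \<and> p * real i + q * real j = M} \<subseteq> ?\<phi> ` {..n}"
        using on_edge by fastforce
      show "\<forall>z\<in>?\<phi> ` {..n} - {(i, j). (i, j) \<in> support2 P \<and> p * real i + q * real j = M}. ?c z = 0"
      proof
        fix z assume "z \<in> ?\<phi> ` {..n} - {(i, j). (i, j) \<in> support2 P \<and> p * real i + q * real j = M}"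
        then obtain k where k: "k \<le> n" and z: "z = ?\<phi> k"
          and nin: "?\<phi> k \<notin> {(i, j). (i, j) \<in> support2 P \<and> p * real i + q * real j = M}" by auto
        have "p * real (nat (int a + int k * u)) + q * real (nat (int b + int k * v)) =
            p * of_int (int a + int k * u) + q * of_int (int b + int k * v)"
          using kx[OF k] ky[OF k] by simp
        also have "\<dots> = (p * real a + q * real b) + real k * (p * of_int u + q * of_int v)"
          by (simp add: algebra_simps)
        also have "\<dots> = M" using Aw perp by simp
        finally have "coeff2 P (nat (int a + int k * u)) (nat (int b + int k * v)) = 0"
          using nin by (simp add: support2_def)
        then show "?c z = 0" by (simp add: z)
      qed
    qed simp
    also have "\<dots> = (\<Sum>k\<le>n. ?c (?\<phi> k))" using sum.reindex[OF inj, of ?c] by (simp add: o_def)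
    also have "\<dots> = (\<Sum>k\<le>n. X ^ a * Y ^ b * (coeff2 P (nat (int a + int k * u)) (nat (int b + int k * v)) *
        (X powi u * Y powi v) ^ k))"
    proof (rule sum.cong[OF refl])
      fix k assume k: "k \<in> {..n}"
      have pw: "Z ^ nat (int c + int k * w) = Z ^ c * (Z powi w) ^ k"
        if "Z \<noteq> 0" "0 \<le> int c + int k * w" for Z :: complex and c w
      proof -
        have "Z ^ nat (int c + int k * w) = Z powi (int c + w * int k)"
          using that(2) by (simp add: power_int_def mult.commute)
        also have "\<dots> = Z powi int c * (Z powi w) powi int k"
          using that(1) by (simp add: power_int_add power_int_mult)
        finally show ?thesis by simp
      qed
      show "?c (?\<phi> k) = X ^ a * Y ^ b * (coeff2 P (nat (int a + int k * u)) (nat (int b + int k * v)) *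
        (X powi u * Y powi v) ^ k)"
        using pw[OF XY(1) kx] pw[OF XY(2) ky] k by (simp add: power_mult_distrib)
    qed
    also have "\<dots> = X ^ a * Y ^ b * poly f (X powi u * Y powi v)"
      unfolding f poly_sum poly_monom sum_distrib_left ..
    finally show ?thesis .
  qed
  moreover have "coeff f k = coeff2 P (nat (int a + int k * u)) (nat (int b + int k * v))" if "k \<le> n" for k
    using that by (simp add: f coeff_sum)
  then have "coeff f 0 \<noteq> 0" "coeff f n \<noteq> 0" using A B1(3) B2 by auto
  then have "poly f 0 \<noteq> 0" "degree f \<noteq> 0" using n le_degree[of f n] by (auto simp: poly_0_coeff_0)
  moreover have "\<forall>(i, j)\<in>support2 P. p * real i + q * real j \<le> M"
    using le by (force simp: support2_def)
  ultimately show ?thesis using pq uv perp by blast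
qed

section \<open>Face polynomials\<close>

text \<open>The factor \<open>1 - \<beta> \<tau>\<^sup>\<kappa>\<close>, multiplied by \<open>\<tau>\<^sup>-\<^sup>\<kappa>\<close> if \<open>\<kappa>\<close> is negative.\<close>

definition binomial_factor :: "int \<Rightarrow> complex \<Rightarrow> complex poly" where
  "binomial_factor \<kappa> \<beta> = (if \<kappa> > 0 then 1 - monom \<beta> (nat \<kappa>) else monom 1 (nat (- \<kappa>)) - [:\<beta>:])"

lemma poly_binomial_factor:
  assumes "\<tau> \<noteq> 0"
  shows "1 - \<beta> * \<tau> powi \<kappa> = \<tau> powi (min 0 \<kappa>) * poly (binomial_factor \<kappa> \<beta>) \<tau>"
  using assms
  by (auto simp: binomial_factor_def poly_monom power_int_def min_def field_simps)

lemma poly_binomial_factor_0: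
  "\<kappa> \<noteq> 0 \<Longrightarrow> \<beta> \<noteq> 0 \<Longrightarrow> poly (binomial_factor \<kappa> \<beta>) 0 \<noteq> 0"
  by (auto simp: binomial_factor_def poly_monom power_0_left)

lemma coeff_binomial_factor_nonzero:
  assumes "\<kappa> \<noteq> 0" "\<beta> \<noteq> 0"
  shows "{k. coeff (binomial_factor \<kappa> \<beta>) k \<noteq> 0} = {0, nat \<bar>\<kappa>\<bar>}"
  unfolding set_eq_iff
proof (rule allI)
  fix k
  show "k \<in> {k. coeff (binomial_factor \<kappa> \<beta>) k \<noteq> 0} \<longleftrightarrow> k \<in> {0, nat \<bar>\<kappa>\<bar>}"
    using assms by (cases k) (auto simp: binomial_factor_def)
qed

lemma root_binomial_factor:
  assumes "poly (binomial_factor \<kappa> \<beta>) \<tau> = 0" "cmod \<beta> = 1" "\<kappa> \<noteq> 0"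
  shows "cmod \<tau> = 1"
proof -
  have "cmod \<tau> ^ nat \<bar>\<kappa>\<bar> = 1"
  proof (cases "\<kappa> > 0")
    case True
    then have "\<beta> * \<tau> ^ nat \<kappa> = 1" using assms(1) by (simp add: binomial_factor_def poly_monom)
    then have "cmod (\<beta> * \<tau> ^ nat \<kappa>) = 1" by simp
    then show ?thesis using True assms(2) by (simp add: norm_mult norm_power)
  next
    case False
    then have "\<tau> ^ nat (- \<kappa>) = \<beta>" using assms(1) by (simp add: binomial_factor_def poly_monom)
    then have "cmod (\<tau> ^ nat (- \<kappa>)) = 1" using assms(2) by simp
    then show ?thesis using False by (simp add: norm_power)
  qed
  then show ?thesis using assms(3) by (intro power_eq_imp_eq_base[of _ "nat \<bar>\<kappa>\<bar>" 1]) auto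
qed

lemma poly_eq_if_eq_off_0:
  fixes p q :: "complex poly"
  assumes "\<And>\<tau>. \<tau> \<noteq> 0 \<Longrightarrow> poly p \<tau> = poly q \<tau>"
  shows "p = q"
proof (rule ccontr)
  assume "p \<noteq> q"
  then have "finite {\<tau>. poly (p - q) \<tau> = 0}" by (intro poly_roots_finite) simp
  moreover have "- {0} \<subseteq> {\<tau>. poly (p - q) \<tau> = 0}" using assms by auto
  ultimately have "finite (- {0 :: complex})" using finite_subset by blast
  then show False using infinite_UNIV_char_0[where 'a = complex] by (simp add: finite_compl)
qed

text \<open>Clearing negative powers leaves f equal to \<mu> times a power of \<tau> times a product
  of \<open>binomial_factor\<close>s. Neither f nor that product vanishes at 0, so the power is
  trivial.\<close>

lemma poly_eq_prod_binomial_factors: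
  fixes f :: "complex poly"
  assumes eq: "\<And>\<tau>. \<tau> \<noteq> 0 \<Longrightarrow> poly f \<tau> = \<mu> * \<tau> powi N * (\<Prod>\<beta>\<leftarrow>bs. 1 - \<beta> * \<tau> powi \<kappa>)"
    and "\<mu> \<noteq> 0" "\<kappa> \<noteq> 0" "0 \<notin> set bs" "poly f 0 \<noteq> 0"
  shows "f = Polynomial.smult \<mu> (\<Prod>\<beta>\<leftarrow>bs. binomial_factor \<kappa> \<beta>)"
proof -
  let ?G = "\<Prod>\<beta>\<leftarrow>bs. binomial_factor \<kappa> \<beta>"
  have prod: "(\<Prod>\<beta>\<leftarrow>bs. 1 - \<beta> * \<tau> powi \<kappa>) = \<tau> powi (int (length bs) * min 0 \<kappa>) * poly ?G \<tau>" if "\<tau> \<noteq> 0" for \<tau>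
  proof (induction bs)
    case (Cons b bs)
    have "\<tau> powi (int (length (b # bs)) * min 0 \<kappa>) = \<tau> powi (min 0 \<kappa>) * \<tau> powi (int (length bs) * min 0 \<kappa>)"
      using that by (simp add: distrib_right power_int_add)
    then show ?case
      using Cons poly_binomial_factor[OF that, of b \<kappa>] by (simp add: mult_ac)
  qed simp
  define K where "K = N + int (length bs) * min 0 \<kappa>"
  have f: "poly f \<tau> = \<mu> * \<tau> powi K * poly ?G \<tau>" if "\<tau> \<noteq> 0" for \<tau>
    using eq[OF that] prod[OF that] that by (simp add: K_def power_int_add)
  have G0: "poly ?G 0 \<noteq> 0"
    using assms(4) by (induction bs) (auto simp: poly_binomial_factor_0 assms(3))
  have "K = 0"
  proof (rule ccontr)
    assume "K \<noteq> 0"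
    then consider "K > 0" | "K < 0" by linarith
    then show False
    proof cases
      case 1
      have "f = monom \<mu> (nat K) * ?G"
        using f 1 by (intro poly_eq_if_eq_off_0) (simp add: poly_monom power_int_def)
      then have "poly f 0 = 0" using 1 by (simp add: poly_monom)
      then show False using assms(5) by simp
    next
      case 2
      have "monom 1 (nat (- K)) * f = Polynomial.smult \<mu> ?G"
      proof (rule poly_eq_if_eq_off_0)
        fix \<tau> :: complex assume \<tau>: "\<tau> \<noteq> 0"
        then show "poly (monom 1 (nat (- K)) * f) \<tau> = poly (Polynomial.smult \<mu> ?G) \<tau>"
          using f[OF \<tau>] 2 by (simp add: poly_monom power_int_def field_simps)
      qed
      then have "poly (monom 1 (nat (- K)) * f) 0 = poly (Polynomial.smult \<mu> ?G) 0" by simp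
      then have "\<mu> * poly ?G 0 = 0" using 2 by (simp add: poly_monom power_0_left)
      then show False using G0 assms(2) by simp
    qed
  qed
  then show ?thesis using f by (intro poly_eq_if_eq_off_0) simp
qed

text \<open>A constant is not a binomial, so \<mu> is absorbed into one of the factors; this is why
  the list must be nonempty.\<close>

lemma factors_into_binomials_prod:
  assumes "bs \<noteq> []" "set bs \<subseteq> unit_monomials m lam" "\<mu> \<in> unit_monomials m lam" "\<kappa> \<noteq> 0"
    and lam: "\<forall>i\<in>{1..m}. lam i \<noteq> 0"
  shows "factors_into_binomials (int_adjoin m lam)
    (Polynomial.smult \<mu> (\<Prod>\<beta>\<leftarrow>bs. binomial_factor \<kappa> \<beta>))"
proof -
  let ?U = "unit_monomials m lam"
  obtain b bs' where bs: "bs = b # bs'" using assms(1) by (cases bs) auto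
  have good: "binomial_poly (Polynomial.smult \<nu> (binomial_factor \<kappa> \<beta>)) \<and>
      (\<forall>k. coeff (Polynomial.smult \<nu> (binomial_factor \<kappa> \<beta>)) k \<in> int_adjoin m lam)"
    if "\<beta> \<in> ?U" "\<nu> \<in> ?U" for \<beta> \<nu>
  proof (intro conjI allI)
    have nz: "\<beta> \<noteq> 0" "\<nu> \<noteq> 0" using that unit_monomials_nonzero lam by blast+
    have "{k. coeff (Polynomial.smult \<nu> (binomial_factor \<kappa> \<beta>)) k \<noteq> 0} = {0, nat \<bar>\<kappa>\<bar>}"
      using coeff_binomial_factor_nonzero[OF assms(4) nz(1)] nz(2) by simp
    then show "binomial_poly (Polynomial.smult \<nu> (binomial_factor \<kappa> \<beta>))"
      unfolding binomial_poly_def using assms(4) by simp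
    fix k
    have "coeff (binomial_factor \<kappa> \<beta>) k \<in> {0, 1, \<beta>, - \<beta>}"
      using assms(4) by (auto simp: binomial_factor_def coeff_pCons split: nat.splits)
    then have "coeff (binomial_factor \<kappa> \<beta>) k = 0 \<or> coeff (binomial_factor \<kappa> \<beta>) k \<in> ?U"
      using that(1) unit_monomials_uminus[OF that(1)] sign_in_unit_monomials[of 1] by auto
    then show "coeff (Polynomial.smult \<nu> (binomial_factor \<kappa> \<beta>)) k \<in> int_adjoin m lam"
      using that(2) unit_monomials_int_adjoin zero_in_int_adjoin unit_monomials_mult by fastforce
  qed
  have one: "1 \<in> ?U" by (rule sign_in_unit_monomials) simp
  show ?thesis
    unfolding factors_into_binomials_def
  proof (intro exI conjI ballI)
    let ?gs = "Polynomial.smult \<mu> (binomial_factor \<kappa> b) # map (binomial_factor \<kappa>) bs'"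
    show "Polynomial.smult \<mu> (\<Prod>\<beta>\<leftarrow>bs. binomial_factor \<kappa> \<beta>) = prod_list ?gs" by (simp add: bs)
    fix g assume "g \<in> set ?gs"
    then obtain \<beta> \<nu> where "\<beta> \<in> ?U" "\<nu> \<in> ?U" "g = Polynomial.smult \<nu> (binomial_factor \<kappa> \<beta>)"
    proof -
      assume hyp: "\<And>\<beta> \<nu>. \<beta> \<in> ?U \<Longrightarrow> \<nu> \<in> ?U \<Longrightarrow> g = Polynomial.smult \<nu> (binomial_factor \<kappa> \<beta>) \<Longrightarrow> thesis"
      consider "g = Polynomial.smult \<mu> (binomial_factor \<kappa> b)" | \<beta> where "\<beta> \<in> set bs'" "g = binomial_factor \<kappa> \<beta>"
        using \<open>g \<in> set ?gs\<close> by auto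
      then show thesis
      proof cases
        case 1
        then show ?thesis using hyp[of b \<mu>] assms(2,3) bs by auto
      next
        case 2
        then show ?thesis using hyp[of \<beta> 1] assms(2) one bs by auto
      qed
    qed
    then show "binomial_poly g" "\<forall>k. coeff g k \<in> int_adjoin m lam" using good by blast+
  qed
qed

lemma cmod_root_prod_binomial_factors:
  assumes "poly (Polynomial.smult \<mu> (\<Prod>\<beta>\<leftarrow>bs. binomial_factor \<kappa> \<beta>)) \<tau> = 0" "\<mu> \<noteq> 0" "\<kappa> \<noteq> 0"
    and "\<And>\<beta>. \<beta> \<in> set bs \<Longrightarrow> cmod \<beta> = 1"
  shows "cmod \<tau> = 1"
proof -
  have "poly (\<Prod>\<beta>\<leftarrow>bs. binomial_factor \<kappa> \<beta>) \<tau> = 0" using assms(1,2) by simp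
  then have "\<exists>\<beta>\<in>set bs. poly (binomial_factor \<kappa> \<beta>) \<tau> = 0" by (induction bs) auto
  then show ?thesis using root_binomial_factor assms(3,4) by blast
qed

text \<open>The curve X = \<tau>^a, Y = \<tau>^b stays in the region X, Y \<noteq> 0 and satisfies
  X^u Y^v = \<tau>. Along it the initial form becomes a power of \<tau> times f(\<tau>).\<close>

lemma powi_solve:
  fixes u v :: int and \<tau> :: complex
  assumes "a * u + b * v = 1" "\<tau> \<noteq> 0"
  shows "(\<tau> powi a) powi u * (\<tau> powi b) powi v = \<tau>"
  using assms by (simp flip: power_int_mult power_int_add)

lemma eval2_quiver_A_poly:
  "eval2 (quiver_A_poly lam A) x y = mpoly_eval A (\<lambda>k. if k = 0 then y else lam k * x)"
proof -
  have "comm_ring_hom (\<lambda>P :: complex poly poly. poly (poly P [:y:]) x)" by unfold_locales auto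
  then have "eval2 (quiver_A_poly lam A) x y =
      mpoly_eval A (\<lambda>k. poly (poly (if k = 0 then [:0, 1:] else [:[:0, lam k:]:]) [:y:]) x)"
    unfolding eval2_def quiver_A_poly_def by (rule mpoly_eval_comp_hom)
  also have "(\<lambda>k. poly (poly (if k = 0 then [:0, 1:] else [:[:0, lam k:]:]) [:y:]) x) =
      (\<lambda>k. if k = 0 then y else lam k * x)" by auto
  finally show ?thesis .
qed

lemma initial_form_scale:
  assumes "t > 0"
  shows "initial_form P (t * p) (t * q) (t * M) X Y = initial_form P p q M X Y"
proof -
  have "t * p * real i + t * q * real j = t * M \<longleftrightarrow> p * real i + q * real j = M" for i j
  proof -
    have "t * p * real i + t * q * real j = t * (p * real i + q * real j)" by (simp add: algebra_simps)
    then show ?thesis using assms by simp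
  qed
  then show ?thesis unfolding initial_form_def by simp
qed

text \<open>On the diagonal X = Y = z each factor becomes 1 - \<beta> z^(g+h) with g + h > 0, which
  is a nonzero polynomial. The extra factor \<open>monom 1 1\<close> keeps z away from 0.\<close>

lemma binomial_product_nonzero:
  assumes "binomial_product (unit_monomials m lam) g h L" "(g, h) \<noteq> (0, 0)" "\<forall>i\<in>{1..m}. lam i \<noteq> 0"
  shows "\<exists>X Y. X \<noteq> 0 \<and> Y \<noteq> 0 \<and> L X Y \<noteq> 0"
proof -
  obtain \<mu> a b bs where L: "\<mu> \<in> unit_monomials m lam"
    "\<And>X Y. L X Y = \<mu> * X ^ a * Y ^ b * (\<Prod>\<beta>\<leftarrow>bs. 1 - \<beta> * (X ^ g * Y ^ h))"
    using assms(1) unfolding binomial_product_def by blast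
  let ?q = "monom 1 1 * (\<Prod>\<beta>\<leftarrow>bs. 1 - monom \<beta> (g + h)) :: complex poly"
  have "1 - monom \<beta> (g + h) \<noteq> (0 :: complex poly)" for \<beta>
  proof
    assume "1 - monom \<beta> (g + h) = (0 :: complex poly)"
    then have "coeff (1 - monom \<beta> (g + h)) 0 = 0" by simp
    then show False using assms(2) by (auto split: if_splits)
  qed
  then have "?q \<noteq> 0" by (auto simp: prod_list_zero_iff)
  then obtain z where z: "poly ?q z \<noteq> 0" using poly_all_0_iff_0 by blast
  have "poly (\<Prod>\<beta>\<leftarrow>bs. 1 - monom \<beta> (g + h)) z = (\<Prod>\<beta>\<leftarrow>bs. 1 - \<beta> * (z ^ g * z ^ h))"
    by (induction bs) (auto simp: poly_monom power_add)
  then have "z \<noteq> 0" "(\<Prod>\<beta>\<leftarrow>bs. 1 - \<beta> * (z ^ g * z ^ h)) \<noteq> 0" using z by (auto simp: poly_monom)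
  then show ?thesis
    using unit_monomials_nonzero[OF L(1) assms(3)] unfolding L(2) by (intro exI[of _ z]) auto
qed

text \<open>The limit L and the initial form agree for X, Y \<noteq> 0. Comparing them along the
  curve with X^u Y^v = \<tau> transfers the binomial factors of L to f.\<close>

lemma quiver_face_poly_binomials:
  fixes m \<alpha> :: nat and lam :: "nat \<Rightarrow> complex" and A :: int_mpoly
  assumes "m \<ge> 1" "\<alpha> \<ge> 2" and lam: "\<forall>i\<in>{1..m}. lam i \<noteq> 0"
    and "is_quiver_resultant m (\<lambda>i j. if i = j then int \<alpha> else 0) A"
    and face: "is_face_poly (quiver_A_poly lam A) e f"
  shows "\<exists>\<mu> \<kappa> bs. bs \<noteq> [] \<and> set bs \<subseteq> unit_monomials m lam \<and> \<mu> \<in> unit_monomials m lam \<and> \<kappa> \<noteq> 0 \<and>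
    f = Polynomial.smult \<mu> (\<Prod>\<beta>\<leftarrow>bs. binomial_factor \<kappa> \<beta>)"
proof -
  let ?P = "quiver_A_poly lam A" and ?U = "unit_monomials m lam"
  obtain c :: complex where c: "c = 1 \<or> c = -1"
    and fac: "\<And>v. v 0 \<noteq> 0 \<Longrightarrow> \<exists>r. (\<forall>i\<in>{1..m}. trinomial_roots \<alpha> (v i) (r i)) \<and>
      mpoly_eval A v = c * (\<Prod>k\<in>index_set m \<alpha>. 1 - v 0 * (\<Prod>i\<in>{1..m}. r i (k i)))"
    using quiver_resultant_factorization[OF assms(2,4)] by blast
  have E: "\<exists>r. (\<forall>i\<in>{1..m}. trinomial_roots \<alpha> (lam i * x) (r i)) \<and>
      eval2 ?P x y = c * (\<Prod>k\<in>index_set m \<alpha>. 1 - y * (\<Prod>i\<in>{1..m}. r i (k i)))" if "y \<noteq> 0" for x y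
  proof -
    let ?v = "\<lambda>k. if k = 0 then y else lam k * x"
    have "?v 0 \<noteq> 0" using that by simp
    then obtain r where r: "\<forall>i\<in>{1..m}. trinomial_roots \<alpha> (?v i) (r i)"
      "mpoly_eval A ?v = c * (\<Prod>k\<in>index_set m \<alpha>. 1 - ?v 0 * (\<Prod>i\<in>{1..m}. r i (k i)))"
      using fac[of ?v] by blast
    have "\<forall>i\<in>{1..m}. trinomial_roots \<alpha> (lam i * x) (r i)" using r(1) by auto
    then show ?thesis using r(2) unfolding eval2_quiver_A_poly by auto
  qed
  obtain p0 q0 M0 u v a b where pq0: "(p0, q0) \<noteq> (0 :: real, 0)" and uv: "coprime u v"
    and perp0: "p0 * real_of_int u + q0 * real_of_int v = 0"
    and le0': "\<forall>(i, j)\<in>support2 ?P. p0 * real i + q0 * real j \<le> M0"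
    and init0: "\<forall>X Y. X \<noteq> 0 \<longrightarrow> Y \<noteq> 0 \<longrightarrow>
      initial_form ?P p0 q0 M0 X Y = X ^ a * Y ^ b * poly f (X powi u * Y powi v)"
    and f0: "poly f 0 \<noteq> 0" and deg: "degree f \<noteq> 0"
    using face_poly_initial_form[OF face] by (elim exE conjE) (rule that)
  have le0: "p0 * real i + q0 * real j \<le> M0" if "(i, j) \<in> support2 ?P" for i j
    using le0' that by auto
  \<comment> \<open>The positive factor that turns p0 into one of the three normalised values; 1 -
    \<alpha> is negative, matching p0 < 0.\<close>
  define t where "t = (if p0 > 0 then real \<alpha> / p0 else if p0 < 0 then (1 - real \<alpha>) / p0 else 1)"
  have t: "t > 0" using assms(2) by (auto simp: t_def intro: divide_neg_neg)
  define p q M where "p = t * p0" and "q = t * q0" and "M = t * M0"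
  have pcase: "p = real \<alpha> \<or> p = 1 - real \<alpha> \<or> p = 0 \<and> q \<noteq> 0"
    using pq0 t by (auto simp: p_def q_def t_def)
  have pq: "(p, q) \<noteq> (0, 0)" using pq0 t by (auto simp: p_def q_def)
  have perp: "p * real_of_int u + q * real_of_int v = 0"
  proof -
    have "p * real_of_int u + q * real_of_int v = t * (p0 * real_of_int u + q0 * real_of_int v)"
      by (simp add: p_def q_def algebra_simps)
    then show ?thesis using perp0 by simp
  qed
  have le: "p * real i + q * real j \<le> M" if "(i, j) \<in> support2 ?P" for i j
  proof -
    have "t * (p0 * real i + q0 * real j) \<le> t * M0" using le0[OF that] t by simp
    then show ?thesis by (simp add: p_def q_def M_def algebra_simps)
  qed
  have init: "initial_form ?P p q M X Y = X ^ a * Y ^ b * poly f (X powi u * Y powi v)"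
    if "X \<noteq> 0" "Y \<noteq> 0" for X Y
    using init0 that t by (simp add: p_def q_def M_def initial_form_scale)
  obtain a' b' where bez: "a' * u + b' * v = 1" using uv bezout_int[of u v] by auto
  have solve: "\<tau> powi a' \<noteq> 0" "\<tau> powi b' \<noteq> 0" "(\<tau> powi a') powi u * (\<tau> powi b') powi v = \<tau>" if "\<tau> \<noteq> 0" for \<tau> :: complex
    using that powi_solve[OF bez that] by auto
  have "f \<noteq> 0" using f0 by auto
  then have "finite (insert 0 {\<tau>. poly f \<tau> = 0})" using poly_roots_finite by blast
  from ex_new_if_finite[OF infinite_UNIV_char_0 this]
  obtain \<tau>1 where \<tau>1: "\<tau>1 \<noteq> 0" "poly f \<tau>1 \<noteq> 0" by auto
  have in_nz: "initial_form ?P p q M (\<tau>1 powi a') (\<tau>1 powi b') \<noteq> 0"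
    using init[OF solve(1,2)[OF \<tau>1(1)]] solve[OF \<tau>1(1)] \<tau>1(2) by simp
  obtain N L where L: "\<And>X Y. X \<noteq> 0 \<Longrightarrow> Y \<noteq> 0 \<Longrightarrow> scaled_limit (eval2 ?P) p q N X Y (L X Y)"
    and Lcase: "(\<forall>X Y. X \<noteq> 0 \<longrightarrow> Y \<noteq> 0 \<longrightarrow> L X Y \<noteq> 0) \<or>
     (\<exists>g h. (g, h) \<noteq> (0, 0) \<and> p * real g + q * real h = 0 \<and> binomial_product ?U g h L)"
    using scaled_limit_exists[OF assms(2,1) lam c E pcase] by blast
  have "\<exists>X Y. X \<noteq> 0 \<and> Y \<noteq> 0 \<and> L X Y \<noteq> 0"
    using Lcase
  proof
    assume "\<forall>X Y. X \<noteq> 0 \<longrightarrow> Y \<noteq> 0 \<longrightarrow> L X Y \<noteq> 0"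
    then have "L 1 1 \<noteq> 0" by simp
    then show ?thesis by (intro exI[of _ 1]) simp
  next
    assume "\<exists>g h. (g, h) \<noteq> (0, 0) \<and> p * real g + q * real h = 0 \<and> binomial_product ?U g h L"
    then show ?thesis using binomial_product_nonzero[OF _ _ lam] by blast
  qed
  then obtain X2 Y2 where L_nz: "X2 \<noteq> 0" "Y2 \<noteq> 0" "L X2 Y2 \<noteq> 0" by blast
  have eq: "X ^ a * Y ^ b * poly f (X powi u * Y powi v) = L X Y" if "X \<noteq> 0" "Y \<noteq> 0" for X Y
    using initial_form_eq_scaled_limit[OF le L solve(1,2)[OF \<tau>1(1)] in_nz L_nz that] init[OF that] by simp
  have nonconst: "\<exists>\<tau>. poly f \<tau> = 0"
    using deg by (intro fundamental_theorem_of_algebra) (simp add: constant_degree)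
  \<comment> \<open>A root of f, nonzero as f(0) \<noteq> 0, yields a zero of L with X, Y \<noteq>
    0. This excludes the nonvanishing alternative, in particular the weights with p = 0.\<close>
  then obtain \<tau>0 where \<tau>0: "poly f \<tau>0 = 0" by blast
  then have \<tau>0_nz: "\<tau>0 \<noteq> 0" using f0 by auto
  have "L (\<tau>0 powi a') (\<tau>0 powi b') = 0"
    using eq[OF solve(1,2)[OF \<tau>0_nz]] solve(3)[OF \<tau>0_nz] \<tau>0 by simp
  then obtain g h where gh: "(g, h) \<noteq> (0, 0)" "p * real g + q * real h = 0" "binomial_product ?U g h L"
    using Lcase solve(1,2)[OF \<tau>0_nz] by blast
  obtain \<mu> aa bb bs where \<mu>: "\<mu> \<in> ?U" and bs: "set bs \<subseteq> ?U"
    and Lform: "\<And>X Y. L X Y = \<mu> * X ^ aa * Y ^ bb * (\<Prod>\<beta>\<leftarrow>bs. 1 - \<beta> * (X ^ g * Y ^ h))"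
    using gh(3) unfolding binomial_product_def by blast
  \<comment> \<open>Both (g, h) and (u, v) are orthogonal to the nonzero vector (p, q), hence
    parallel.\<close>
  have gv: "int g * v = int h * u"
  proof -
    have "p * (real g * of_int v - real h * of_int u) =
        (p * real g + q * real h) * of_int v - (p * of_int u + q * of_int v) * real h"
      by (simp add: algebra_simps)
    moreover have "q * (real g * of_int v - real h * of_int u) =
        (p * of_int u + q * of_int v) * real g - (p * real g + q * real h) * of_int u"
      by (simp add: algebra_simps)
    ultimately have "real g * of_int v - real h * of_int u = 0"
      using pq gh(2) perp by auto
    then have "real_of_int (int g * v) = real_of_int (int h * u)" by simp
    then show ?thesis by linarith
  qed
  \<comment> \<open>Since (u, v) is primitive, (g, h) = \<kappa> (u, v) with an integer \<kappa>; it
    is negative when the edge is traversed in the opposite direction.\<close>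
  define \<kappa> where "\<kappa> = a' * int g + b' * int h"
  have "\<kappa> * u = int g * (a' * u + b' * v)" "\<kappa> * v = int h * (a' * u + b' * v)"
    using gv by (simp_all add: \<kappa>_def algebra_simps)
  then have "int g = \<kappa> * u" "int h = \<kappa> * v" using bez by simp_all
  then have \<kappa>: "\<kappa> \<noteq> 0" using gh(1) by auto
  have "poly f \<tau> = \<mu> * \<tau> powi (a' * int aa + b' * int bb - a' * int a - b' * int b) * (\<Prod>\<beta>\<leftarrow>bs. 1 - \<beta> * \<tau> powi \<kappa>)"
    if \<tau>: "\<tau> \<noteq> 0" for \<tau>
  proof -
    have pw: "(\<tau> powi a') ^ i * (\<tau> powi b') ^ j = \<tau> powi (a' * int i + b' * int j)" for i j
      using \<tau> by (simp add: power_int_add power_int_mult)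
    have "(\<tau> powi a') ^ a * (\<tau> powi b') ^ b * poly f \<tau> =
        \<mu> * ((\<tau> powi a') ^ aa * (\<tau> powi b') ^ bb) * (\<Prod>\<beta>\<leftarrow>bs. 1 - \<beta> * ((\<tau> powi a') ^ g * (\<tau> powi b') ^ h))"
      using eq[OF solve(1,2)[OF \<tau>]] solve(3)[OF \<tau>] unfolding Lform by (simp add: mult.assoc)
    then have main: "\<tau> powi (a' * int a + b' * int b) * poly f \<tau> =
        \<mu> * \<tau> powi (a' * int aa + b' * int bb) * (\<Prod>\<beta>\<leftarrow>bs. 1 - \<beta> * \<tau> powi \<kappa>)"
      unfolding pw \<kappa>_def .
    have "\<tau> powi (a' * int aa + b' * int bb) =
        \<tau> powi (a' * int a + b' * int b) * \<tau> powi (a' * int aa + b' * int bb - a' * int a - b' * int b)"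
      using \<tau> by (simp flip: power_int_add)
    then have "\<tau> powi (a' * int a + b' * int b) * poly f \<tau> = \<tau> powi (a' * int a + b' * int b) *
        (\<mu> * \<tau> powi (a' * int aa + b' * int bb - a' * int a - b' * int b) * (\<Prod>\<beta>\<leftarrow>bs. 1 - \<beta> * \<tau> powi \<kappa>))"
      using main by (simp add: mult_ac)
    then show ?thesis using \<tau> by simp
  qed
  then have f: "f = Polynomial.smult \<mu> (\<Prod>\<beta>\<leftarrow>bs. binomial_factor \<kappa> \<beta>)"
  proof (rule poly_eq_prod_binomial_factors)
    show "\<mu> \<noteq> 0" using unit_monomials_nonzero[OF \<mu> lam] .
    show "0 \<notin> set bs" using bs unit_monomials_nonzero lam by blast
  qed (use \<kappa> f0 in auto)
  have "bs \<noteq> []"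
  proof
    assume "bs = []"
    then have "degree f = 0" unfolding f by simp
    then show False using deg by simp
  qed
  then show ?thesis using bs \<mu> \<kappa> f by blast
qed

text \<open>The roots of 1 - \<beta> \<tau>^\<kappa> have modulus 1 exactly when \<beta> does. On
  the edge belonging to x \<rightarrow> \<infinity>, \<beta> is up to sign the product of all
  \<open>lam i\<close>, so its modulus depends on theirs. For this reason temperedness is stated for
  \<open>lam i\<close> of modulus 1, while the factorization holds for all nonzero
  \<open>lam i\<close>.\<close>

theorem mainTheorem1:
  fixes m \<alpha> :: nat and lam :: "nat \<Rightarrow> complex" and A :: int_mpoly
  assumes "m \<ge> 2" and "\<alpha> \<ge> 2"
    and "\<forall>i\<in>{1..m}. lam i \<noteq> 0"
    and "is_quiver_resultant m (\<lambda>i j. if i = j then int \<alpha> else 0) A"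
  shows "((\<forall>i\<in>{1..m}. cmod (lam i) = 1) \<longrightarrow> tempered (quiver_A_poly lam A)) \<and>
         (\<forall>e f. is_face_poly (quiver_A_poly lam A) e f \<longrightarrow>
                factors_into_binomials (int_adjoin m lam) f)"
proof (intro conjI impI allI)
  have "m \<ge> 1" using assms(1) by simp
  note face = quiver_face_poly_binomials[OF this assms(2-4)]
  show "tempered (quiver_A_poly lam A)" if unit: "\<forall>i\<in>{1..m}. cmod (lam i) = 1"
    unfolding tempered_def
  proof (intro allI impI)
    fix e f \<tau> assume f: "is_face_poly (quiver_A_poly lam A) e f" and \<tau>: "poly f \<tau> = 0"
    obtain \<mu> \<kappa> bs where *: "set bs \<subseteq> unit_monomials m lam" "\<mu> \<in> unit_monomials m lam" "\<kappa> \<noteq> 0"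
      "f = Polynomial.smult \<mu> (\<Prod>\<beta>\<leftarrow>bs. binomial_factor \<kappa> \<beta>)"
      using face[OF f] by blast
    show "cmod \<tau> = 1"
    proof (rule cmod_root_prod_binomial_factors[OF \<tau>[unfolded *(4)] _ *(3)])
      show "\<mu> \<noteq> 0" by (rule unit_monomials_nonzero[OF *(2) assms(3)])
      show "cmod \<beta> = 1" if "\<beta> \<in> set bs" for \<beta>
        using that *(1) unit_monomials_cmod[OF _ unit] by blast
    qed
  qed
  fix e f assume "is_face_poly (quiver_A_poly lam A) e f"
  from face[OF this] obtain \<mu> \<kappa> bs where "bs \<noteq> []" "set bs \<subseteq> unit_monomials m lam"
    "\<mu> \<in> unit_monomials m lam" "\<kappa> \<noteq> 0" "f = Polynomial.smult \<mu> (\<Prod>\<beta>\<leftarrow>bs. binomial_factor \<kappa> \<beta>)"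
    by blast
  then show "factors_into_binomials (int_adjoin m lam) f"
    using factors_into_binomials_prod assms(3) by blast
qed

end
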